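(* Let $d_L\ge2$, let $\tau:=I_L/d_L$ be the maximally mixed state on $\mathcal H_L=\mathbb C^{d_L}$, and for $0\le p<1$ let $\mathcal N_p$ be the noise channel defined in the context. Then, as $p\to0^+$, $$\Delta^{\mathrm{opt}}(\tau,\mathcal N_p)=\frac{d_L-1}{4(d_L^2-1)^2}\,p^2+o(p^2),$$ and consequently, since $\varepsilon^{\mathrm{opt}}(\tau,\mathcal N_p)=p/(d_L^2-2)$, $$\kappa^{(2)}:=\lim_{p\to0^+}\frac{\Delta^{\mathrm{opt}}(\tau,\mathcal N_p)}{\varepsilon^{\mathrm{opt}}(\tau,\mathcal N_p)^2}=\frac{d_L-1}{4}\left(\frac{d_L^2-2}{d_L^2-1}\right)^2.$$
   Context: $\mathsf L(\mathcal H)$ is the space of linear operators on $\mathcal H$. CPTNI means completely positive and trace-non-increasing ($\sum_jL_j^\dagger L_j\preceq I$ for Kraus operators $L_j$). For a completely positive map $\Phi$ on $\mathsf L(\mathcal H_L)$ with Kraus operators $F_j$, $F_{\mathrm e}(\rho,\Phi):=\sum_j|\operatorname{tr}(\rho F_j)|^2$. The Choi rank $r_{\mathcal C}$ of $\mathcal C$ is the minimum number of its Kraus operators. For a noise map $\mathcal N$ on $\mathsf L(\mathcal H_C)$, $$F^{\mathrm{opt}}(\rho,\mathcal N):=\max_{\mathcal C,\mathcal D}F_{\mathrm e}(\rho,\mathcal D\circ\mathcal N\circ\mathcal C),\qquad F_1^{\mathrm{opt}}(\rho,\mathcal N):=\max_{\mathcal C,\mathcal D:\,r_{\mathcal C}\le1}F_{\mathrm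 e}(\rho,\mathcal D\circ\mathcal N\circ\mathcal C),$$ over CPTNI maps $\mathcal C:\mathsf L(\mathcal H_L)\to\mathsf L(\mathcal H_C)$, $\mathcal D:\mathsf L(\mathcal H_C)\to\mathsf L(\mathcal H_L)$; $\varepsilon^{\mathrm{opt}}:=1-F^{\mathrm{opt}}$, $\Delta^{\mathrm{opt}}:=F^{\mathrm{opt}}-F_1^{\mathrm{opt}}$. Input-first vectorization: for $M:\mathcal H_1\to\mathcal H_2$, $|M\rangle\!\rangle:=\sum_i|i\rangle\otimes M|i\rangle\in\mathcal H_1\otimes\mathcal H_2$; the Choi matrix of a map with Kraus operators $L_j$ is $J=\sum_j|L_j\rangle\!\rangle\langle\!\langle L_j|$ (extended linearly to all linear maps). $\mathcal N^\dagger$ is the Hilbert–Schmidt adjoint of $\mathcal N$. Construction. $\mathcal H_S=\mathbb C^{d_L}$, $\mathcal H_C=\mathcal H_L\otimes\mathcal H_S$ (so $d_C=d_L^2$), $|\psi_\tau\rangle:=d_L^{-1/2}\sum_{i=0}^{d_L-1}|i\rangle_L\otimes|i\rangle_S$, $\hat\pi_C:=|\psi_\tau\rangle\langle\psi_\tau|$. For $0\le p<1$ set $$\lambda_1:=1-\tfrac{p}{d_L^2-2},\quad\lambda_4:=\tfrac{d_L^2-1+p}{d_L^2},\quad\lambda_5:=\tfrac{1-p}{d_L^2},\quad\lambda_2:=\tfrac{(1-\lambda_1)(d_L^2\lambda_1-1)}{d_L^2\lambda_4},\quad\lambda_3:=\tfrac{2(1-\lambda_1)^2}{d_L^2\lambda_4},$$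 $$Q_p:=\sqrt{d_L}\Big[\sqrt{\tfrac{\lambda_4}{d_L^2-1}}\,(I_C-\hat\pi_C)+\sqrt{\lambda_5}\,\hat\pi_C\Big].$$ Let $B_{ij}(p):=Q_p(I_L\otimes|i\rangle_S\langle j|_S)\in\mathsf L(\mathcal H_C)$; let $P_p$ be the orthogonal projector onto $\operatorname{span}\{|B_{ij}(p)\rangle\!\rangle\}_{i,j=0}^{d_L-1}\subseteq\mathcal H_C\otimes\mathcal H_C$, $P_p^\perp:=I_{C\otimes C}-P_p$, and $X_p:=\lambda_3I_C+\frac{\lambda_2}{\lambda_4}\hat\pi_C$. The noise map $\mathcal N_p:\mathsf L(\mathcal H_C)\to\mathsf L(\mathcal H_C)$, a quantum channel, is defined by $$J(\mathcal N_p^\dagger)=\lambda_1P_p+P_p^\perp(I_C\otimes X_p)P_p^\perp.$$ *)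

theory Defs
  imports "HOL-Analysis.Analysis" "HOL-Library.Landau_Symbols"
begin

text \<open>
  The Hilbert space with orthonormal basis \<open>|i\<rangle>\<close>, \<open>i :: 'a\<close>, is \<open>complex ^ 'a\<close>, and an operator from
  \<open>complex ^ 'a\<close> to \<open>complex ^ 'b\<close> is a matrix of type \<open>complex ^ 'a ^ 'b\<close>.  A tensor product is
  indexed by the product of the index types.  The inner product of HOL-Analysis is the real one, so
  the complex one is introduced here, conjugate-linear in its first argument.
\<close>

section \<open>Operators on finite-dimensional Hilbert spaces\<close>

definition cdot :: "complex ^ 'a \<Rightarrow> complex ^ 'a \<Rightarrow> complex" where
  "cdot v w = (\<Sum>i\<in>UNIV. cnj (v $ i) * w $ i)"

definition adj :: "complex ^ 'a ^ 'b \<Rightarrow> complex ^ 'b ^ 'a" where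
  "adj A = (\<chi> i j. cnj (A $ j $ i))"

definition mscale :: "complex \<Rightarrow> complex ^ 'a ^ 'b \<Rightarrow> complex ^ 'a ^ 'b" where
  "mscale c A = (\<chi> i j. c * A $ i $ j)"

definition ket :: "'a \<Rightarrow> complex ^ 'a" where
  "ket i = axis i 1"

text \<open>\<open>outer v w\<close> is \<open>|v\<rangle>\<langle>w|\<close>.\<close>

definition outer :: "complex ^ 'b \<Rightarrow> complex ^ 'a \<Rightarrow> complex ^ 'a ^ 'b" where
  "outer v w = (\<chi> i j. v $ i * cnj (w $ j))"

definition vtensor :: "complex ^ 'a \<Rightarrow> complex ^ 'b \<Rightarrow> complex ^ ('a::finite \<times> 'b::finite)" where
  "vtensor v w = (\<chi> i. v $ fst i * w $ snd i)"

definition mtensor ::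
  "complex ^ 'a ^ 'c \<Rightarrow> complex ^ 'b ^ 'd \<Rightarrow> complex ^ ('a::finite \<times> 'b::finite) ^ ('c \<times> 'd)" where
  "mtensor A B = (\<chi> i j. A $ fst i $ fst j * B $ snd i $ snd j)"

text \<open>Over the complex numbers a nonnegative quadratic form forces the matrix to be Hermitian.\<close>

definition psd :: "complex ^ 'a ^ 'a \<Rightarrow> bool" where
  "psd A \<longleftrightarrow> (\<forall>v. cdot v (A *v v) \<in> \<real>\<^sub>\<ge>\<^sub>0)"

definition loewner_le :: "complex ^ 'a ^ 'a \<Rightarrow> complex ^ 'a ^ 'a \<Rightarrow> bool" where
  "loewner_le A B \<longleftrightarrow> psd (B - A)"

definition ortho_projector :: "(complex ^ 'a) set \<Rightarrow> complex ^ 'a ^ 'a" where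
  "ortho_projector V = (THE P. P ** P = P \<and> adj P = P \<and> range (\<lambda>v. P *v v) = V)"

section \<open>Maps between operator spaces\<close>

type_synonym ('a, 'b) supermap = "complex ^ 'a ^ 'a \<Rightarrow> complex ^ 'b ^ 'b"

definition clinear_map :: "('a::finite, 'b::finite) supermap \<Rightarrow> bool" where
  "clinear_map \<Phi> \<longleftrightarrow>
     (\<forall>X Y. \<Phi> (X + Y) = \<Phi> X + \<Phi> Y) \<and> (\<forall>c X. \<Phi> (mscale c X) = mscale c (\<Phi> X))"

text \<open>
  An operator on \<open>\<complex>\<^sup>n \<otimes> \<H>\<close> is given by its \<open>n \<times> n\<close> blocks \<open>X i j\<close>, which are operators on \<open>\<H>\<close>;
  \<open>id \<otimes> \<Phi>\<close> then acts blockwise.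
\<close>

definition block_psd :: "nat \<Rightarrow> (nat \<Rightarrow> nat \<Rightarrow> complex ^ 'a ^ 'a) \<Rightarrow> bool" where
  "block_psd n X \<longleftrightarrow>
     (\<forall>v :: nat \<Rightarrow> complex ^ 'a. (\<Sum>i<n. \<Sum>j<n. cdot (v i) (X i j *v v j)) \<in> \<real>\<^sub>\<ge>\<^sub>0)"

definition completely_positive :: "('a::finite, 'b::finite) supermap \<Rightarrow> bool" where
  "completely_positive \<Phi> \<longleftrightarrow>
     clinear_map \<Phi> \<and> (\<forall>n X. block_psd n X \<longrightarrow> block_psd n (\<lambda>i j. \<Phi> (X i j)))"

definition kraus_ops :: "('a::finite, 'b::finite) supermap \<Rightarrow> (complex ^ 'a ^ 'b) list \<Rightarrow> bool" where
  "kraus_ops \<Phi> Ls \<longleftrightarrow> (\<forall>X. \<Phi> X = (\<Sum>L\<leftarrow>Ls. L ** X ** adj L))"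

text \<open>
  The operator \<open>\<Sum>\<^sub>j L\<^sub>j\<^sup>\<dagger> L\<^sub>j\<close> depends only on the map, so it does not matter which Kraus operators
  witness that the map is trace-non-increasing.
\<close>

definition trace_nonincreasing :: "('a::finite, 'b::finite) supermap \<Rightarrow> bool" where
  "trace_nonincreasing \<Phi> \<longleftrightarrow>
     (\<exists>Ls. kraus_ops \<Phi> Ls \<and> loewner_le (\<Sum>L\<leftarrow>Ls. adj L ** L) (mat 1))"

definition cptni :: "('a::finite, 'b::finite) supermap \<Rightarrow> bool" where
  "cptni \<Phi> \<longleftrightarrow> completely_positive \<Phi> \<and> trace_nonincreasing \<Phi>"

definition choi_rank :: "('a::finite, 'b::finite) supermap \<Rightarrow> nat" where
  "choi_rank \<Phi> = (LEAST r. \<exists>Ls. kraus_ops \<Phi> Ls \<and> length Ls = r)"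

text \<open>The sum is the same for all Kraus representations of \<open>\<Phi>\<close>.\<close>

definition ent_fidelity :: "complex ^ 'a ^ 'a \<Rightarrow> ('a::finite, 'a::finite) supermap \<Rightarrow> real" where
  "ent_fidelity \<rho> \<Phi> = (let Fs = (SOME Fs. kraus_ops \<Phi> Fs) in \<Sum>F\<leftarrow>Fs. (cmod (trace (\<rho> ** F)))\<^sup>2)"

definition hs_adjoint :: "('a::finite, 'b::finite) supermap \<Rightarrow> ('b::finite, 'a::finite) supermap" where
  "hs_adjoint \<Phi> = (THE \<Psi>. \<forall>X Y. trace (adj (\<Psi> Y) ** X) = trace (adj Y ** \<Phi> X))"

text \<open>Input-first vectorization \<open>|M\<rangle>\<rangle>\<close>.\<close>

definition vectorize :: "complex ^ 'a ^ 'b \<Rightarrow> complex ^ ('a::finite \<times> 'b::finite)" where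
  "vectorize M = (\<Sum>i\<in>UNIV. vtensor (ket i) (M *v ket i))"

text \<open>
  This is the linear extension of \<open>J = \<Sum>\<^sub>j |L\<^sub>j\<rangle>\<rangle>\<langle>\<langle>L\<^sub>j|\<close> to all linear maps: it is linear in \<open>\<Phi>\<close>, and it
  has the required value on \<open>X \<mapsto> \<Sum>\<^sub>j L\<^sub>j X L\<^sub>j\<^sup>\<dagger>\<close> by \<open>choi_kraus\<close> below.
\<close>

definition choi :: "('a::finite, 'b::finite) supermap \<Rightarrow> complex ^ ('a::finite \<times> 'b::finite) ^ ('a::finite \<times> 'b::finite)" where
  "choi \<Phi> = (\<Sum>i\<in>UNIV. \<Sum>j\<in>UNIV. mtensor (outer (ket i) (ket j)) (\<Phi> (outer (ket i) (ket j))))"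

lemma vectorize_nth: "vectorize M $ (i, k) = M $ k $ i"
proof -
  have "vectorize M $ (i, k) = (\<Sum>l\<in>UNIV. if l = i then (M *v ket l) $ k else 0)"
    unfolding vectorize_def vtensor_def by (auto simp: ket_def axis_def simp del: sum.delta sum.delta' intro!: sum.cong)
  moreover have "(M *v ket i) $ k = (\<Sum>l\<in>UNIV. if l = i then M $ k $ l else 0)"
    unfolding matrix_vector_mult_def
    by (auto simp: ket_def axis_def simp del: sum.delta sum.delta' intro!: sum.cong)
  ultimately show ?thesis by simp
qed

lemma choi_nth: "choi \<Phi> $ (i, k) $ (j, l) = \<Phi> (outer (ket i) (ket j)) $ k $ l"
proof -
  have ket_bra: "outer (ket a) (ket b) $ i $ j = (if b = j then if a = i then 1 else 0 else 0)"
    for a b by (auto simp: outer_def ket_def axis_def)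
  have "choi \<Phi> $ (i, k) $ (j, l) =
      (\<Sum>a\<in>UNIV. \<Sum>b\<in>UNIV. if b = j then (if a = i then \<Phi> (outer (ket a) (ket b)) $ k $ l else 0) else 0)"
    unfolding choi_def mtensor_def by (auto simp: ket_bra simp del: sum.delta sum.delta' intro!: sum.cong)
  then show ?thesis by simp
qed

lemma choi_sandwich: "choi (\<lambda>X. A ** X ** adj B) = outer (vectorize A) (vectorize B)"
proof -
  have "(A ** outer (ket i) (ket j) ** adj B) $ k $ l = A $ k $ i * cnj (B $ l $ j)" for i j k l
  proof -
    have "(A ** outer (ket i) (ket j)) $ k $ b = (if b = j then A $ k $ i else 0)" for b
    proof -
      have "(A ** outer (ket i) (ket j)) $ k $ b =
          (\<Sum>a\<in>UNIV. if a = i then A $ k $ a * (if b = j then 1 else 0) else 0)"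
        unfolding matrix_matrix_mult_def vec_lambda_beta
        by (rule sum.cong) (auto simp: outer_def ket_def axis_def)
      then show ?thesis by simp
    qed
    then have "(A ** outer (ket i) (ket j) ** adj B) $ k $ l =
        (\<Sum>b\<in>UNIV. if b = j then A $ k $ i * cnj (B $ l $ b) else 0)"
      unfolding matrix_matrix_mult_def [of "A ** outer (ket i) (ket j)"]
      by (auto simp: adj_def simp del: sum.delta sum.delta' intro!: sum.cong)
    then show ?thesis by simp
  qed
  then show ?thesis
    by (auto simp: vec_eq_iff choi_nth outer_def vectorize_nth)
qed

lemma choi_kraus:
  assumes "kraus_ops \<Phi> Ls"
  shows "choi \<Phi> = (\<Sum>L\<leftarrow>Ls. outer (vectorize L) (vectorize L))"
proof -
  have "choi (\<lambda>X. \<Sum>L\<leftarrow>Ls. L ** X ** adj L) = (\<Sum>L\<leftarrow>Ls. choi (\<lambda>X. L ** X ** adj L))"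
    by (induction Ls) (auto simp: vec_eq_iff choi_nth)
  moreover have "\<Phi> = (\<lambda>X. \<Sum>L\<leftarrow>Ls. L ** X ** adj L)"
    using assms by (auto simp: kraus_ops_def)
  ultimately show ?thesis by (simp add: choi_sandwich)
qed

section \<open>Optimal entanglement fidelities\<close>

text \<open>
  The suprema below are maxima: the trace-non-increasing completely positive maps, and those among
  them of Choi rank at most one, form compact sets on which the fidelity is continuous.
\<close>

definition F_opt :: "complex ^ 'l ^ 'l \<Rightarrow> ('c::finite, 'c::finite) supermap \<Rightarrow> real" where
  "F_opt \<rho> \<N> = Sup {ent_fidelity \<rho> (\<D> \<circ> \<N> \<circ> \<C>) |
     (\<C> :: ('l::finite, 'c::finite) supermap) (\<D> :: ('c::finite, 'l::finite) supermap). cptni \<C> \<and> cptni \<D>}"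

definition F1_opt :: "complex ^ 'l ^ 'l \<Rightarrow> ('c::finite, 'c::finite) supermap \<Rightarrow> real" where
  "F1_opt \<rho> \<N> = Sup {ent_fidelity \<rho> (\<D> \<circ> \<N> \<circ> \<C>) |
     (\<C> :: ('l::finite, 'c::finite) supermap) (\<D> :: ('c::finite, 'l::finite) supermap). cptni \<C> \<and> cptni \<D> \<and> choi_rank \<C> \<le> 1}"

definition eps_opt :: "complex ^ 'l ^ 'l \<Rightarrow> ('c::finite, 'c::finite) supermap \<Rightarrow> real" where
  "eps_opt \<rho> \<N> = 1 - F_opt \<rho> \<N>"

definition Delta_opt :: "complex ^ 'l ^ 'l \<Rightarrow> ('c::finite, 'c::finite) supermap \<Rightarrow> real" where
  "Delta_opt \<rho> \<N> = F_opt \<rho> \<N> - F1_opt \<rho> \<N>"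

section \<open>The noise channel\<close>

text \<open>
  The index type \<open>'n\<close> labels the bases of both \<open>\<H>\<^sub>L\<close> and \<open>\<H>\<^sub>S\<close>, so that \<open>d\<^sub>L = CARD('n)\<close> and
  \<open>\<H>\<^sub>C = \<H>\<^sub>L \<otimes> \<H>\<^sub>S = complex ^ ('n \<times> 'n)\<close>.  The parameter \<open>d\<close> of \<open>lam1\<close> to \<open>lam5\<close> is \<open>d\<^sub>L\<close>.
\<close>

definition lam1 :: "real \<Rightarrow> real \<Rightarrow> real" where
  "lam1 d p = 1 - p / (d\<^sup>2 - 2)"

definition lam4 :: "real \<Rightarrow> real \<Rightarrow> real" where
  "lam4 d p = (d\<^sup>2 - 1 + p) / d\<^sup>2"

definition lam5 :: "real \<Rightarrow> real \<Rightarrow> real" where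
  "lam5 d p = (1 - p) / d\<^sup>2"

definition lam2 :: "real \<Rightarrow> real \<Rightarrow> real" where
  "lam2 d p = (1 - lam1 d p) * (d\<^sup>2 * lam1 d p - 1) / (d\<^sup>2 * lam4 d p)"

definition lam3 :: "real \<Rightarrow> real \<Rightarrow> real" where
  "lam3 d p = 2 * (1 - lam1 d p)\<^sup>2 / (d\<^sup>2 * lam4 d p)"

definition tau :: "complex ^ 'n ^ 'n" where
  "tau = (1 / real CARD('n)) *\<^sub>R mat 1"

definition psi_tau :: "complex ^ ('n::finite \<times> 'n)" where
  "psi_tau = (1 / sqrt (real CARD('n))) *\<^sub>R (\<Sum>i\<in>UNIV. vtensor (ket i) (ket i))"

definition pi_C :: "complex ^ ('n::finite \<times> 'n) ^ ('n::finite \<times> 'n)" where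
  "pi_C = outer psi_tau psi_tau"

definition Q_op :: "real \<Rightarrow> complex ^ ('n::finite \<times> 'n) ^ ('n::finite \<times> 'n)" where
  "Q_op p = (let d = real CARD('n) in
     sqrt d *\<^sub>R (sqrt (lam4 d p / (d\<^sup>2 - 1)) *\<^sub>R (mat 1 - pi_C) + sqrt (lam5 d p) *\<^sub>R pi_C))"

definition B_op :: "real \<Rightarrow> 'n \<Rightarrow> 'n \<Rightarrow> complex ^ ('n::finite \<times> 'n) ^ ('n::finite \<times> 'n)" where
  "B_op p i j = Q_op p ** mtensor (mat 1) (outer (ket i) (ket j))"

text \<open>\<open>vec.span\<close> is the span over the scalar field \<open>complex\<close>, unlike \<open>span\<close>.\<close>

definition P_proj :: "real \<Rightarrow> complex ^ (('n::finite \<times> 'n) \<times> ('n \<times> 'n)) ^ (('n::finite \<times> 'n) \<times> ('n \<times> 'n))" where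
  "P_proj p = ortho_projector (vec.span {vectorize (B_op p i j) | i j. True})"

definition X_op :: "real \<Rightarrow> complex ^ ('n::finite \<times> 'n) ^ ('n::finite \<times> 'n)" where
  "X_op p = (let d = real CARD('n) in
     lam3 d p *\<^sub>R mat 1 + (lam2 d p / lam4 d p) *\<^sub>R pi_C)"

definition noise_choi ::
  "real \<Rightarrow> complex ^ (('n::finite \<times> 'n) \<times> ('n \<times> 'n)) ^ (('n::finite \<times> 'n) \<times> ('n \<times> 'n))" where
  "noise_choi p =
     lam1 (real CARD('n)) p *\<^sub>R P_proj p +
     (mat 1 - P_proj p) ** mtensor (mat 1) (X_op p) ** (mat 1 - P_proj p)"

definition noise :: "real \<Rightarrow> ('n::finite \<times> 'n, 'n \<times> 'n) supermap" where
  "noise p = (THE \<N>. clinear_map \<N> \<and> choi (hs_adjoint \<N>) = noise_choi p)"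

end

theory Submission
  imports Defs
begin

text \<open>
  In Kraus form the fidelity is \<open>d\<^sup>-\<^sup>2 \<Sum> \<langle>\<langle>CD| J |CD\<rangle>\<rangle>\<close>, where \<open>J\<close> is the Choi matrix of the adjoint noise.
  Since \<open>\<lambda>\<^sub>1\<close> is the largest eigenvalue of \<open>J\<close> and \<open>d\<^sup>-\<^sup>2 \<Sum> \<parallel>CD\<parallel>\<^sup>2 \<le> 1\<close>, it is at most \<open>\<lambda>\<^sub>1\<close>, and the
  operators \<open>B\<^sub>i\<^sub>j\<close>, which factor as \<open>C\<^sub>i D\<^sub>j\<close>, attain this value.

  For an encoder with a single Kraus operator \<open>W\<close> and a trace-non-increasing family \<open>E\<^sub>a\<close> on \<open>\<H>\<^sub>L\<close>, the
  question is how much of the weight of the operators \<open>W E\<^sub>a\<close> can lie in the span of the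
  \<open>B\<^sub>w = Q (I \<otimes> |w\<rangle>)\<close>.  For a unit vector \<open>c\<close>, let \<open>u\<close> (\<open>d - 1\<close> times) and \<open>v\<close> (once) be the singular values of \<open>B\<^sub>c\<close>.
  If all the components point in the direction of one \<open>B\<^sub>c\<close>, a Cauchy-Schwarz inequality weighted by
  \<open>|B\<^sub>c|\<close> bounds the weight by \<open>(tr |B\<^sub>c|)\<^sup>2 = ((d - 1) u + v)\<^sup>2 = d - (d - 1) (u - v)\<^sup>2\<close>, and the isometry in the polar
  decomposition of \<open>B\<^sub>c\<close> attains this bound.  In general take for \<open>c\<close> the top eigenvector of the Gram
  operator of the components.  Because the range of \<open>W\<close> has dimension at most \<open>d\<close>, the components
  orthogonal to \<open>c\<close> have weight \<open>O(p)\<close>, and they change the bound by \<open>o(p\<^sup>2)\<close> only.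
\<close>

section \<open>Complex inner product, adjoints and rank-one operators\<close>

lemma sum_prod_UNIV:
  "(\<Sum>r\<in>UNIV. f r) = (\<Sum>i\<in>UNIV. \<Sum>j\<in>UNIV. f (i :: 'a::finite, j :: 'b::finite))"
  by (simp add: sum.cartesian_product)

lemma norm_vec_sq: "(norm (v :: complex ^ 'a))\<^sup>2 = (\<Sum>i\<in>UNIV. (cmod (v $ i))\<^sup>2)"
  by (simp add: norm_vec_def L2_set_def sum_nonneg)

lemma norm_mat_sq: "(norm (A :: complex ^ 'a ^ 'b))\<^sup>2 = (\<Sum>i\<in>UNIV. (norm (A $ i))\<^sup>2)"
  by (simp add: norm_vec_def L2_set_def sum_nonneg)

lemma cdot_add_right: "cdot v (w + w') = cdot v w + cdot v w'"
  by (simp add: cdot_def algebra_simps sum.distrib)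

lemma cdot_diff_right: "cdot v (w - w') = cdot v w - cdot v w'"
  by (simp add: cdot_def algebra_simps sum_subtractf)

lemma cdot_scale_right: "cdot v (c *s w) = c * cdot v w"
  by (simp add: cdot_def sum_distrib_left algebra_simps)

lemma cdot_scaleR_right: "cdot v (r *\<^sub>R w) = of_real r * cdot v w"
  unfolding cdot_def sum_distrib_left
  by (simp add: scaleR_conv_of_real[where 'a = complex] algebra_simps)

lemma cdot_zero_right [simp]: "cdot v 0 = 0" and cdot_zero_left [simp]: "cdot 0 v = 0"
  by (simp_all add: cdot_def)

lemma cdot_sum_right: "cdot v (\<Sum>i\<in>I. f i) = (\<Sum>i\<in>I. cdot v (f i))"
  by (induction I rule: infinite_finite_induct) (simp_all add: cdot_add_right)

lemma cnj_cdot: "cnj (cdot v w) = cdot w v"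
  by (simp add: cdot_def mult.commute)

lemma cdot_add_left: "cdot (w + w') v = cdot w v + cdot w' v"
  by (simp add: cdot_def algebra_simps sum.distrib)

lemma cdot_diff_left: "cdot (w - w') v = cdot w v - cdot w' v"
  by (simp add: cdot_def algebra_simps sum_subtractf)

lemma cdot_scale_left: "cdot (c *s w) v = cnj c * cdot w v"
  by (simp add: cdot_def sum_distrib_left algebra_simps)

lemma cdot_self: "cdot v v = of_real ((norm v)\<^sup>2)"
  unfolding cdot_def norm_vec_sq of_real_sum by (simp only: complex_norm_square mult.commute)

lemma cmod_cdot_le: "cmod (cdot v w) \<le> norm v * norm w"
proof -
  have "cmod (cdot v w) \<le> (\<Sum>i\<in>UNIV. \<bar>cmod (v $ i)\<bar> * \<bar>cmod (w $ i)\<bar>)"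
    unfolding cdot_def by (rule order_trans[OF norm_sum]) (simp add: norm_mult)
  also have "\<dots> \<le> norm v * norm w"
    unfolding norm_vec_def by (rule L2_set_mult_ineq)
  finally show ?thesis .
qed

lemma norm_add_sq: "(norm (v + w :: complex ^ 'a))\<^sup>2 = (norm v)\<^sup>2 + (norm w)\<^sup>2 + 2 * Re (cdot v w)"
proof -
  have "cdot (v + w) (v + w) = cdot v v + cdot w w + (cdot v w + cnj (cdot v w))"
    by (simp add: cdot_add_left cdot_add_right cnj_cdot)
  then have "complex_of_real ((norm (v + w))\<^sup>2) = of_real ((norm v)\<^sup>2 + (norm w)\<^sup>2 + 2 * Re (cdot v w))"
    by (simp add: cdot_self complex_add_cnj)
  then show ?thesis by (simp only: of_real_eq_iff)
qed

lemma norm_scale: "norm (c *s (v :: complex ^ 'a)) = cmod c * norm v"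
  by (simp add: norm_vec_def norm_mult L2_set_right_distrib)

lemma adj_nth [simp]: "adj A $ i $ j = cnj (A $ j $ i)"
  by (simp add: adj_def)

lemma outer_nth [simp]: "outer v w $ i $ j = v $ i * cnj (w $ j)"
  by (simp add: outer_def)

lemma ket_nth: "ket a $ i = (if a = i then 1 else 0)"
  by (auto simp: ket_def axis_def)

lemma adj_adj [simp]: "adj (adj A) = A"
  by (simp add: vec_eq_iff)

lemma adj_mult: "adj (A ** B) = adj B ** adj A"
  by (simp add: vec_eq_iff matrix_matrix_mult_def mult.commute)

lemma adj_mat1 [simp]: "adj (mat 1) = mat 1"
  by (simp add: vec_eq_iff mat_def)

lemma cdot_adj: "cdot v (A *v w) = cdot (adj A *v v) w"
  unfolding cdot_def matrix_vector_mult_def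
  by (simp add: sum_distrib_left sum_distrib_right) (subst sum.swap, simp add: algebra_simps)

lemma matrix_mult_scaleR_left: "(r *\<^sub>R A) ** B = r *\<^sub>R (A ** (B :: complex ^ 'a ^ 'b))"
  by (simp add: vec_eq_iff matrix_matrix_mult_def scaleR_sum_right)

lemma matrix_mult_scaleR_right: "A ** (r *\<^sub>R B) = r *\<^sub>R (A ** (B :: complex ^ 'a ^ 'b))"
  by (simp add: vec_eq_iff matrix_matrix_mult_def scaleR_sum_right)

lemma matrix_vector_scaleR_left: "(r *\<^sub>R A) *v y = r *\<^sub>R (A *v (y :: complex ^ 'a))"
  by (simp add: vec_eq_iff matrix_vector_mult_def scaleR_sum_right)

lemma outer_mult_vec: "outer v w *v y = cdot w y *s v"
  by (simp add: vec_eq_iff matrix_vector_mult_def cdot_def sum_distrib_right sum_distrib_left algebra_simps)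

lemma conj_outer: "A ** outer v w ** adj B = outer (A *v v) (B *v w)"
  by (simp add: vec_eq_iff matrix_matrix_mult_def matrix_vector_mult_def sum_distrib_left sum_distrib_right algebra_simps)

lemma trace_outer: "trace (outer v w) = cdot w v"
  by (simp add: trace_def cdot_def mult.commute)

lemma matrix_vector_sum_left: "(\<Sum>i\<in>I. A i) *v y = (\<Sum>i\<in>I. A i *v y)"
  by (induction I rule: infinite_finite_induct) (simp_all add: matrix_vector_mult_add_rdistrib)

section \<open>Frobenius inner product\<close>

definition hs :: "complex ^ 'a ^ 'b \<Rightarrow> complex ^ 'a ^ 'b \<Rightarrow> complex" where
  "hs A B = (\<Sum>i\<in>UNIV. cdot (A $ i) (B $ i))"

lemma hs_trace: "hs A B = trace (adj A ** B)"
  unfolding hs_def cdot_def trace_def matrix_matrix_mult_def by (simp, rule sum.swap)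

lemma hs_add_right: "hs A (B + C) = hs A B + hs A C"
  by (simp add: hs_def cdot_add_right sum.distrib)

lemma hs_diff_right: "hs A (B - C) = hs A B - hs A C"
  by (simp add: hs_def cdot_diff_right sum_subtractf)

lemma hs_self: "hs A A = of_real ((norm A)\<^sup>2)"
  by (simp add: hs_def cdot_self norm_mat_sq)

lemma cnj_hs: "cnj (hs A B) = hs B A"
  by (simp add: hs_def cnj_cdot)

lemma cmod_hs_le: "cmod (hs A B) \<le> norm A * norm B"
proof -
  have "cmod (hs A B) \<le> (\<Sum>i\<in>UNIV. \<bar>norm (A $ i)\<bar> * \<bar>norm (B $ i)\<bar>)"
    unfolding hs_def by (rule order_trans[OF norm_sum]) (auto intro!: sum_mono simp: cmod_cdot_le)
  also have "\<dots> \<le> norm A * norm B"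
    unfolding norm_vec_def[of A] norm_vec_def[of B] by (rule L2_set_mult_ineq)
  finally show ?thesis .
qed

lemma norm_add_sq_hs: "(norm (A + B :: complex ^ 'a ^ 'b))\<^sup>2 = (norm A)\<^sup>2 + (norm B)\<^sup>2 + 2 * Re (hs A B)"
  by (simp add: norm_mat_sq norm_add_sq hs_def sum.distrib sum_distrib_left Re_sum)

lemma hs_mult_left: "hs A (B ** C) = hs (adj B ** A) C"
  by (simp add: hs_trace adj_mult matrix_mul_assoc)

lemma cdot_vectorize: "cdot (vectorize A) (vectorize B) = hs A B"
proof -
  have "cdot (vectorize A) (vectorize B) = (\<Sum>i\<in>UNIV. \<Sum>k\<in>UNIV. cnj (A $ k $ i) * B $ k $ i)"
    unfolding cdot_def sum_prod_UNIV by (simp add: vectorize_nth)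
  also have "\<dots> = hs A B" unfolding hs_def cdot_def by (rule sum.swap)
  finally show ?thesis .
qed

lemma norm_vectorize: "norm (vectorize A) = norm A"
proof -
  have "complex_of_real ((norm (vectorize A))\<^sup>2) = of_real ((norm A)\<^sup>2)"
    by (simp only: cdot_self[symmetric] hs_self[symmetric] cdot_vectorize)
  then have "(norm (vectorize A))\<^sup>2 = (norm A)\<^sup>2" by (simp only: of_real_eq_iff)
  then show ?thesis by simp
qed

lemma norm_sq_columns: "(norm (A :: complex ^ 'a ^ 'b))\<^sup>2 = (\<Sum>k\<in>UNIV. (norm (A *v ket k))\<^sup>2)"
proof -
  have "(A *v ket k) $ i = A $ i $ k" for i k
    by (simp add: matrix_vector_mult_def ket_nth if_distrib cong: if_cong)
  then show ?thesis
    unfolding norm_mat_sq norm_vec_sq by simp (rule sum.swap)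
qed

lemma hs_outer_left: "hs (outer x e) M = cdot x (M *v e)"
  unfolding hs_def cdot_def matrix_vector_mult_def
  by (simp add: sum_distrib_left algebra_simps)

lemma norm_outer: "norm (outer x e) = norm x * norm e"
proof -
  have "complex_of_real ((norm (outer x e))\<^sup>2) = of_real ((norm x * norm e)\<^sup>2)"
    by (simp only: hs_self[symmetric] hs_outer_left outer_mult_vec cdot_scale_right cdot_self)
       (simp add: power_mult_distrib)
  then have "(norm (outer x e))\<^sup>2 = (norm x * norm e)\<^sup>2" by (simp only: of_real_eq_iff)
  then show ?thesis by simp
qed

text \<open>\<open>M - outer (M *v e) e\<close> is \<open>M\<close> composed with the projector onto
  the complement of \<open>e\<close>. It is Frobenius-orthogonal to \<open>outer (M *v e) e\<close>,
  whose norm is that of \<open>M *v e\<close>, so the first claim is Pythagoras.\<close>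

lemma norm_sq_split:
  assumes "norm e = 1"
  shows "(norm (M - outer (M *v e) e))\<^sup>2 = (norm M)\<^sup>2 - (norm (M *v e))\<^sup>2"
    and "(M - outer (M *v e) e) *v e = 0"
proof -
  show 0: "(M - outer (M *v e) e) *v e = 0"
    using assms by (simp add: matrix_vector_mult_diff_rdistrib outer_mult_vec cdot_self)
  have "hs (M - outer (M *v e) e) (outer (M *v e) e) = 0"
    by (subst cnj_hs[symmetric]) (simp add: hs_outer_left 0)
  then show "(norm (M - outer (M *v e) e))\<^sup>2 = (norm M)\<^sup>2 - (norm (M *v e))\<^sup>2"
    using norm_add_sq_hs[of "M - outer (M *v e) e" "outer (M *v e) e"] assms
    by (simp add: norm_outer)
qed

section \<open>Recovery after a single encoding operator\<close>

text \<open>Cauchy-Schwarz weighted by |B|, for right singular values \<open>u\<close> on the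
  complement of \<open>e\<close> and \<open>v\<close> on \<open>e\<close>. The first factor is then
  tr |B|, the second is the |B|-weighted squared norm of \<open>S\<close>. The two parts of
  \<open>B\<close> are met only through their norms, so no singular value decomposition
  occurs.\<close>

lemma weighted_cauchy_schwarz:
  fixes B S :: "complex ^ 'a ^ 'b"
  assumes e: "norm e = 1" and v: "norm (B *v e) = v" and B: "(norm B)\<^sup>2 = m * u\<^sup>2 + v\<^sup>2"
    and nonneg: "0 \<le> m" "0 \<le> u"
  shows "(cmod (hs B S))\<^sup>2 \<le> (m * u + v) * (u * ((norm S)\<^sup>2 - (norm (S *v e))\<^sup>2) + v * (norm (S *v e))\<^sup>2)"
proof -
  have v0: "0 \<le> v" using v by auto
  define S1 B1 where "S1 = S - outer (S *v e) e" and "B1 = B - outer (B *v e) e"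
  define p q where "p = norm S1" and "q = norm (S *v e)"
  have p: "p\<^sup>2 = (norm S)\<^sup>2 - (norm (S *v e))\<^sup>2" and S1e: "S1 *v e = 0"
    using norm_sq_split[OF e, of S] by (auto simp: p_def S1_def)
  have "(norm B1)\<^sup>2 = (sqrt m * u)\<^sup>2"
    using norm_sq_split(1)[OF e, of B] B v nonneg by (simp add: B1_def power_mult_distrib)
  then have nB1: "norm B1 = sqrt m * u" using nonneg by simp
  have "hs B S = hs B S1 + hs B (outer (S *v e) e)"
    by (simp add: hs_add_right[symmetric] S1_def)
  moreover have "hs B (outer (S *v e) e) = cdot (B *v e) (S *v e)"
    by (subst cnj_hs[symmetric]) (simp add: hs_outer_left cnj_cdot)
  \<comment> \<open>\<open>S1\<close> vanishes on \<open>e\<close>, so the part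
    \<open>outer (B *v e) e\<close> of \<open>B\<close> is orthogonal to it.\<close>
  moreover have "hs B S1 = hs B1 S1"
    by (subst cnj_hs[symmetric], subst (2) cnj_hs[symmetric])
       (simp add: B1_def hs_diff_right, subst cnj_hs[symmetric], simp add: hs_outer_left S1e)
  ultimately have "cmod (hs B S) \<le> cmod (hs B1 S1) + cmod (cdot (B *v e) (S *v e))"
    by (simp add: norm_triangle_ineq)
  also have "\<dots> \<le> sqrt m * u * p + v * q"
    using cmod_hs_le[of B1 S1] cmod_cdot_le[of "B *v e" "S *v e"] by (simp add: nB1 v p_def q_def)
  finally have "(cmod (hs B S))\<^sup>2 \<le> (sqrt m * u * p + v * q)\<^sup>2"
    by (rule power_mono) simp
  \<comment> \<open>The slack is a perfect square; writing \<open>m\<close> as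
    \<open>r\<^sup>2\<close> makes the identity polynomial.\<close>
  also have "\<dots> = (m * u + v) * (u * p\<^sup>2 + v * q\<^sup>2) - u * v * (sqrt m * q - p)\<^sup>2"
  proof -
    obtain r where r: "m = r\<^sup>2" "r \<ge> 0" using nonneg(1) by (metis real_sqrt_pow2 real_sqrt_ge_zero)
    show ?thesis unfolding r(1) using r(2) by (simp add: power2_eq_square algebra_simps)
  qed
  also have "\<dots> \<le> (m * u + v) * (u * p\<^sup>2 + v * q\<^sup>2)"
    using nonneg v0 by simp
  finally show ?thesis using p by (simp add: q_def)
qed

text \<open>This is B_w = Q (I \<otimes> |w>) for Q = a I + b |Omega><Omega| with |Omega> = sum |i
  i>. In other words, y is sent to a (y \<otimes> w) + b (sum w_k y_k) |Omega>.\<close>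

definition encoder :: "real \<Rightarrow> real \<Rightarrow> complex ^ 'n \<Rightarrow> complex ^ 'n ^ ('n::finite \<times> 'n)" where
  "encoder a b w = (\<chi> r k. (if fst r = k then of_real a * w $ snd r else 0) + (if fst r = snd r then of_real b * w $ k else 0))"

text \<open>The Frobenius adjoint of \<open>encoder a b\<close>. When \<open>encoder a b\<close> is
  isometric, the value at \<open>T\<close> is the vector w for which B_w is the orthogonal
  projection of \<open>T\<close> onto the space of all B_w.\<close>

definition coords :: "real \<Rightarrow> real \<Rightarrow> complex ^ 'n ^ ('n::finite \<times> 'n) \<Rightarrow> complex ^ 'n" where
  "coords a b T = (\<chi> s. of_real a * (\<Sum>l\<in>UNIV. T $ (l, s) $ l) + of_real b * (\<Sum>l\<in>UNIV. T $ (l, l) $ s))"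

text \<open>\<open>encoder\<close> pairs w with the input bilinearly, so the input direction singled
  out by B_c is the conjugate of c: (adj B_c) B_c is a^2 I plus a multiple of the projector onto
  it.\<close>

definition conj_vec :: "complex ^ 'n \<Rightarrow> complex ^ 'n" where
  "conj_vec c = (\<chi> i. cnj (c $ i))"

lemma sum_diag: "(\<Sum>l\<in>UNIV. \<Sum>s\<in>UNIV. if l = s then f l s else 0) = (\<Sum>l\<in>UNIV. f l l)"
  for f :: "'a::finite \<Rightarrow> 'a \<Rightarrow> complex"
  by simp

lemma hs_encoder: "hs (encoder a b w) T = cdot w (coords a b T)"
proof -
  have "hs (encoder a b w) T = (\<Sum>l\<in>UNIV. \<Sum>s\<in>UNIV. \<Sum>k\<in>UNIV.
       (if l = k then of_real a * cnj (w $ s) * T $ (l, s) $ k else 0)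
     + (if l = s then of_real b * cnj (w $ k) * T $ (l, s) $ k else 0))"
    unfolding hs_def cdot_def sum_prod_UNIV encoder_def
    by (intro sum.cong refl) (simp add: algebra_simps)
  also have "\<dots> = (\<Sum>l\<in>UNIV. \<Sum>s\<in>UNIV. of_real a * cnj (w $ s) * T $ (l, s) $ l)
     + (\<Sum>l\<in>UNIV. \<Sum>k\<in>UNIV. \<Sum>s\<in>UNIV. if l = s then of_real b * cnj (w $ k) * T $ (l, s) $ k else 0)"
    unfolding sum.distrib by (rule arg_cong2[where f = "(+)"]) (simp, rule sum.cong[OF refl], rule sum.swap)
  also have "\<dots> = (\<Sum>s\<in>UNIV. \<Sum>l\<in>UNIV. of_real a * cnj (w $ s) * T $ (l, s) $ l)
     + (\<Sum>k\<in>UNIV. \<Sum>l\<in>UNIV. of_real b * cnj (w $ k) * T $ (l, l) $ k)"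
    by (rule arg_cong2[where f = "(+)"]) (rule sum.swap, simp, rule sum.swap)
  also have "\<dots> = cdot w (coords a b T)"
    by (simp add: cdot_def coords_def sum_distrib_left sum.distrib algebra_simps)
  finally show ?thesis .
qed

lemma coords_diff: "coords a b (S - T) = coords a b S - coords a b T"
  by (simp add: vec_eq_iff coords_def sum_subtractf algebra_simps)

text \<open>The hypothesis evaluates the adjoint composed with \<open>encoder a b\<close> to the
  identity. It therefore makes w |-> B_w an isometry, with left inverse
  \<open>coords a b\<close>.\<close>

lemma coords_encoder:
  fixes w :: "complex ^ 'n"
  assumes "real CARD('n) * a\<^sup>2 + 2 * a * b + real CARD('n) * b\<^sup>2 = 1"
  shows "coords a b (encoder a b w) = w"
proof -
  have "coords a b (encoder a b w) $ s = w $ s" for s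
  proof -
    have "coords a b (encoder a b w) $ s = of_real (real CARD('n) * a\<^sup>2 + 2 * a * b + real CARD('n) * b\<^sup>2) * w $ s"
      by (simp add: coords_def encoder_def sum.distrib power2_eq_square algebra_simps)
    then show ?thesis by (simp only: assms) simp
  qed
  then show ?thesis by (simp add: vec_eq_iff)
qed

lemma encoder_add: "encoder a b (w + z) = encoder a b w + encoder a b z"
  by (simp add: vec_eq_iff encoder_def algebra_simps)

lemma encoder_vec:
  "(encoder a b w *v y) $ (l, s) = of_real a * (y $ l * w $ s) + (if l = s then of_real b * (\<Sum>k\<in>UNIV. w $ k * y $ k) else 0)"
proof -
  have "(encoder a b w *v y) $ (l, s) = (\<Sum>k\<in>UNIV. (if l = k then of_real a * (y $ k * w $ s) else 0)
     + (if l = s then of_real b * (w $ k * y $ k) else 0))"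
    unfolding matrix_vector_mult_def encoder_def by (simp, intro sum.cong refl) (auto simp: algebra_simps)
  then show ?thesis by (auto simp: sum.distrib sum_distrib_left)
qed

lemma norm_conj_vec [simp]: "norm (conj_vec c) = norm c"
  by (simp add: conj_vec_def norm_vec_def)

text \<open>At w = c this gives the square of the exceptional singular value of B_c. For w
  orthogonal to c it says that B_c and B_w have orthogonal images of \<open>conj_vec c\<close>,
  which removes a cross term in \<open>single_bound\<close>.\<close>

lemma cdot_encoder_conj:
  fixes c w :: "complex ^ 'n"
  assumes "norm c = 1"
  shows "cdot (encoder a b c *v conj_vec c) (encoder a b w *v conj_vec c) = of_real (a\<^sup>2 + 2 * a * b + real CARD('n) * b\<^sup>2) * cdot c w"
proof -
  have cc: "(\<Sum>k\<in>UNIV. c $ k * cnj (c $ k)) = 1"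
    using assms cdot_self[of c] by (simp add: cdot_def mult.commute)
  have cw: "(\<Sum>k\<in>UNIV. w $ k * cnj (c $ k)) = cdot c w"
    by (simp add: cdot_def mult.commute)
  have "cdot (encoder a b c *v conj_vec c) (encoder a b w *v conj_vec c) =
     (\<Sum>l\<in>UNIV. \<Sum>s\<in>UNIV. (of_real (a\<^sup>2) * (c $ l * cnj (c $ l))) * (w $ s * cnj (c $ s))
       + (if l = s then of_real (a * b) * (c $ l * cnj (c $ s) * cdot c w) + of_real (a * b) * (cnj (c $ l) * w $ s)
          + of_real (b\<^sup>2) * cdot c w else 0))"
    unfolding cdot_def[of "encoder a b c *v conj_vec c"] sum_prod_UNIV
    by (intro sum.cong refl) (auto simp: encoder_vec conj_vec_def cc cw power2_eq_square algebra_simps)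
  also have "\<dots> = of_real (a\<^sup>2) * ((\<Sum>l\<in>UNIV. c $ l * cnj (c $ l)) * (\<Sum>s\<in>UNIV. w $ s * cnj (c $ s)))
      + (of_real (a * b) * ((\<Sum>l\<in>UNIV. c $ l * cnj (c $ l)) * cdot c w)
         + of_real (a * b) * (\<Sum>l\<in>UNIV. cnj (c $ l) * w $ l) + of_nat CARD('n) * (of_real (b\<^sup>2) * cdot c w))"
    unfolding sum.distrib sum_diag sum_product
    by (simp only: sum_distrib_left sum_distrib_right sum_constant mult.assoc)
  also have "\<dots> = of_real (a\<^sup>2 + 2 * a * b + real CARD('n) * b\<^sup>2) * cdot c w"
    by (simp only: cc cw cdot_def[symmetric] of_real_add of_real_mult of_real_of_nat_eq of_real_numeral) algebra
  finally show ?thesis .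
qed

text \<open>The term with \<open>b\<close> pairs w with the conjugate of c, which gives
  \<open>cdot c w\<close>. It vanishes, and only the tensor product remains.\<close>

lemma norm_encoder_conj_ortho:
  assumes "norm c = 1" "cdot c w = 0" "a \<ge> 0"
  shows "norm (encoder a b w *v conj_vec c) = a * norm w"
proof -
  have cw: "(\<Sum>k\<in>UNIV. w $ k * cnj (c $ k)) = 0"
    using assms by (simp add: cdot_def mult.commute)
  have "(norm (encoder a b w *v conj_vec c))\<^sup>2 = (\<Sum>l\<in>UNIV. \<Sum>s\<in>UNIV. a\<^sup>2 * (cmod (c $ l))\<^sup>2 * (cmod (w $ s))\<^sup>2)"
    unfolding norm_vec_sq sum_prod_UNIV
    by (simp add: encoder_vec conj_vec_def cw norm_mult power_mult_distrib algebra_simps cong: if_cong)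
  also have "\<dots> = a\<^sup>2 * (norm c)\<^sup>2 * (norm w)\<^sup>2"
    unfolding norm_vec_sq mult.assoc sum_product by (simp only: sum_distrib_left)
  finally have "(norm (encoder a b w *v conj_vec c))\<^sup>2 = (a * norm w)\<^sup>2" using assms by (simp add: power_mult_distrib)
  then show ?thesis using assms by simp
qed

lemma norm_encoder:
  fixes w :: "complex ^ 'n"
  assumes "real CARD('n) * a\<^sup>2 + 2 * a * b + real CARD('n) * b\<^sup>2 = 1"
  shows "norm (encoder a b w) = norm w"
proof -
  have "complex_of_real ((norm (encoder a b w))\<^sup>2) = of_real ((norm w)\<^sup>2)"
    by (simp only: hs_self[symmetric] hs_encoder coords_encoder[OF assms] cdot_self)
  then have "(norm (encoder a b w))\<^sup>2 = (norm w)\<^sup>2" by (simp only: of_real_eq_iff)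
  then show ?thesis by simp
qed

section \<open>Norm bounds for contractive families\<close>

lemma norm_matrix_vector_le: "norm e = 1 \<Longrightarrow> norm (M *v e) \<le> norm M" for M :: "complex ^ 'a ^ 'b"
proof -
  assume "norm e = 1"
  from norm_sq_split(1)[OF this, of M] have "(norm (M *v e))\<^sup>2 \<le> (norm M)\<^sup>2"
    by (metis diff_ge_0_iff_ge zero_le_power2)
  then show ?thesis by (rule power2_le_imp_le) simp
qed

text \<open>The contraction bound is applied to each column of \<open>X\<close>. With
  \<open>X\<close> the identity or a projector, it bounds the total squared norm by a
  dimension.\<close>

lemma contractive_family_mult:
  fixes T :: "'i \<Rightarrow> complex ^ 'a ^ 'b" and X :: "complex ^ 'c ^ 'a"
  assumes "\<And>y. (\<Sum>i\<in>I. (norm (T i *v y))\<^sup>2) \<le> (norm y)\<^sup>2"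
  shows "(\<Sum>i\<in>I. (norm (T i ** X))\<^sup>2) \<le> (norm X)\<^sup>2"
proof -
  have "(\<Sum>i\<in>I. (norm (T i ** X))\<^sup>2) = (\<Sum>k\<in>UNIV. \<Sum>i\<in>I. (norm (T i *v (X *v ket k)))\<^sup>2)"
    unfolding norm_sq_columns[of "_ ** _"] by (subst sum.swap) (simp add: matrix_vector_mul_assoc)
  also have "\<dots> \<le> (norm X)\<^sup>2"
    unfolding norm_sq_columns[of X] by (intro sum_mono assms)
  finally show ?thesis .
qed

lemma norm_ket [simp]: "norm (ket k) = 1"
proof -
  have "(norm (ket k :: complex ^ 'a))\<^sup>2 = 1"
    by (simp add: norm_vec_sq ket_nth if_distrib[of cmod] if_distrib[of "\<lambda>x. x\<^sup>2"] cong: if_cong)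
  then show ?thesis by (metis norm_ge_zero power2_eq_1_iff less_eq_real_def neg_0_le_iff_le not_one_le_zero)
qed

lemma norm_mat1: "(norm (mat 1 :: complex ^ 'a ^ 'a))\<^sup>2 = real CARD('a)"
  by (simp add: norm_sq_columns)

text \<open>The numerical data of the family B_w, freed from the channel: \<open>normalized\<close>
  makes w |-> B_w isometric, and \<open>v_sq\<close> says that \<open>v\<close> is the exceptional
  singular value of B_c. The two sign conditions on \<open>b\<close> give \<open>v \<le> a\<close>
  and bound the operator norm of Q by \<open>a\<close>.\<close>

locale frame_params =
  fixes n a b v :: real
  assumes a_pos: "0 < a" and b_nonpos: "b \<le> 0" and b_ge: "0 \<le> 2 * a + n * b" and v_nonneg: "0 \<le> v"
    and normalized: "n * a\<^sup>2 + 2 * a * b + n * b\<^sup>2 = 1" and v_sq: "v\<^sup>2 = a\<^sup>2 + 2 * a * b + n * b\<^sup>2"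
    and n_ge: "2 \<le> n"
begin

definition "gap = a - v"
definition "trace_norm = (n - 1) * a + v"

lemma v_le: "v \<le> a"
proof -
  have "v\<^sup>2 = a\<^sup>2 + b * (2 * a + n * b)" unfolding v_sq by (simp add: power2_eq_square algebra_simps)
  also have "\<dots> \<le> a\<^sup>2" using b_nonpos b_ge by (simp add: mult_nonpos_nonneg)
  finally show ?thesis using a_pos by (auto intro: power2_le_imp_le)
qed

lemma gap_nonneg: "0 \<le> gap" and gap_le: "gap \<le> a"
  using v_le v_nonneg by (auto simp: gap_def)

lemma sq_sum: "(n - 1) * a\<^sup>2 + v\<^sup>2 = 1"
  using normalized v_sq by (simp add: algebra_simps)

lemma a_le: "a \<le> 1"
proof -
  have "a\<^sup>2 \<le> (n - 1) * a\<^sup>2" using n_ge by (simp add: mult_le_cancel_right1)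
  also have "\<dots> \<le> 1" using sq_sum zero_le_power2[of v] by linarith
  finally have "a\<^sup>2 \<le> 1\<^sup>2" by simp
  then show ?thesis by (rule power2_le_imp_le) simp
qed

lemma na_sq: "n * a\<^sup>2 = 1 + 2 * a * gap - gap\<^sup>2"
  using sq_sum by (simp add: gap_def power2_eq_square algebra_simps)

lemma trace_norm_a: "trace_norm * a = 1 + a * gap - gap\<^sup>2"
  using sq_sum by (simp add: trace_norm_def gap_def power2_eq_square algebra_simps)

lemma trace_norm_nonneg: "0 \<le> trace_norm"
  using n_ge a_pos v_nonneg by (simp add: trace_norm_def)

text \<open>For numbers s_i with squares summing to 1, n - (sum s_i)^2 is the sum of (s_i - s_j)^2
  over pairs. Here only the n - 1 pairs containing \<open>v\<close> contribute, so the loss is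
  quadratic in \<open>gap\<close>.\<close>

lemma trace_norm_sq: "n - trace_norm\<^sup>2 = (n - 1) * gap\<^sup>2"
proof -
  have "n - trace_norm\<^sup>2 = n * ((n - 1) * a\<^sup>2 + v\<^sup>2) - trace_norm\<^sup>2" by (simp add: sq_sum)
  also have "\<dots> = (n - 1) * gap\<^sup>2"
    by (simp add: trace_norm_def gap_def power2_eq_square algebra_simps)
  finally show ?thesis .
qed

text \<open>Summed over a contractive family, the first term is at most \<open>trace_norm\<close>
  times (n - 1) a + v, that is \<open>trace_norm\<^sup>2\<close>. The component \<open>w\<close> of
  the coordinates off \<open>c\<close> costs only the two remaining terms: one is quadratic in
  \<open>gap\<close>, the other carries the residual of \<open>T\<close> outside the space of the
  B_z.\<close>

lemma single_bound:
  fixes T :: "complex ^ 'n ^ ('n \<times> 'n)" and c :: "complex ^ 'n"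
  assumes n: "n = real CARD('n)" and c: "norm c = 1"
  defines "z \<equiv> coords a b T"
  defines "w \<equiv> z - cdot c z *s c"
  shows "(norm z)\<^sup>2 \<le> trace_norm * (a * ((norm T)\<^sup>2 - (norm (T *v conj_vec c))\<^sup>2) + v * (norm (T *v conj_vec c))\<^sup>2)
     + gap\<^sup>2 * (1 + a\<^sup>2) * (norm w)\<^sup>2 + 2 * (trace_norm * a) * gap * (norm w * norm (T - encoder a b z))"
proof -
  define al where "al = cdot c z"
  \<comment> \<open>\<open>S\<close> removes from \<open>T\<close> only the component B_w with w
    orthogonal to c. Its coordinates are then a multiple of c, so
    \<open>weighted_cauchy_schwarz\<close> can be used with B_c.\<close>
  define S R where "S = T - encoder a b w" and "R = T - encoder a b z"
  have norm1: "real CARD('n) * a\<^sup>2 + 2 * a * b + real CARD('n) * b\<^sup>2 = 1"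
    using normalized n by simp
  have cc: "cdot c c = 1" using c by (simp add: cdot_self)
  have z: "z = w + al *s c" by (simp add: w_def al_def)
  have cw: "cdot c w = 0" by (simp add: w_def cdot_diff_right cdot_scale_right cc)
  then have wc: "cdot w c = 0" by (metis cnj_cdot complex_cnj_zero)
  have nz: "(norm z)\<^sup>2 = (norm w)\<^sup>2 + (cmod al)\<^sup>2"
    unfolding z by (simp add: norm_add_sq norm_scale c cdot_scale_right wc)
  have coordsS: "coords a b S = al *s c"
    by (simp add: S_def coords_diff coords_encoder[OF norm1] z_def[symmetric] z)
  have "hs (encoder a b c) S = al" by (simp add: hs_encoder coordsS cdot_scale_right cc)
  moreover have vB: "norm (encoder a b c *v conj_vec c) = v"
  proof -
    have "complex_of_real ((norm (encoder a b c *v conj_vec c))\<^sup>2) = of_real (v\<^sup>2)"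
      unfolding cdot_self[symmetric] cdot_encoder_conj[OF c] cc v_sq n by simp
    then have "(norm (encoder a b c *v conj_vec c))\<^sup>2 = v\<^sup>2" by (simp only: of_real_eq_iff)
    then show ?thesis using v_nonneg by simp
  qed
  moreover have "(norm (encoder a b c))\<^sup>2 = (n - 1) * a\<^sup>2 + v\<^sup>2"
    using sq_sum by (simp add: norm_encoder[OF norm1] c)
  ultimately have "(cmod al)\<^sup>2 \<le> trace_norm * (a * ((norm S)\<^sup>2 - (norm (S *v conj_vec c))\<^sup>2) + v * (norm (S *v conj_vec c))\<^sup>2)"
    using weighted_cauchy_schwarz[of "conj_vec c" "encoder a b c" v "n - 1" a S] c n_ge a_pos
    by (simp add: trace_norm_def)
  then have S: "(cmod al)\<^sup>2 \<le> trace_norm * (a * (norm S)\<^sup>2 - gap * (norm (S *v conj_vec c))\<^sup>2)"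
    by (simp add: gap_def algebra_simps)
  have T: "T = S + encoder a b w" by (simp add: S_def)
  have "hs S (encoder a b w) = 0"
    by (subst cnj_hs[symmetric]) (simp add: hs_encoder coordsS cdot_scale_right wc)
  then have nT: "(norm T)\<^sup>2 = (norm S)\<^sup>2 + (norm w)\<^sup>2"
    unfolding T by (simp add: norm_add_sq_hs norm_encoder[OF norm1])
  have "encoder a b z = encoder a b w + encoder a b (al *s c)" by (simp add: z encoder_add)
  then have SR: "S = R + encoder a b (al *s c)" by (simp add: S_def R_def)
  have bs: "encoder a b (al *s c) *v y = al *s (encoder a b c *v y)" for y
    by (auto simp: vec_eq_iff encoder_vec sum_distrib_left algebra_simps)
  \<comment> \<open>\<open>S\<close> and \<open>R\<close> differ by a multiple of B_c, whose image
    of \<open>conj_vec c\<close> is orthogonal to that of B_w. The cross term is thus controlled by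
    the residual \<open>R\<close> alone.\<close>
  have SRc: "cdot (S *v conj_vec c) (encoder a b w *v conj_vec c) = cdot (R *v conj_vec c) (encoder a b w *v conj_vec c)"
    unfolding SR matrix_vector_mult_add_rdistrib cdot_add_left bs cdot_scale_left cdot_encoder_conj[OF c] cw by simp
  have "cmod (cdot (R *v conj_vec c) (encoder a b w *v conj_vec c)) \<le> norm (R *v conj_vec c) * (a * norm w)"
    using cmod_cdot_le[of "R *v conj_vec c" "encoder a b w *v conj_vec c"] a_pos
    by (simp add: norm_encoder_conj_ortho[OF c cw])
  also have "\<dots> \<le> norm R * (a * norm w)"
    using norm_matrix_vector_le[of "conj_vec c" R] a_pos c by (intro mult_right_mono) auto
  finally have cross: "Re (cdot (S *v conj_vec c) (encoder a b w *v conj_vec c)) \<le> norm R * (a * norm w)"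
    unfolding SRc using complex_Re_le_cmod order_trans by blast
  have nTc: "(norm (T *v conj_vec c))\<^sup>2 \<le> (norm (S *v conj_vec c))\<^sup>2 + a\<^sup>2 * (norm w)\<^sup>2 + 2 * (norm R * (a * norm w))"
    unfolding T matrix_vector_mult_add_rdistrib norm_add_sq
    using cross a_pos by (simp add: norm_encoder_conj_ortho[OF c cw] power_mult_distrib)
  \<comment> \<open>The left side is the coefficient with which the weighted norm counts the squared
    norm of \<open>w\<close>. It equals 1 up to order \<open>gap\<^sup>2\<close>; the cubic term is
    nonnegative and is dropped at the end.\<close>
  have key: "trace_norm * a * (1 - gap * a) = 1 - gap\<^sup>2 * (1 + a\<^sup>2) + a * gap * gap\<^sup>2"
    unfolding trace_norm_a by algebra
  have "(cmod al)\<^sup>2 + (1 - gap\<^sup>2 * (1 + a\<^sup>2) + a * gap * gap\<^sup>2) * (norm w)\<^sup>2 - 2 * (trace_norm * a) * gap * (norm w * norm R)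
     \<le> trace_norm * (a * (norm S)\<^sup>2 - gap * (norm (S *v conj_vec c))\<^sup>2) + (trace_norm * a * (1 - gap * a)) * (norm w)\<^sup>2
       - 2 * (trace_norm * a) * gap * (norm w * norm R)"
    using S by (simp add: key)
  also have "\<dots> = trace_norm * (a * ((norm S)\<^sup>2 + (norm w)\<^sup>2)
       - gap * ((norm (S *v conj_vec c))\<^sup>2 + a\<^sup>2 * (norm w)\<^sup>2 + 2 * (norm R * (a * norm w))))"
    by algebra
  also have "\<dots> \<le> trace_norm * (a * (norm T)\<^sup>2 - gap * (norm (T *v conj_vec c))\<^sup>2)"
    unfolding nT using nTc trace_norm_nonneg gap_nonneg a_pos by (intro mult_left_mono diff_mono) auto
  finally have "(cmod al)\<^sup>2 + (1 - gap\<^sup>2 * (1 + a\<^sup>2) + a * gap * gap\<^sup>2) * (norm w)\<^sup>2 - 2 * (trace_norm * a) * gap * (norm w * norm R)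
     \<le> trace_norm * (a * (norm T)\<^sup>2 - gap * (norm (T *v conj_vec c))\<^sup>2)" .
  moreover have "0 \<le> a * gap * gap\<^sup>2 * (norm w)\<^sup>2"
    using a_pos gap_nonneg by simp
  moreover have "trace_norm * (a * ((norm T)\<^sup>2 - (norm (T *v conj_vec c))\<^sup>2) + v * (norm (T *v conj_vec c))\<^sup>2)
      = trace_norm * (a * (norm T)\<^sup>2 - gap * (norm (T *v conj_vec c))\<^sup>2)"
    unfolding gap_def by algebra
  ultimately show ?thesis
    unfolding nz R_def[symmetric] distrib_right left_diff_distrib by linarith
qed

end

lemma sum_cauchy_schwarz: "(\<Sum>i\<in>I. f i * g i) \<le> sqrt (\<Sum>i\<in>I. (f i)\<^sup>2) * sqrt (\<Sum>i\<in>I. (g i)\<^sup>2)" for f g :: "'i \<Rightarrow> real"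
proof -
  have "(\<Sum>i\<in>I. f i * g i) \<le> (\<Sum>i\<in>I. \<bar>f i\<bar> * \<bar>g i\<bar>)"
    by (intro sum_mono) (metis abs_ge_self abs_mult)
  also have "\<dots> \<le> L2_set f I * L2_set g I" by (rule L2_set_mult_ineq)
  finally show ?thesis by (simp add: L2_set_def)
qed

text \<open>A top eigenvector of \<open>\<Sum>\<^sub>i |z\<^sub>i\<rangle>\<langle>z\<^sub>i|\<close>.\<close>

lemma exists_top_vector:
  fixes z :: "'i \<Rightarrow> complex ^ 'n"
  obtains c :: "complex ^ 'n" where "norm c = 1"
    "\<And>y. (\<Sum>i\<in>I. (cmod (cdot y (z i)))\<^sup>2) \<le> (\<Sum>i\<in>I. (cmod (cdot c (z i)))\<^sup>2) * (norm y)\<^sup>2"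
proof -
  let ?q = "\<lambda>y. \<Sum>i\<in>I. (cmod (cdot y (z i)))\<^sup>2"
  have ne: "sphere (0 :: complex ^ 'n) 1 \<noteq> {}"
    using norm_ket[of "undefined :: 'n"] by (metis empty_iff mem_sphere_0)
  have "continuous_on (sphere 0 1) ?q"
    unfolding cdot_def by (intro continuous_intros)
  from continuous_attains_sup[OF compact_sphere ne this]
  obtain c where c: "c \<in> sphere 0 1" "\<And>y. y \<in> sphere 0 1 \<Longrightarrow> ?q y \<le> ?q c"
    by metis
  have "?q y \<le> ?q c * (norm y)\<^sup>2" for y
  proof (cases "y = 0")
    case False
    define y' where "y' = of_real (1 / norm y) *s y"
    have "?q y' \<le> ?q c" using c(2)[of y'] False by (simp add: y'_def norm_scale norm_divide)
    moreover have "?q y' = ?q y / (norm y)\<^sup>2"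
      by (simp add: y'_def cdot_scale_left norm_mult power_mult_distrib sum_distrib_left[symmetric] norm_divide power_divide sum_divide_distrib)
    ultimately show ?thesis using False by (simp add: field_simps)
  qed simp
  then show thesis using c(1) that by auto
qed

section \<open>Weight captured by a whole family behind one encoder\<close>

lemma matrix_mult_diff_right: "A ** (B - C) = A ** B - A ** (C :: complex ^ 'a ^ 'b)"
  by (simp add: vec_eq_iff matrix_matrix_mult_def sum_subtractf right_diff_distrib)

context frame_params
begin

text \<open>Column \<open>m\<close> of Q W, cut into blocks indexed by \<open>k\<close>. It
  represents the entry (m, k) of \<open>adj W ** encoder a b z\<close> as a functional of
  \<open>z\<close>.\<close>

definition gram_vec :: "complex ^ 'n ^ ('n \<times> 'n) \<Rightarrow> 'n \<Rightarrow> 'n::finite \<Rightarrow> complex ^ 'n" where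
  "gram_vec W m k = (\<chi> s. of_real a * W $ (k, s) $ m + (if k = s then of_real b * (\<Sum>l\<in>UNIV. W $ (l, l) $ m) else 0))"

lemma adj_mult_encoder: "(adj W ** encoder a b z) $ m $ k = cdot (gram_vec W m k) z"
proof -
  have "(adj W ** encoder a b z) $ m $ k = (\<Sum>l\<in>UNIV. \<Sum>s\<in>UNIV.
      (if l = k then of_real a * cnj (W $ (l, s) $ m) * z $ s else 0)
      + (if l = s then of_real b * cnj (W $ (l, s) $ m) * z $ k else 0))"
    unfolding matrix_matrix_mult_def sum_prod_UNIV encoder_def
    by (simp, intro sum.cong refl) (auto simp: algebra_simps)
  also have "\<dots> = (\<Sum>s\<in>UNIV. \<Sum>l\<in>UNIV. if l = k then of_real a * cnj (W $ (l, s) $ m) * z $ s else 0)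
      + (\<Sum>l\<in>UNIV. of_real b * cnj (W $ (l, l) $ m) * z $ k)"
    unfolding sum.distrib by (rule arg_cong2[where f = "(+)"]) (rule sum.swap, simp)
  also have "\<dots> = (\<Sum>s\<in>UNIV. of_real a * cnj (W $ (k, s) $ m) * z $ s) 
      + (\<Sum>s\<in>UNIV. if k = s then (\<Sum>l\<in>UNIV. of_real b * cnj (W $ (l, l) $ m)) * z $ s else 0)"
    by (simp add: sum_distrib_right)
  also have "\<dots> = cdot (gram_vec W m k) z"
    unfolding cdot_def sum.distrib[symmetric]
    by (intro sum.cong refl) (simp add: gram_vec_def algebra_simps sum_distrib_left)
  finally show ?thesis .
qed

text \<open>This is the bound |Q W| \<le> a |W|: the eigenvalues of Q are a and a + n b, and the
  second lies between -a and a. In the computation the excess is b (2 a + n b) |t|^2, which the sign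
  conditions make nonpositive.\<close>

lemma gram_vec_norm:
  fixes W :: "complex ^ 'n ^ ('n \<times> 'n)"
  assumes n: "n = real CARD('n)"
  shows "(\<Sum>m\<in>UNIV. \<Sum>k\<in>UNIV. (norm (gram_vec W m k))\<^sup>2) \<le> a\<^sup>2 * (norm W)\<^sup>2"
proof -
  have "(\<Sum>k\<in>UNIV. (norm (gram_vec W m k))\<^sup>2) \<le> a\<^sup>2 * (\<Sum>k\<in>UNIV. \<Sum>s\<in>UNIV. (cmod (W $ (k, s) $ m))\<^sup>2)" for m
  proof -
    define t where "t = (\<Sum>l\<in>UNIV. W $ (l, l) $ m)"
    have sq: "(cmod (of_real a * x + of_real b * t))\<^sup>2 = a\<^sup>2 * (cmod x)\<^sup>2 + 2 * a * b * Re (cnj t * x) + b\<^sup>2 * (cmod t)\<^sup>2" for x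
      by (simp add: cmod_power2) algebra
    have "(\<Sum>k\<in>UNIV. (norm (gram_vec W m k))\<^sup>2) = (\<Sum>k\<in>UNIV. \<Sum>s\<in>UNIV. a\<^sup>2 * (cmod (W $ (k, s) $ m))\<^sup>2
        + (if k = s then 2 * a * b * Re (cnj t * W $ (k, s) $ m) + b\<^sup>2 * (cmod t)\<^sup>2 else 0))"
      unfolding norm_vec_sq gram_vec_def t_def[symmetric]
      by (intro sum.cong refl) (simp add: sq norm_mult power_mult_distrib)
    also have "\<dots> = a\<^sup>2 * (\<Sum>k\<in>UNIV. \<Sum>s\<in>UNIV. (cmod (W $ (k, s) $ m))\<^sup>2)
        + (2 * a * b * Re (cnj t * (\<Sum>k\<in>UNIV. W $ (k, k) $ m)) + n * (b\<^sup>2 * (cmod t)\<^sup>2))"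
      unfolding sum.distrib by (simp add: sum.distrib sum_distrib_left n distrib_left)
    also have "cnj t * (\<Sum>k\<in>UNIV. W $ (k, k) $ m) = of_real ((cmod t)\<^sup>2)"
      by (simp only: t_def[symmetric] complex_norm_square mult.commute)
    also have "2 * a * b * Re (of_real ((cmod t)\<^sup>2)) + n * (b\<^sup>2 * (cmod t)\<^sup>2) = b * (2 * a + n * b) * (cmod t)\<^sup>2"
      by (simp add: power2_eq_square algebra_simps)
    also have "\<dots> \<le> 0"
      using b_nonpos b_ge by (simp add: mult_nonpos_nonneg)
    finally show ?thesis by simp
  qed
  then have "(\<Sum>m\<in>UNIV. \<Sum>k\<in>UNIV. (norm (gram_vec W m k))\<^sup>2) \<le> (\<Sum>m\<in>UNIV. a\<^sup>2 * (\<Sum>k\<in>UNIV. \<Sum>s\<in>UNIV. (cmod (W $ (k, s) $ m))\<^sup>2))"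
    by (intro sum_mono)
  also have "\<dots> = a\<^sup>2 * (norm W)\<^sup>2"
    unfolding sum_distrib_left[symmetric] norm_mat_sq norm_vec_sq sum_prod_UNIV[symmetric, of "\<lambda>(k, s). (cmod (W $ (k, s) $ _))\<^sup>2", simplified]
    by (rule arg_cong2[where f = "(*)"], simp) (subst sum.swap, simp add: sum_prod_UNIV)
  finally show ?thesis .
qed

text \<open>The arithmetic end of \<open>recovery_bound\<close>: \<open>f\<close> is the captured
  weight, \<open>lam\<close> its part along the top direction, \<open>eta\<close> the rest. If the
  deficit n - f is below (n - 1) \<open>gap\<^sup>2\<close>, the hypothesis on \<open>lam\<close>
  forces \<open>eta\<close> to be of order \<open>gap\<close>. The two error terms are then at most
  8 and 6 times \<open>n * gap\<^sup>2 * sqrt gap\<close>, whence the constant 14.\<close>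

lemma deficit_bound_real:
  fixes f lam eta Rs :: real
  assumes "0 \<le> f" "f \<le> n" and lam: "f\<^sup>2 \<le> lam * (n * a\<^sup>2) * n" and eta: "eta = f - lam" "0 \<le> eta"
    and f: "f \<le> trace_norm\<^sup>2 + gap\<^sup>2 * (1 + a\<^sup>2) * eta + 2 * (trace_norm * a) * gap * (sqrt eta * sqrt (n - f))"
  shows "(n - 1) * gap\<^sup>2 - 14 * n * gap\<^sup>2 * sqrt gap \<le> n - f"
proof -
  define g where "g = n - f"
  define K where "K = n * a\<^sup>2"
  have K: "1 \<le> K" "K \<le> 1 + 2 * gap"
  proof -
    have "0 \<le> gap * (2 * a - gap)" using gap_nonneg gap_le by simp
    then show "1 \<le> K" unfolding K_def na_sq by (simp add: power2_eq_square algebra_simps)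
    have "a * gap \<le> 1 * gap" using a_le gap_nonneg by (rule mult_right_mono)
    then show "K \<le> 1 + 2 * gap" unfolding K_def na_sq using zero_le_power2[of gap] by linarith
  qed
  have n0: "0 < n" using n_ge by simp
  \<comment> \<open>From lam \<ge> f^2 / (n K) one gets eta \<le> f (1 - f / (n K)). Enlarging the
    first factor f to n K leaves n K - f.\<close>
  have eta_le: "eta \<le> g + 2 * n * gap"
  proof -
    have "f\<^sup>2 / (n * K) \<le> lam"
      using lam K n0 by (simp add: K_def[symmetric] divide_le_eq mult_ac)
    then have "eta \<le> f * (1 - f / (n * K))" by (simp add: eta power2_eq_square algebra_simps)
    also have "\<dots> \<le> (n * K) * (1 - f / (n * K))"
    proof (rule mult_right_mono)
      show "f \<le> n * K" using assms(2) K n0 by (smt (verit) mult_le_cancel_left1)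
      then show "0 \<le> 1 - f / (n * K)" using K n0 by (simp add: divide_le_eq)
    qed
    also have "\<dots> = n * K - f" using K n0 by (simp add: field_simps)
    also have "\<dots> \<le> n * (1 + 2 * gap) - f" using K n0 by simp
    finally show ?thesis by (simp add: g_def algebra_simps)
  qed
  show ?thesis
  proof (cases "(n - 1) * gap\<^sup>2 \<le> g")
    case True
    moreover have "0 \<le> 14 * n * gap\<^sup>2 * sqrt gap" using n0 gap_nonneg by simp
    ultimately show ?thesis unfolding g_def by linarith
  next
    case False
    have d1: "0 \<le> gap" "gap \<le> 1" using gap_nonneg gap_le a_le by auto
    have g0: "0 \<le> g" using assms by (simp add: g_def)
    have gle: "g \<le> n * gap\<^sup>2"
      using False zero_le_power2[of gap] unfolding left_diff_distrib by linarith
    have "n * gap\<^sup>2 \<le> n * gap" using d1 n0 by (simp add: power2_eq_square mult_left_le)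
    then have e3: "eta \<le> 3 * n * gap" using eta_le gle by simp
    have sd: "sqrt gap * sqrt gap = gap" "gap \<le> sqrt gap" "0 \<le> sqrt gap"
      using d1 by (auto simp: real_le_rsqrt power2_eq_square mult_left_le)
    have "sqrt eta * sqrt g \<le> sqrt (3 * n * gap) * sqrt (n * gap\<^sup>2)"
      using e3 gle g0 eta by (intro mult_mono) auto
    also have "\<dots> = sqrt 3 * (n * gap * sqrt gap)"
      using d1 n0 by (simp add: real_sqrt_mult)
    also have "\<dots> \<le> 2 * (n * gap * sqrt gap)"
      using d1 n0 by (intro mult_right_mono) (auto intro: real_le_lsqrt)
    finally have s1: "sqrt eta * sqrt g \<le> 2 * (n * gap * sqrt gap)" .
    have "a * gap \<le> 1 * gap" using a_le d1 by (intro mult_right_mono)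
    then have ta: "trace_norm * a \<le> 2" unfolding trace_norm_a using d1 zero_le_power2[of gap] by linarith
    have ta0: "0 \<le> trace_norm * a" using trace_norm_nonneg a_pos by simp
    have "2 * (trace_norm * a) * gap * (sqrt eta * sqrt g) \<le> 2 * 2 * gap * (2 * (n * gap * sqrt gap))"
      by (rule mult_mono[OF _ s1]) (use d1 ta0 eta g0 mult_right_mono[OF ta, of "2 * gap"] in \<open>auto simp: mult_ac\<close>)
    then have t1: "2 * (trace_norm * a) * gap * (sqrt eta * sqrt g) \<le> 8 * (n * gap\<^sup>2 * sqrt gap)"
      by (simp add: power2_eq_square algebra_simps)
    have "a\<^sup>2 \<le> 1" using a_le a_pos by (simp add: power_le_one)
    then have "gap\<^sup>2 * (1 + a\<^sup>2) * eta \<le> gap\<^sup>2 * 2 * (3 * n * gap)"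
      using e3 eta by (intro mult_mono) auto
    also have "\<dots> \<le> gap\<^sup>2 * 2 * (3 * n * sqrt gap)"
      using sd n0 by (intro mult_left_mono) auto
    finally have t2: "gap\<^sup>2 * (1 + a\<^sup>2) * eta \<le> 6 * (n * gap\<^sup>2 * sqrt gap)" by (simp add: mult_ac)
    show ?thesis using f t1 t2 trace_norm_sq unfolding g_def by linarith
  qed
qed

text \<open>A single contraction \<open>W\<close> on an n-dimensional space cannot serve several
  orthogonal directions: if the coordinates spread away from the top direction \<open>c\<close>,
  then the products of \<open>adj W\<close> with the B_z are too small to reproduce the weight
  \<open>f\<close>. So \<open>c\<close> carries nearly everything, and \<open>single_bound\<close>
  in that direction finishes.\<close>

lemma recovery_bound:
  fixes W :: "complex ^ 'n ^ ('n \<times> 'n)" and E :: "'i \<Rightarrow> complex ^ 'n ^ 'n"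
  assumes n: "n = real CARD('n)" and W: "\<And>y. norm (W *v y) \<le> norm y"
    and E: "\<And>y. (\<Sum>i\<in>I. (norm (E i *v y))\<^sup>2) \<le> (norm y)\<^sup>2"
  shows "(\<Sum>i\<in>I. (norm (coords a b (W ** E i)))\<^sup>2) \<le> n - ((n - 1) * gap\<^sup>2 - 14 * n * gap\<^sup>2 * sqrt gap)"
proof -
  have norm1: "real CARD('n) * a\<^sup>2 + 2 * a * b + real CARD('n) * b\<^sup>2 = 1"
    using normalized n by simp
  define T z where "T = (\<lambda>i. W ** E i)" and "z = (\<lambda>i. coords a b (T i))"
  define R where "R = (\<lambda>i. T i - encoder a b (z i))"
  define f where "f = (\<Sum>i\<in>I. (norm (z i))\<^sup>2)"
  have T: "(\<Sum>i\<in>I. (norm (T i *v y))\<^sup>2) \<le> (norm y)\<^sup>2" for y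
  proof -
    have "(\<Sum>i\<in>I. (norm (T i *v y))\<^sup>2) \<le> (\<Sum>i\<in>I. (norm (E i *v y))\<^sup>2)"
      by (intro sum_mono power_mono) (auto simp: T_def matrix_vector_mul_assoc[symmetric] W)
    then show ?thesis using E[of y] by simp
  qed
  have T2: "(\<Sum>i\<in>I. (norm (T i))\<^sup>2) \<le> n"
    using contractive_family_mult[of T I "mat 1", OF T] by (simp add: norm_mat1 n)
  have E2: "(\<Sum>i\<in>I. (norm (E i))\<^sup>2) \<le> n"
    using contractive_family_mult[of E I "mat 1", OF E] by (simp add: norm_mat1 n)
  \<comment> \<open>The dimension of the input space enters here: each of the n columns of
    \<open>W\<close> has norm at most 1.\<close>
  have W2: "(norm W)\<^sup>2 \<le> n"
  proof -
    have "(norm (W *v ket k))\<^sup>2 \<le> 1" for k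
      using W[of "ket k"] by (simp add: power_le_one)
    then have "(\<Sum>k\<in>UNIV. (norm (W *v ket k))\<^sup>2) \<le> (\<Sum>k\<in>(UNIV :: 'n set). 1)" by (intro sum_mono)
    then show ?thesis by (simp add: norm_sq_columns n)
  qed
  have hz: "hs (encoder a b (z i)) (T i) = of_real ((norm (z i))\<^sup>2)" for i
    unfolding hs_encoder by (simp add: z_def cdot_self)
  have R: "(norm (R i))\<^sup>2 = (norm (T i))\<^sup>2 - (norm (z i))\<^sup>2" for i
  proof -
    have "coords a b (R i) = 0" by (simp add: R_def coords_diff coords_encoder[OF norm1] z_def)
    then have "hs (encoder a b (z i)) (R i) = 0" by (simp add: hs_encoder)
    then show ?thesis
      using norm_add_sq_hs[of "encoder a b (z i)" "R i"] by (simp add: norm_encoder[OF norm1]) (simp add: R_def)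
  qed
  have R2: "(\<Sum>i\<in>I. (norm (R i))\<^sup>2) \<le> n - f"
    unfolding R sum_subtractf f_def using T2 by simp
  then have fn: "f \<le> n" by (smt (verit) sum_nonneg zero_le_power2)
  have f0: "0 \<le> f" by (simp add: f_def sum_nonneg)
  obtain c :: "complex ^ 'n" where c: "norm c = 1"
    and top: "\<And>y. (\<Sum>i\<in>I. (cmod (cdot y (z i)))\<^sup>2) \<le> (\<Sum>i\<in>I. (cmod (cdot c (z i)))\<^sup>2) * (norm y)\<^sup>2"
    using exists_top_vector[where I = I and z = z] by metis
  define lam where "lam = (\<Sum>i\<in>I. (cmod (cdot c (z i)))\<^sup>2)"
  have lam0: "0 \<le> lam" by (simp add: lam_def sum_nonneg)
  define w where "w = (\<lambda>i. z i - cdot c (z i) *s c)"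
  have w: "(norm (w i))\<^sup>2 = (norm (z i))\<^sup>2 - (cmod (cdot c (z i)))\<^sup>2" for i
  proof -
    have "cdot (w i) c = 0"
      by (subst cnj_cdot[symmetric]) (simp add: w_def cdot_diff_right cdot_scale_right cdot_self c)
    then show ?thesis
      using norm_add_sq[of "w i" "cdot c (z i) *s c"] by (simp add: cdot_scale_right norm_scale c) (simp add: w_def)
  qed
  define eta where "eta = (\<Sum>i\<in>I. (norm (w i))\<^sup>2)"
  have eta: "eta = f - lam" by (simp add: eta_def w sum_subtractf f_def lam_def)
  have eta0: "0 \<le> eta" by (simp add: eta_def sum_nonneg)
  have "(\<Sum>i\<in>I. (norm (adj W ** encoder a b (z i)))\<^sup>2) = (\<Sum>m\<in>UNIV. \<Sum>k\<in>UNIV. \<Sum>i\<in>I. (cmod (cdot (gram_vec W m k) (z i)))\<^sup>2)"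
    unfolding norm_mat_sq norm_vec_sq adj_mult_encoder by (subst sum.swap, intro sum.cong refl) (rule sum.swap)
  also have "\<dots> \<le> (\<Sum>m\<in>UNIV. \<Sum>k\<in>UNIV. lam * (norm (gram_vec W m k))\<^sup>2)"
    unfolding lam_def by (intro sum_mono top)
  also have "\<dots> \<le> lam * (a\<^sup>2 * (norm W)\<^sup>2)"
    unfolding sum_distrib_left[symmetric] using gram_vec_norm[OF n, of W] lam0 by (intro mult_left_mono)
  also have "\<dots> \<le> lam * (a\<^sup>2 * n)" using W2 lam0 by (intro mult_left_mono) auto
  finally have G: "(\<Sum>i\<in>I. (norm (adj W ** encoder a b (z i)))\<^sup>2) \<le> lam * (n * a\<^sup>2)" by (simp add: mult_ac)
  \<comment> \<open>Moving \<open>W\<close> to the other side of <B_z, W E> = |z|^2 and applying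
    Cauchy-Schwarz over the family bounds \<open>f\<close> through \<open>lam\<close>.\<close>
  have "f = (\<Sum>i\<in>I. Re (hs (adj W ** encoder a b (z i)) (E i)))"
    unfolding f_def hs_mult_left[symmetric] using hz by (simp add: T_def)
  also have "\<dots> \<le> (\<Sum>i\<in>I. norm (adj W ** encoder a b (z i)) * norm (E i))"
    by (intro sum_mono) (meson cmod_hs_le complex_Re_le_cmod order_trans)
  also have "\<dots> \<le> sqrt (\<Sum>i\<in>I. (norm (adj W ** encoder a b (z i)))\<^sup>2) * sqrt (\<Sum>i\<in>I. (norm (E i))\<^sup>2)"
    by (rule sum_cauchy_schwarz)
  also have "\<dots> \<le> sqrt (lam * (n * a\<^sup>2)) * sqrt n"
    using G E2 lam0 n_ge by (intro mult_mono) (auto simp: sum_nonneg)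
  finally have "f \<le> sqrt (lam * (n * a\<^sup>2) * n)" by (simp add: real_sqrt_mult)
  then have "f\<^sup>2 \<le> (sqrt (lam * (n * a\<^sup>2) * n))\<^sup>2" using f0 by (rule power_mono)
  then have lamf: "f\<^sup>2 \<le> lam * (n * a\<^sup>2) * n" using lam0 n_ge by simp
  define e where "e = conj_vec c"
  have e: "norm e = 1" by (simp add: e_def c)
  have y1: "(\<Sum>i\<in>I. (norm (T i *v e))\<^sup>2) \<le> 1" using T[of e] e by simp
  \<comment> \<open>\<open>X\<close> is the projector onto the complement of \<open>e\<close>, of
    squared norm n - 1, and the summands are the squared norms of \<open>T i ** X\<close>.\<close>
  have y2: "(\<Sum>i\<in>I. (norm (T i))\<^sup>2 - (norm (T i *v e))\<^sup>2) \<le> n - 1"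
  proof -
    define X where "X = mat 1 - outer (mat 1 *v e) e"
    have "T i ** X = T i - outer (T i *v e) e" for i
      using conj_outer[of "T i" e e "mat 1"] by (simp add: X_def matrix_mult_diff_right)
    then have "(\<Sum>i\<in>I. (norm (T i))\<^sup>2 - (norm (T i *v e))\<^sup>2) = (\<Sum>i\<in>I. (norm (T i ** X))\<^sup>2)"
      by (simp add: norm_sq_split(1)[OF e])
    also have "\<dots> \<le> (norm X)\<^sup>2" by (rule contractive_family_mult[OF T])
    also have "\<dots> = n - 1" unfolding X_def norm_sq_split(1)[OF e] by (simp add: norm_mat1 e n)
    finally show ?thesis .
  qed
  have "f \<le> (\<Sum>i\<in>I. trace_norm * (a * ((norm (T i))\<^sup>2 - (norm (T i *v e))\<^sup>2) + v * (norm (T i *v e))\<^sup>2)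
     + gap\<^sup>2 * (1 + a\<^sup>2) * (norm (w i))\<^sup>2 + 2 * (trace_norm * a) * gap * (norm (w i) * norm (R i)))"
    unfolding f_def w_def R_def z_def e_def by (intro sum_mono single_bound[OF n c])
  also have "\<dots> = trace_norm * (a * (\<Sum>i\<in>I. (norm (T i))\<^sup>2 - (norm (T i *v e))\<^sup>2) + v * (\<Sum>i\<in>I. (norm (T i *v e))\<^sup>2))
     + gap\<^sup>2 * (1 + a\<^sup>2) * eta + 2 * (trace_norm * a) * gap * (\<Sum>i\<in>I. norm (w i) * norm (R i))"
    by (simp only: sum.distrib sum_distrib_left[symmetric] eta_def)
  also have "\<dots> \<le> trace_norm * (a * (n - 1) + v * 1) + gap\<^sup>2 * (1 + a\<^sup>2) * eta + 2 * (trace_norm * a) * gap * (sqrt eta * sqrt (n - f))"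
  proof (intro add_mono mult_left_mono order_refl)
    have "(\<Sum>i\<in>I. norm (w i) * norm (R i)) \<le> sqrt eta * sqrt (\<Sum>i\<in>I. (norm (R i))\<^sup>2)"
      unfolding eta_def by (rule sum_cauchy_schwarz)
    also have "\<dots> \<le> sqrt eta * sqrt (n - f)" using R2 eta0 by (intro mult_left_mono) auto
    finally show "(\<Sum>i\<in>I. norm (w i) * norm (R i)) \<le> sqrt eta * sqrt (n - f)" .
  qed (use y1 y2 a_pos v_nonneg trace_norm_nonneg gap_nonneg in auto)
  also have "trace_norm * (a * (n - 1) + v * 1) = trace_norm\<^sup>2" by (simp add: trace_norm_def power2_eq_square mult.commute)
  finally have "(n - 1) * gap\<^sup>2 - 14 * n * gap\<^sup>2 * sqrt gap \<le> n - f"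
    by (intro deficit_bound_real[OF f0 fn lamf eta eta0])
  then show ?thesis by (simp add: f_def z_def T_def)
qed

end

section \<open>Kraus operators and Choi matrices\<close>

lemma matrix_mult_add_left: "(A + B) ** C = A ** C + B ** (C :: complex ^ 'a ^ 'b)"
  by (simp add: vec_eq_iff matrix_matrix_mult_def sum.distrib distrib_right)

lemma cdot_gram_list: "cdot y ((\<Sum>L\<leftarrow>Ls. adj L ** L) *v y) = of_real (\<Sum>L\<leftarrow>Ls. (norm (L *v y))\<^sup>2)"
proof (induction Ls)
  case (Cons L Ls)
  have "cdot y ((adj L ** L) *v y) = of_real ((norm (L *v y))\<^sup>2)"
    by (simp only: matrix_vector_mul_assoc[symmetric] cdot_adj adj_adj cdot_self)
  then show ?case using Cons by (simp add: matrix_vector_mult_add_rdistrib cdot_add_right)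
qed simp

lemma loewner_le_mat1_iff:
  "loewner_le (\<Sum>L\<leftarrow>Ls. adj L ** L) (mat 1) \<longleftrightarrow> (\<forall>y. (\<Sum>L\<leftarrow>Ls. (norm (L *v y))\<^sup>2) \<le> (norm y)\<^sup>2)"
proof -
  have "cdot y ((mat 1 - (\<Sum>L\<leftarrow>Ls. adj L ** L)) *v y) = of_real ((norm y)\<^sup>2 - (\<Sum>L\<leftarrow>Ls. (norm (L *v y))\<^sup>2))" for y
    by (simp add: matrix_vector_mult_diff_rdistrib cdot_diff_right cdot_gram_list cdot_self)
  then show ?thesis by (simp only: loewner_le_def psd_def nonneg_Reals_of_real_iff diff_ge_0_iff_ge)
qed

lemma trace_sum_list: "trace (\<Sum>x\<leftarrow>xs. f x) = (\<Sum>x\<leftarrow>xs. trace (f x))" for f :: "'i \<Rightarrow> complex ^ 'a ^ 'a"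
  by (induction xs) (simp_all add: trace_add, simp add: trace_def)

lemma trace_kraus:
  assumes "kraus_ops \<Phi> Ls"
  shows "trace (\<Phi> (outer y y)) = of_real (\<Sum>L\<leftarrow>Ls. (norm (L *v y))\<^sup>2)"
proof -
  have "trace (\<Phi> (outer y y)) = (\<Sum>L\<leftarrow>Ls. of_real ((norm (L *v y))\<^sup>2))"
    using assms by (simp add: kraus_ops_def trace_sum_list conj_outer trace_outer cdot_self)
  also have "\<dots> = of_real (\<Sum>L\<leftarrow>Ls. (norm (L *v y))\<^sup>2)" by (induction Ls) auto
  finally show ?thesis .
qed

lemma clinear_map_kraus:
  assumes "kraus_ops \<Phi> Ls"
  shows "clinear_map \<Phi>"
proof -
  have "\<Phi> = (\<lambda>X. \<Sum>L\<leftarrow>Ls. L ** X ** adj L)" using assms by (auto simp: kraus_ops_def)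
  moreover have "(\<Sum>L\<leftarrow>Ls. L ** (X + Y) ** adj L) = (\<Sum>L\<leftarrow>Ls. L ** X ** adj L) + (\<Sum>L\<leftarrow>Ls. L ** Y ** adj L)" for X Y
    by (induction Ls) (simp_all add: matrix_add_ldistrib matrix_mult_add_left)
  moreover have "L ** mscale c X ** adj L = mscale c (L ** X ** adj L)" for L :: "complex ^ 'a ^ 'b" and c X
    by (simp add: vec_eq_iff matrix_matrix_mult_def mscale_def sum_distrib_left sum_distrib_right algebra_simps)
  then have "(\<Sum>L\<leftarrow>Ls. L ** mscale c X ** adj L) = mscale c (\<Sum>L\<leftarrow>Ls. L ** X ** adj L)" for c X
    by (induction Ls) (simp_all add: vec_eq_iff mscale_def algebra_simps)
  ultimately show ?thesis by (simp add: clinear_map_def)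
qed

lemma completely_positive_kraus:
  assumes "kraus_ops \<Phi> Ls"
  shows "completely_positive \<Phi>"
  unfolding completely_positive_def
proof (intro conjI allI impI)
  show "clinear_map \<Phi>" by (rule clinear_map_kraus[OF assms])
  fix n and X :: "nat \<Rightarrow> nat \<Rightarrow> complex ^ 'a ^ 'a"
  assume X: "block_psd n X"
  have "(\<Sum>i<n. \<Sum>j<n. cdot (v i) ((\<Sum>L\<leftarrow>Ls. L ** X i j ** adj L) *v v j)) \<in> \<real>\<^sub>\<ge>\<^sub>0" for v
  proof (induction Ls)
    case (Cons L Ls)
    have "cdot (v i) ((L ** X i j ** adj L) *v v j) = cdot (adj L *v v i) (X i j *v (adj L *v v j))" for i j
      by (simp add: matrix_vector_mul_assoc[symmetric] cdot_adj[of _ L])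
    then have "(\<Sum>i<n. \<Sum>j<n. cdot (v i) ((L ** X i j ** adj L) *v v j)) \<in> \<real>\<^sub>\<ge>\<^sub>0"
      using X[unfolded block_psd_def, rule_format, of "\<lambda>i. adj L *v v i"] by simp
    with Cons show ?case
      by (simp add: matrix_vector_mult_add_rdistrib cdot_add_right sum.distrib)
  qed simp
  then show "block_psd n (\<lambda>i j. \<Phi> (X i j))"
    using assms by (simp add: block_psd_def kraus_ops_def)
qed

text \<open>A Kraus representation already implies complete positivity, so only the contraction
  property of some Kraus list remains to be checked.\<close>

lemma cptni_iff:
  "cptni \<Phi> \<longleftrightarrow> (\<exists>Ls. kraus_ops \<Phi> Ls \<and> (\<forall>y. (\<Sum>L\<leftarrow>Ls. (norm (L *v y))\<^sup>2) \<le> (norm y)\<^sup>2))"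
  unfolding cptni_def trace_nonincreasing_def loewner_le_mat1_iff
  using completely_positive_kraus by blast

text \<open>The sum is the trace of the map at |y><y|, hence the same for every Kraus list of the
  map.\<close>

lemma cptni_contractive:
  assumes "cptni \<Phi>" "kraus_ops \<Phi> Ls"
  shows "(\<Sum>L\<leftarrow>Ls. (norm (L *v y))\<^sup>2) \<le> (norm y)\<^sup>2"
proof -
  obtain Ls' where Ls': "kraus_ops \<Phi> Ls'" "\<forall>y. (\<Sum>L\<leftarrow>Ls'. (norm (L *v y))\<^sup>2) \<le> (norm y)\<^sup>2"
    using assms(1) by (auto simp: cptni_iff)
  have "(\<Sum>L\<leftarrow>Ls. (norm (L *v y))\<^sup>2) = (\<Sum>L\<leftarrow>Ls'. (norm (L *v y))\<^sup>2)"
    using trace_kraus[OF assms(2), of y] trace_kraus[OF Ls'(1), of y] by (simp only: of_real_eq_iff)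
  then show ?thesis using Ls'(2) by simp
qed

lemma choi_rank_le_1:
  assumes "cptni \<Phi>" "choi_rank \<Phi> \<le> 1"
  obtains "kraus_ops \<Phi> []" | L where "kraus_ops \<Phi> [L]"
proof -
  have "\<exists>r. \<exists>Ls. kraus_ops \<Phi> Ls \<and> length Ls = r" using assms(1) by (auto simp: cptni_iff)
  then have "\<exists>Ls. kraus_ops \<Phi> Ls \<and> length Ls = choi_rank \<Phi>"
    unfolding choi_rank_def by (rule LeastI_ex)
  then obtain Ls where Ls: "kraus_ops \<Phi> Ls" "length Ls \<le> 1" using assms(2) by auto
  then consider "Ls = []" | L where "Ls = [L]" by (cases Ls) auto
  then show thesis using Ls that by cases auto
qed

lemma kraus_ops_comp:
  assumes "kraus_ops \<Phi> Ls" "kraus_ops \<Psi> Ms"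
  shows "kraus_ops (\<Psi> \<circ> \<Phi>) [M ** L. M \<leftarrow> Ms, L \<leftarrow> Ls]"
proof -
  have *: "M ** (\<Sum>L\<leftarrow>Ls. L ** X ** adj L) ** adj M = (\<Sum>L\<leftarrow>Ls. (M ** L) ** X ** adj (M ** L))" for M X
    by (induction Ls) (simp_all add: matrix_add_ldistrib matrix_mult_add_left matrix_mul_assoc adj_mult)
  have "(\<Sum>M\<leftarrow>Ms. M ** (\<Sum>L\<leftarrow>Ls. L ** X ** adj L) ** adj M) = (\<Sum>F\<leftarrow>[M ** L. M \<leftarrow> Ms, L \<leftarrow> Ls]. F ** X ** adj F)" for X
    by (induction Ms) (simp_all add: o_def *)
  then show ?thesis using assms by (simp add: kraus_ops_def)
qed

lemma cdot_outer_sum_list: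
  "cdot r ((\<Sum>v\<leftarrow>vs. outer v v) *v r) = of_real (\<Sum>v\<leftarrow>vs. (cmod (cdot r v))\<^sup>2)"
proof (induction vs)
  case (Cons v vs)
  have "cdot v r * cdot r v = of_real ((cmod (cdot r v))\<^sup>2)"
    by (subst cnj_cdot[symmetric]) (simp only: complex_norm_square mult.commute)
  then show ?case using Cons
    by (simp add: matrix_vector_mult_add_rdistrib cdot_add_right outer_mult_vec cdot_scale_right)
qed simp

text \<open>The sum is the quadratic form of the Choi matrix at the vectorized adjoint of
  \<open>\<rho>\<close>. It takes the same value for any two Kraus lists, which resolves the
  \<open>SOME\<close> in the definition.\<close>

lemma ent_fidelity_kraus:
  assumes "kraus_ops \<Phi> Fs"
  shows "ent_fidelity \<rho> \<Phi> = (\<Sum>F\<leftarrow>Fs. (cmod (trace (\<rho> ** F)))\<^sup>2)"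
proof -
  have *: "complex_of_real (\<Sum>F\<leftarrow>Gs. (cmod (trace (\<rho> ** F)))\<^sup>2)
      = cdot (vectorize (adj \<rho>)) (choi \<Phi> *v vectorize (adj \<rho>))" if "kraus_ops \<Phi> Gs" for Gs
    unfolding choi_kraus[OF that]
    using cdot_outer_sum_list[of "vectorize (adj \<rho>)" "map vectorize Gs"]
    by (simp add: o_def cdot_vectorize hs_trace)
  have "kraus_ops \<Phi> (SOME Fs. kraus_ops \<Phi> Fs)" using assms by (rule someI)
  from *[OF this] *[OF assms] show ?thesis
    unfolding ent_fidelity_def Let_def by (metis of_real_eq_iff)
qed

section \<open>Maps with a given adjoint Choi matrix\<close>

text \<open>A certificate of positivity from which Kraus operators can be read off. It is built up
  explicitly by the closure rules below, so \<open>noise_choi\<close> need not be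
  diagonalised.\<close>

definition gram_form :: "complex ^ 'a ^ 'a \<Rightarrow> bool" where
  "gram_form J \<longleftrightarrow> (\<exists>vs. J = (\<Sum>v\<leftarrow>vs. outer v v))"

lemma gram_form_outer: "gram_form (outer v v)"
  unfolding gram_form_def by (rule exI[of _ "[v]"]) simp

lemma gram_form_add: "gram_form J \<Longrightarrow> gram_form K \<Longrightarrow> gram_form (J + K)"
  unfolding gram_form_def
proof (elim exE)
  fix vs ws assume "J = (\<Sum>v\<leftarrow>vs. outer v v)" "K = (\<Sum>v\<leftarrow>ws. outer v v)"
  then have "J + K = (\<Sum>v\<leftarrow>vs @ ws. outer v v)" by simp
  then show "\<exists>us. J + K = (\<Sum>v\<leftarrow>us. outer v v)" ..
qed

lemma gram_form_sum: "(\<And>i. i \<in> I \<Longrightarrow> gram_form (J i)) \<Longrightarrow> gram_form (\<Sum>i\<in>I. J i)"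
proof (induction I rule: infinite_finite_induct)
  case empty show ?case unfolding gram_form_def by (rule exI[of _ "[]"]) simp
next
  case (infinite I) then show ?case unfolding gram_form_def by (intro exI[of _ "[]"]) simp
qed (simp add: gram_form_add)

lemma gram_form_conj:
  assumes "gram_form J"
  shows "gram_form (A ** J ** adj A)"
proof -
  obtain vs where J: "J = (\<Sum>v\<leftarrow>vs. outer v v)" using assms by (auto simp: gram_form_def)
  have "A ** J ** adj A = (\<Sum>v\<leftarrow>map ((*v) A) vs. outer v v)"
    unfolding J by (induction vs) (simp_all add: matrix_add_ldistrib matrix_mult_add_left conj_outer o_def)
  then show ?thesis unfolding gram_form_def ..
qed

lemma gram_form_scale:
  assumes "gram_form J" "0 \<le> r"
  shows "gram_form (r *\<^sub>R J)"
proof -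
  have "mat (complex_of_real (sqrt r)) ** J ** adj (mat (complex_of_real (sqrt r))) = r *\<^sub>R J"
  proof -
    have "mat (complex_of_real (sqrt r)) = sqrt r *\<^sub>R (mat 1 :: complex ^ 'a ^ 'a)"
      by (auto simp: vec_eq_iff mat_def scaleR_conv_of_real[where 'a = complex])
    moreover have "adj (sqrt r *\<^sub>R (mat 1 :: complex ^ 'a ^ 'a)) = sqrt r *\<^sub>R mat 1"
      by (auto simp: vec_eq_iff mat_def)
    ultimately show ?thesis using assms(2) by (simp add: matrix_mult_scaleR_left matrix_mult_scaleR_right)
  qed
  then show ?thesis using gram_form_conj[OF assms(1)] by metis
qed

lemma mat1_outer: "mat 1 = (\<Sum>i\<in>UNIV. outer (ket i) (ket i))"
  by (auto simp: vec_eq_iff mat_def ket_nth if_distrib[of "\<lambda>x. x * _"] cong: if_cong)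

lemma gram_form_mat1: "gram_form (mat 1)"
  unfolding mat1_outer by (intro gram_form_sum gram_form_outer)

lemma matrix_ket_decomp: "X = (\<Sum>k\<in>UNIV. \<Sum>l\<in>UNIV. mscale (X $ k $ l) (outer (ket k) (ket l)))"
proof -
  have "(\<Sum>k\<in>UNIV. \<Sum>l\<in>UNIV. X $ k $ l * (ket k $ i * cnj (ket l $ j))) = (\<Sum>k\<in>UNIV. \<Sum>l\<in>UNIV. if l = j then if k = i then X $ k $ l else 0 else 0)" for i j
    by (intro sum.cong refl) (auto simp: ket_nth)
  then show ?thesis by (simp add: vec_eq_iff mscale_def)
qed

lemma clinear_map_sum:
  assumes "clinear_map \<Phi>"
  shows "\<Phi> (\<Sum>i\<in>I. f i) = (\<Sum>i\<in>I. \<Phi> (f i))"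
proof -
  have "\<Phi> 0 = \<Phi> (mscale 0 0)" by (simp add: mscale_def vec_eq_iff zero_vec_def)
  also have "\<dots> = 0" using assms by (simp add: clinear_map_def) (simp add: mscale_def vec_eq_iff)
  finally have "\<Phi> 0 = 0" .
  with assms show ?thesis
    by (induction I rule: infinite_finite_induct) (simp_all add: clinear_map_def)
qed

lemma clinear_map_decomp:
  assumes "clinear_map \<Phi>"
  shows "\<Phi> X = (\<Sum>k\<in>UNIV. \<Sum>l\<in>UNIV. mscale (X $ k $ l) (\<Phi> (outer (ket k) (ket l))))"
  by (subst matrix_ket_decomp[of X]) (use assms in \<open>simp add: clinear_map_sum, simp add: clinear_map_def\<close>)

lemma hs_ket: "hs A (outer (ket k) (ket l)) = cnj (A $ k $ l)"
proof -
  have "hs A (outer (ket k) (ket l)) = cnj (hs (outer (ket k) (ket l)) A)" by (simp add: cnj_hs)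
  also have "cdot (ket k) (A *v ket l) = A $ k $ l"
    by (simp add: cdot_def matrix_vector_mult_def ket_nth if_distrib[of "\<lambda>x. x * _"] if_distrib[of cnj] if_distrib[of "\<lambda>x. _ * x"] cong: if_cong)
  then have "hs (outer (ket k) (ket l)) A = A $ k $ l" by (simp add: hs_outer_left)
  finally show ?thesis by simp
qed

text \<open>Testing against matrix units determines every entry of an adjoint, which gives
  uniqueness. The map with these entries satisfies the adjoint equation by linearity, which gives
  existence.\<close>

lemma hs_adjoint_nth:
  assumes "clinear_map \<Phi>"
  shows "hs_adjoint \<Phi> Y $ k $ l = cnj (hs Y (\<Phi> (outer (ket k) (ket l))))"
proof -
  define \<Psi> where "\<Psi> = (\<lambda>Y. \<chi> k l. cnj (hs Y (\<Phi> (outer (ket k) (ket l)))))"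
  have hs_mscale: "hs A (mscale c B) = c * hs A B" for A B :: "complex ^ 'b ^ 'b" and c
    by (simp add: hs_def cdot_def mscale_def sum_distrib_left algebra_simps)
  have hs_sum: "hs A (\<Sum>i\<in>I. f i) = (\<Sum>i\<in>I. hs A (f i))" for A :: "complex ^ 'b ^ 'b" and I :: "'a set" and f
    by (induction I rule: infinite_finite_induct) (simp_all add: hs_add_right, simp_all add: hs_def)
  have 1: "hs (\<Psi> Y) X = hs Y (\<Phi> X)" for X Y
    by (subst clinear_map_decomp[OF assms, of X])
       (simp add: hs_sum hs_mscale, simp add: hs_def cdot_def \<Psi>_def mult.commute)
  have "hs_adjoint \<Phi> = \<Psi>"
    unfolding hs_adjoint_def hs_trace[symmetric]
  proof (rule the_equality)
    fix \<Psi>' assume "\<forall>X Y. hs (\<Psi>' Y) X = hs Y (\<Phi> X)"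
    then have "hs (\<Psi>' Y) (outer (ket k) (ket l)) = hs (\<Psi> Y) (outer (ket k) (ket l))" for Y k l by (simp add: 1)
    then show "\<Psi>' = \<Psi>" by (simp add: hs_ket vec_eq_iff fun_eq_iff)
  qed (simp add: 1)
  then show ?thesis by (simp add: \<Psi>_def)
qed

text \<open>Up to conjugation, the Choi matrix of the adjoint only rearranges the entries of the map
  on matrix units, so it determines a linear map.\<close>

lemma choi_hs_adjoint_nth:
  assumes "clinear_map \<Phi>"
  shows "choi (hs_adjoint \<Phi>) $ (i, k) $ (j, l) = cnj (\<Phi> (outer (ket k) (ket l)) $ i $ j)"
  unfolding choi_nth hs_adjoint_nth[OF assms]
  by (subst cnj_hs[symmetric]) (simp add: hs_ket)

lemma matrix_ket_nth: "(A *v ket k) $ i = A $ i $ k"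
  by (simp add: matrix_vector_mult_def ket_nth if_distrib[of "\<lambda>x. _ * x"] cong: if_cong)

text \<open>Passing to the Hilbert-Schmidt adjoint replaces each Kraus operator by its adjoint,
  which gives existence. Uniqueness holds because linear maps that agree on matrix units are
  equal.\<close>

lemma the_map_with_adjoint_choi:
  assumes J: "J = (\<Sum>K\<leftarrow>Ks. outer (vectorize K) (vectorize K))"
  shows "kraus_ops (THE \<Phi>. clinear_map \<Phi> \<and> choi (hs_adjoint \<Phi>) = J) (map adj Ks)"
proof -
  define \<Phi> where "\<Phi> = (\<lambda>X. \<Sum>L\<leftarrow>map adj Ks. L ** X ** adj L)"
  have kr: "kraus_ops \<Phi> (map adj Ks)" by (simp add: kraus_ops_def \<Phi>_def)
  note lin = clinear_map_kraus[OF kr]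
  have "cnj (\<Phi> (outer (ket k) (ket l)) $ i $ j) = J $ (i, k) $ (j, l)" for i k j l
    unfolding \<Phi>_def J conj_outer
    by (induction Ks) (simp_all add: conj_outer matrix_ket_nth vectorize_nth)
  then have choi: "choi (hs_adjoint \<Phi>) = J"
    by (simp add: vec_eq_iff choi_hs_adjoint_nth[OF lin])
  have "(THE \<Phi>. clinear_map \<Phi> \<and> choi (hs_adjoint \<Phi>) = J) = \<Phi>"
  proof (rule the_equality)
    fix \<Psi> :: "('b, 'a) supermap" assume \<Psi>: "clinear_map \<Psi> \<and> choi (hs_adjoint \<Psi>) = J"
    have "\<Psi> (outer (ket k) (ket l)) $ i $ j = \<Phi> (outer (ket k) (ket l)) $ i $ j" for i j k l
      using \<Psi> choi choi_hs_adjoint_nth[OF lin, of i k j l] choi_hs_adjoint_nth[of \<Psi> i k j l]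
      by (metis complex_cnj_cnj)
    then have eq: "\<Psi> (outer (ket k) (ket l)) = \<Phi> (outer (ket k) (ket l))" for k l by (simp add: vec_eq_iff)
    show "\<Psi> = \<Phi>"
    proof
      fix X
      have "\<Psi> X = (\<Sum>k\<in>UNIV. \<Sum>l\<in>UNIV. mscale (X $ k $ l) (\<Psi> (outer (ket k) (ket l))))"
        by (rule clinear_map_decomp[OF conjunct1[OF \<Psi>]])
      also have "\<dots> = (\<Sum>k\<in>UNIV. \<Sum>l\<in>UNIV. mscale (X $ k $ l) (\<Phi> (outer (ket k) (ket l))))"
        by (simp only: eq)
      also have "\<dots> = \<Phi> X" by (rule clinear_map_decomp[OF lin, symmetric])
      finally show "\<Psi> X = \<Phi> X" .
    qed
  qed (use lin choi in simp)
  then show ?thesis using kr by simp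
qed

section \<open>Orthogonal projectors\<close>

locale orthonormal_family =
  fixes e :: "'i::finite \<Rightarrow> complex ^ 'a"
  assumes orthonormal: "cdot (e i) (e j) = (if i = j then 1 else 0)"
begin

definition "proj = (\<Sum>i\<in>UNIV. outer (e i) (e i))"

lemma proj_vec: "proj *v y = (\<Sum>i\<in>UNIV. cdot (e i) y *s e i)"
  by (simp add: proj_def matrix_vector_sum_left outer_mult_vec)

lemma cdot_proj_vec: "cdot (e i) (proj *v y) = cdot (e i) y"
  by (simp add: proj_vec cdot_sum_right cdot_scale_right orthonormal if_distrib[of "\<lambda>x. _ * x"] cong: if_cong)

lemma adj_proj: "adj proj = proj"
proof -
  have "adj (\<Sum>i\<in>I. outer (e i) (e i)) = (\<Sum>i\<in>I. outer (e i) (e i))" for I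
    by (induction I rule: infinite_finite_induct) (auto simp: vec_eq_iff)
  then show ?thesis by (simp add: proj_def)
qed

lemma proj_idem: "proj ** proj = proj"
proof -
  have "(proj ** proj) *v y = proj *v y" for y
    by (simp add: matrix_vector_mul_assoc[symmetric] proj_vec[of "proj *v y"] cdot_proj_vec) (simp add: proj_vec)
  then show ?thesis by (simp add: matrix_eq)
qed

lemma cdot_proj: "cdot y (proj *v y) = of_real (\<Sum>i\<in>UNIV. (cmod (cdot (e i) y))\<^sup>2)"
  unfolding proj_vec cdot_sum_right cdot_scale_right of_real_sum complex_norm_square cnj_cdot ..

lemma norm_proj_perp: "(norm (y - proj *v y))\<^sup>2 = (norm y)\<^sup>2 - (\<Sum>i\<in>UNIV. (cmod (cdot (e i) y))\<^sup>2)"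
proof -
  have "cdot (proj *v y) (proj *v y) = cdot y (proj *v y)" 
    using cdot_adj[of y proj "proj *v y"] by (simp add: adj_proj matrix_vector_mul_assoc proj_idem)
  moreover have "cdot (proj *v y) y = cdot y (proj *v y)" by (simp add: cdot_adj adj_proj)
  ultimately have "complex_of_real ((norm (y - proj *v y))\<^sup>2) = of_real ((norm y)\<^sup>2 - (\<Sum>i\<in>UNIV. (cmod (cdot (e i) y))\<^sup>2))"
    unfolding of_real_diff cdot_self[symmetric] cdot_proj[symmetric] cdot_diff_left cdot_diff_right by simp
  then show ?thesis by (simp only: of_real_eq_iff)
qed

lemma bessel: "(\<Sum>i\<in>UNIV. (cmod (cdot (e i) y))\<^sup>2) \<le> (norm y)\<^sup>2"
  using norm_proj_perp[of y] zero_le_power2[of "norm (y - proj *v y)"] by linarith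

lemma range_proj: "range (\<lambda>y. proj *v y) = vec.span (range e)"
proof
  show "range (\<lambda>y. proj *v y) \<subseteq> vec.span (range e)"
    unfolding proj_vec by (intro image_subsetI vec.span_sum vec.span_scale vec.span_base rangeI)
  have "vec.span (range e) \<subseteq> {y. proj *v y = y}"
  proof (rule vec.span_minimal)
    show "range e \<subseteq> {y. proj *v y = y}"
      by (auto simp: proj_vec orthonormal if_distrib[of "\<lambda>x. x *s _"] cong: if_cong)
    show "vec.subspace {y. proj *v y = y}"
      by (auto simp: vec.subspace_def matrix_vector_right_distrib vector_scalar_commute)
  qed
  then have "y = proj *v y" if "y \<in> vec.span (range e)" for y using that by auto
  then show "vec.span (range e) \<subseteq> range (\<lambda>y. proj *v y)" by (intro subsetI range_eqI)
qed

text \<open>A projector with the same range satisfies P proj = proj and proj P = P. The adjoint of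
  the second equation is P proj = P, so the two coincide.\<close>

lemma ortho_projector_span: "ortho_projector (vec.span (range e)) = proj"
  unfolding ortho_projector_def
proof (rule the_equality)
  show "proj ** proj = proj \<and> adj proj = proj \<and> range (\<lambda>v. proj *v v) = vec.span (range e)"
    by (simp add: proj_idem adj_proj range_proj)
  fix P assume P: "P ** P = P \<and> adj P = P \<and> range (\<lambda>v. P *v v) = vec.span (range e)"
  then have r: "range (\<lambda>v. P *v v) = range (\<lambda>v. proj *v v)" by (simp add: range_proj)
  have "P *v (proj *v y) = proj *v y" for y
  proof -
    obtain x where "proj *v y = P *v x" using r by blast
    then show ?thesis using P by (simp add: matrix_vector_mul_assoc)
  qed
  then have 1: "P ** proj = proj" by (simp add: matrix_eq matrix_vector_mul_assoc[symmetric])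
  have "proj *v (P *v y) = P *v y" for y
  proof -
    obtain x where "P *v y = proj *v x" using r by blast
    then show ?thesis by (simp add: matrix_vector_mul_assoc proj_idem)
  qed
  then have 2: "proj ** P = P" by (simp add: matrix_eq matrix_vector_mul_assoc[symmetric])
  have "P = adj (proj ** P)" using P 2 by simp
  also have "\<dots> = P ** proj" using P by (simp add: adj_mult adj_proj)
  finally show "P = proj" using 1 by simp
qed

end

section \<open>The noise channel\<close>

text \<open>\<open>amp\<close>, \<open>amp_diag\<close> and \<open>amp_low\<close> are the values of
  \<open>a\<close>, \<open>b\<close> and \<open>v\<close> in \<open>frame_params\<close> for the
  operator Q_p of the channel.\<close>

definition amp :: "real \<Rightarrow> real \<Rightarrow> real" where
  "amp d p = sqrt d * sqrt (lam4 d p / (d\<^sup>2 - 1))"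

definition amp_diag :: "real \<Rightarrow> real \<Rightarrow> real" where
  "amp_diag d p = (sqrt (lam5 d p) - sqrt (lam4 d p / (d\<^sup>2 - 1))) / sqrt d"

definition amp_low :: "real \<Rightarrow> real \<Rightarrow> real" where
  "amp_low d p = sqrt ((d - 1) * (lam4 d p / (d\<^sup>2 - 1)) + lam5 d p)"

lemma d_sq_ge: "2 \<le> d \<Longrightarrow> 4 \<le> d\<^sup>2" for d :: real
  using power_mono[of 2 d 2] by simp

text \<open>\<open>al\<close> and \<open>be\<close> are the eigenvalues of Q_p divided by the square
  root of d. Everything follows from 0 \<le> be \<le> al and from (d^2 - 1) al^2 + be^2 = lam4 +
  lam5 = 1.\<close>

lemma frame_params_amp:
  assumes d: "2 \<le> d" and p: "0 \<le> p" "p < 1"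
  shows "frame_params d (amp d p) (amp_diag d p) (amp_low d p)"
proof -
  define al be where "al = sqrt (lam4 d p / (d\<^sup>2 - 1))" and "be = sqrt (lam5 d p)"
  note d4 = d_sq_ge[OF d]
  have "0 < lam4 d p / (d\<^sup>2 - 1)"
    unfolding lam4_def using d4 p d by (intro divide_pos_pos) auto
  then have al0: "0 < al" by (simp add: al_def)
  have be0: "0 \<le> be" using p by (simp add: be_def lam5_def)
  have al2: "al\<^sup>2 = lam4 d p / (d\<^sup>2 - 1)" using \<open>0 < lam4 d p / (d\<^sup>2 - 1)\<close> by (simp add: al_def)
  have be2: "be\<^sup>2 = lam5 d p" using p by (simp add: be_def lam5_def)
  have sd: "sqrt d * sqrt d = d" "sqrt d > 0" using d by auto
  have "(1 - p) * (d\<^sup>2 - 1) \<le> 1 * (d\<^sup>2 - 1)" using p d4 by (intro mult_right_mono) auto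
  also have "\<dots> \<le> d\<^sup>2 - 1 + p" using p by simp
  finally have "1 - p \<le> (d\<^sup>2 - 1 + p) / (d\<^sup>2 - 1)"
    by (rule mult_imp_le_div_pos[rotated]) (use d4 in simp)
  then have "(1 - p) / d\<^sup>2 \<le> (d\<^sup>2 - 1 + p) / (d\<^sup>2 - 1) / d\<^sup>2"
    by (rule divide_right_mono) simp
  then have "lam5 d p \<le> lam4 d p / (d\<^sup>2 - 1)"
    by (simp add: lam4_def lam5_def mult.commute)
  then have be_le: "be \<le> al" unfolding al_def be_def by simp
  have tot: "(d\<^sup>2 - 1) * al\<^sup>2 + be\<^sup>2 = 1"
  proof -
    have "lam4 d p + lam5 d p = 1"
      using d by (simp add: lam4_def lam5_def add_divide_distrib[symmetric])
    then show ?thesis using d4 by (simp add: al2 be2)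
  qed
  have a: "amp d p = sqrt d * al" and b: "amp_diag d p = (be - al) / sqrt d"
    by (simp_all add: amp_def amp_diag_def al_def be_def)
  have a2: "(amp d p)\<^sup>2 = d * al\<^sup>2" and ab: "amp d p * amp_diag d p = al * (be - al)"
    and b2: "d * (amp_diag d p)\<^sup>2 = (be - al)\<^sup>2" and nb: "d * amp_diag d p = sqrt d * (be - al)"
    using sd d by (auto simp: a b power_mult_distrib power_divide real_div_sqrt field_simps)
  have v2: "(amp_low d p)\<^sup>2 = (d - 1) * al\<^sup>2 + be\<^sup>2"
    unfolding amp_low_def al2[symmetric] be2[symmetric] using d by simp
  show ?thesis
  proof
    show "0 < amp d p" using al0 sd by (simp add: a)
    show "amp_diag d p \<le> 0" using be_le sd by (simp add: b divide_le_0_iff)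
    have "2 * amp d p + d * amp_diag d p = sqrt d * (al + be)" unfolding nb a by (simp add: algebra_simps)
    then show "0 \<le> 2 * amp d p + d * amp_diag d p" using al0 be0 sd by simp
    show "0 \<le> amp_low d p" using d4 d p by (simp add: amp_low_def lam4_def lam5_def)
    show "d * (amp d p)\<^sup>2 + 2 * amp d p * amp_diag d p + d * (amp_diag d p)\<^sup>2 = 1"
      using tot unfolding mult.assoc[of 2] a2 ab b2 by algebra
    show "(amp_low d p)\<^sup>2 = (amp d p)\<^sup>2 + 2 * amp d p * amp_diag d p + d * (amp_diag d p)\<^sup>2"
      unfolding mult.assoc[of 2] a2 ab b2 v2 by algebra
    show "2 \<le> d" by (rule d)
  qed
qed

section \<open>The operators B_ij as an orthonormal family\<close>

lemma psi_tau_nth: "(psi_tau :: complex ^ ('n::finite \<times> 'n)) $ r = (if fst r = snd r then of_real (1 / sqrt (real CARD('n))) else 0)"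
proof -
  have "(\<Sum>i\<in>UNIV. vtensor (ket i) (ket i) $ r) = (\<Sum>i\<in>UNIV. if i = fst r then if fst r = snd r then 1 else 0 else (0 :: complex))"
    by (intro sum.cong refl) (auto simp: vtensor_def ket_nth)
  then show ?thesis by (simp add: psi_tau_def scaleR_conv_of_real[where 'a = complex])
qed

lemma norm_psi_tau: "norm (psi_tau :: complex ^ ('n::finite \<times> 'n)) = 1"
proof -
  have "(norm (psi_tau :: complex ^ ('n \<times> 'n)))\<^sup>2 = (\<Sum>l\<in>(UNIV :: 'n set). \<Sum>s\<in>UNIV. if l = s then 1 / real CARD('n) else 0)"
    unfolding norm_vec_sq sum_prod_UNIV psi_tau_nth by (intro sum.cong refl) (auto simp: power_divide norm_divide)
  then have "(norm (psi_tau :: complex ^ ('n \<times> 'n)))\<^sup>2 = 1" by simp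
  then show ?thesis by (metis norm_ge_zero power2_eq_1_iff less_eq_real_def neg_0_le_iff_le not_one_le_zero)
qed

text \<open>The link between the channel and \<open>encoder\<close>: fixing the second column index
  \<open>i\<close> is multiplication by I \<otimes> |i> on the right.\<close>

lemma Q_op_nth:
  fixes i k l s :: "'n::finite"
  defines "d \<equiv> real CARD('n)"
  shows "(Q_op p :: complex ^ ('n \<times> 'n) ^ ('n \<times> 'n)) $ (l, s) $ (k, i) = encoder (amp d p) (amp_diag d p) (ket i) $ (l, s) $ k"
proof -
  have d0: "d > 0" by (simp add: d_def)
  define al be where "al = sqrt (lam4 d p / (d\<^sup>2 - 1))" and "be = sqrt (lam5 d p)"
  have pi: "pi_C $ (l, s) $ (k, i) = (if l = s \<and> k = i then of_real (1 / d) else 0)"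
    using d0 by (auto simp: pi_C_def psi_tau_nth d_def[symmetric] simp flip: of_real_mult of_real_inverse)
  have "Q_op p $ (l, s) $ (k, i) = of_real (sqrt d * al) * (mat 1 $ (l, s) $ (k, i))
     + of_real (sqrt d * (be - al)) * pi_C $ (l, s) $ (k, i)"
    unfolding Q_op_def Let_def d_def[symmetric] al_def[symmetric] be_def[symmetric]
    by (simp add: scaleR_conv_of_real[where 'a = complex] algebra_simps)
  also have "\<dots> = encoder (amp d p) (amp_diag d p) (ket i) $ (l, s) $ k"
  proof -
    have "sqrt d * (1 / d) = 1 / sqrt d" using d0 by (simp add: field_simps)
    then have "sqrt d * (be - al) * (1 / d) = amp_diag d p"
      unfolding amp_diag_def al_def[symmetric] be_def[symmetric] by algebra
    then have c1: "complex_of_real (sqrt d * (be - al)) * of_real (1 / d) = of_real (amp_diag d p)"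
      by (metis of_real_mult)
    have c2: "sqrt d * al = amp d p" by (simp add: amp_def al_def)
    show ?thesis
      unfolding pi encoder_def mat_def c2
      by (auto simp: ket_nth c1 simp del: of_real_mult of_real_divide of_real_diff)
  qed
  finally show ?thesis .
qed

lemma B_op_nth:
  fixes i j :: "'n::finite"
  shows "B_op p i j $ r $ (k, t) = (if t = j then encoder (amp (real CARD('n)) p) (amp_diag (real CARD('n)) p) (ket i) $ r $ k else 0)"
proof -
  have "B_op p i j $ r $ (k, t) = (\<Sum>k'\<in>UNIV. \<Sum>i'\<in>UNIV. if i' = i then if k' = k then if t = j then Q_op p $ r $ (k', i') else 0 else 0 else 0)"
    unfolding B_op_def matrix_matrix_mult_def vec_lambda_beta sum_prod_UNIV mtensor_def
    by (intro sum.cong refl) (auto simp: mat_def ket_nth)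
  also have "\<dots> = (if t = j then Q_op p $ r $ (k, i) else 0)" by simp
  finally show ?thesis by (cases r) (simp add: Q_op_nth)
qed

text \<open>The product T (I \<otimes> |j>).\<close>

definition col_block :: "complex ^ ('a::finite \<times> 'b::finite) ^ 'c \<Rightarrow> 'b \<Rightarrow> complex ^ 'a ^ 'c" where
  "col_block T j = (\<chi> r k. T $ r $ (k, j))"

text \<open>B_ij is the encoder for |i> placed in column block \<open>j\<close> with zeros
  elsewhere, so it tests only this block of \<open>T\<close>.\<close>

lemma hs_B_op:
  fixes T :: "complex ^ ('n::finite \<times> 'n) ^ ('n \<times> 'n)"
  defines "d \<equiv> real CARD('n)"
  shows "hs (B_op p i j) T = coords (amp d p) (amp_diag d p) (col_block T j) $ i"
proof -
  have "hs (B_op p i j) T = (\<Sum>r\<in>UNIV. \<Sum>k\<in>UNIV. \<Sum>t\<in>UNIV. if t = j then cnj (encoder (amp d p) (amp_diag d p) (ket i) $ r $ k) * T $ r $ (k, t) else 0)"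
    unfolding hs_def cdot_def sum_prod_UNIV[of "\<lambda>kt. cnj (B_op p i j $ _ $ kt) * _ $ kt"] B_op_nth d_def
    by (intro sum.cong refl) auto
  also have "\<dots> = hs (encoder (amp d p) (amp_diag d p) (ket i)) (col_block T j)"
    by (simp add: hs_def cdot_def col_block_def)
  also have "\<dots> = coords (amp d p) (amp_diag d p) (col_block T j) $ i"
    by (simp add: hs_encoder cdot_def ket_nth if_distrib[of cnj] if_distrib[of "\<lambda>x. x * _"] cong: if_cong)
  finally show ?thesis .
qed

lemma col_block_B_op:
  fixes i j :: "'n::finite"
  shows "col_block (B_op p i j) j' = (if j' = j then encoder (amp (real CARD('n)) p) (amp_diag (real CARD('n)) p) (ket i) else 0)"
  by (auto simp: col_block_def vec_eq_iff B_op_nth)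

lemma coords_zero: "coords a b 0 = 0"
  by (simp add: coords_def vec_eq_iff)

lemma orthonormal_B_op:
  assumes "CARD('n::finite) \<ge> 2" "0 \<le> p" "p < 1"
  shows "orthonormal_family (\<lambda>(i, j). vectorize (B_op p (i :: 'n) j))"
proof
  fix r r' :: "'n \<times> 'n"
  interpret frame_params "real CARD('n)" "amp (real CARD('n)) p" "amp_diag (real CARD('n)) p" "amp_low (real CARD('n)) p"
    using assms by (intro frame_params_amp) auto
  show "cdot (case r of (i, j) \<Rightarrow> vectorize (B_op p i j)) (case r' of (i, j) \<Rightarrow> vectorize (B_op p i j)) = (if r = r' then 1 else 0)"
    by (cases r; cases r') (auto simp: cdot_vectorize hs_B_op col_block_B_op coords_encoder[OF normalized] coords_zero ket_nth)
qed

lemma orthonormal_ket_tensor: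
  assumes "norm \<psi> = 1"
  shows "orthonormal_family (\<lambda>i. vtensor (ket i) \<psi>)"
proof
  fix i j
  have "cdot (vtensor (ket i) \<psi>) (vtensor (ket j) \<psi>) = (\<Sum>a\<in>UNIV. \<Sum>b\<in>UNIV. if a = i then if a = j then cnj (\<psi> $ b) * \<psi> $ b else 0 else 0)"
    unfolding cdot_def sum_prod_UNIV by (intro sum.cong refl) (auto simp: vtensor_def ket_nth)
  also have "\<dots> = (\<Sum>b\<in>UNIV. if i = j then cnj (\<psi> $ b) * \<psi> $ b else 0)" by (subst sum.swap) simp
  also have "\<dots> = (if i = j then cdot \<psi> \<psi> else 0)" by (simp add: cdot_def)
  finally show "cdot (vtensor (ket i) \<psi>) (vtensor (ket j) \<psi>) = (if i = j then 1 else 0)"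
    using assms by (simp add: cdot_self)
qed

text \<open>The eigenvalue of \<open>X_op\<close> at \<open>psi_tau\<close>. It is the largest one,
  since the coefficient of \<open>pi_C\<close> is nonnegative by \<open>lam_nonneg\<close>.\<close>

definition xi :: "real \<Rightarrow> real \<Rightarrow> real" where
  "xi d p = lam3 d p + lam2 d p / lam4 d p"

text \<open>Put e = 1 - lam1, which is at most 1/2. The two summands of \<open>xi\<close> are at
  most 1/3 and 2/3 of 1 - e = lam1, so lam1 dominates the whole spectrum of
  \<open>noise_choi\<close>.\<close>

lemma lam_nonneg:
  assumes d: "2 \<le> d" and p: "0 \<le> p" "p < 1"
  shows "0 \<le> lam3 d p" "0 \<le> lam2 d p / lam4 d p" "xi d p \<le> lam1 d p" "0 \<le> lam1 d p" "lam1 d p \<le> 1"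
proof -
  note d4 = d_sq_ge[OF d]
  define e where "e = p / (d\<^sup>2 - 2)"
  have e0: "0 \<le> e" using p d4 by (simp add: e_def)
  have "p * 2 \<le> 1 * 2" using p by simp
  also have "1 * 2 \<le> d\<^sup>2 - 2" using d4 by simp
  finally have e1: "e \<le> 1 / 2" using d4 by (simp add: e_def field_simps)
  have l1: "lam1 d p = 1 - e" by (simp add: lam1_def e_def)
  show "0 \<le> lam1 d p" "lam1 d p \<le> 1" using e0 e1 by (auto simp: l1)
  have "lam4 d p \<ge> (d\<^sup>2 - 1) / d\<^sup>2" unfolding lam4_def using p d by (intro divide_right_mono) auto
  then have dl4: "d\<^sup>2 * lam4 d p \<ge> d\<^sup>2 - 1" using d p by (simp add: lam4_def)
  have l40: "0 < lam4 d p" unfolding lam4_def using d4 p d by (intro divide_pos_pos) auto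
  have "3 / 4 \<le> (d\<^sup>2 - 1) / d\<^sup>2" using d4 d by (simp add: pos_le_divide_eq)
  then have l4: "3 / 4 \<le> lam4 d p" using \<open>lam4 d p \<ge> (d\<^sup>2 - 1) / d\<^sup>2\<close> by linarith
  have l2: "lam2 d p = e * (d\<^sup>2 * (1 - e) - 1) / (d\<^sup>2 * lam4 d p)" and l3: "lam3 d p = 2 * e\<^sup>2 / (d\<^sup>2 * lam4 d p)"
    by (simp_all add: lam2_def lam3_def l1)
  show l30: "0 \<le> lam3 d p" using d l40 by (simp add: l3)
  have "d\<^sup>2 * (1 / 2) \<le> d\<^sup>2 * (1 - e)" using e1 by (intro mult_left_mono) auto
  then have num: "0 \<le> d\<^sup>2 * (1 - e) - 1" using d4 by simp
  then show "0 \<le> lam2 d p / lam4 d p" using e0 l40 d by (simp add: l2)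
  have "d\<^sup>2 * (1 - e) - 1 \<le> (1 - e) * (d\<^sup>2 * lam4 d p)"
  proof -
    have "(1 - e) * (d\<^sup>2 - 1) \<le> (1 - e) * (d\<^sup>2 * lam4 d p)" using dl4 e1 by (intro mult_left_mono) auto
    moreover have "d\<^sup>2 * (1 - e) - 1 \<le> (1 - e) * (d\<^sup>2 - 1)" using e0 by (simp add: algebra_simps)
    ultimately show ?thesis by simp
  qed
  then have "e * (d\<^sup>2 * (1 - e) - 1) \<le> e * ((1 - e) * (d\<^sup>2 * lam4 d p))" using e0 by (rule mult_left_mono)
  then have l2le: "lam2 d p \<le> e * (1 - e)"
    unfolding l2 using d l40 by (simp add: pos_divide_le_eq mult_ac)
  have "e * (1 - e) \<le> (1 / 2) * (1 - e)" using e1 by (intro mult_right_mono) auto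
  then have "lam2 d p \<le> (1 / 2) * (1 - e)" using l2le by linarith
  then have "lam2 d p / lam4 d p \<le> ((1 / 2) * (1 - e)) / (3 / 4)"
    using l4 e1 by (intro frac_le) auto
  also have "\<dots> = (2 / 3) * (1 - e)" by simp
  finally have A: "lam2 d p / lam4 d p \<le> (2 / 3) * (1 - e)" .
  have "lam3 d p \<le> 2 * e\<^sup>2 / 3" unfolding l3 using dl4 d4 by (intro frac_le) auto
  also have "\<dots> \<le> 2 * (e * (1 / 2)) / 3"
    unfolding power2_eq_square using e0 e1 by (intro divide_right_mono mult_left_mono) auto
  also have "\<dots> \<le> (1 / 3) * (1 - e)" using e1 by simp
  finally have "lam3 d p \<le> (1 / 3) * (1 - e)" .
  with A show "xi d p \<le> lam1 d p" unfolding xi_def l1 right_diff_distrib by linarith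
qed

lemma sum_list_concat_map: "(\<Sum>y\<leftarrow>concat (map f xs). h y) = (\<Sum>x\<leftarrow>xs. \<Sum>y\<leftarrow>f x. h y)"
  by (induction xs) simp_all

lemma sum_list_swap: "(\<Sum>x\<leftarrow>xs. \<Sum>y\<leftarrow>ys. f x y) = (\<Sum>y\<leftarrow>ys. \<Sum>x\<leftarrow>xs. f x y)"
  for f :: "'a \<Rightarrow> 'b \<Rightarrow> real"
  by (induction xs) (simp_all add: sum_list_addf)

section \<open>The quadratic form of the noise channel\<close>

lemma mtensor_mat1_pi: "mtensor (mat 1) (outer \<psi> \<psi>) = orthonormal_family.proj (\<lambda>i. vtensor (ket i) \<psi>)"
  if "norm \<psi> = 1"
proof -
  have *: "(\<Sum>i\<in>UNIV. outer (vtensor (ket i) \<psi>) (vtensor (ket i) \<psi>)) $ r $ s = mtensor (mat 1) (outer \<psi> \<psi>) $ r $ s" for r s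
  proof -
    have "(\<Sum>i\<in>UNIV. outer (vtensor (ket i) \<psi>) (vtensor (ket i) \<psi>)) $ r $ s
      = (\<Sum>i\<in>UNIV. if i = fst r then if fst r = fst s then \<psi> $ snd r * cnj (\<psi> $ snd s) else 0 else 0)"
      unfolding sum_component by (intro sum.cong refl) (auto simp: vtensor_def ket_nth)
    then show ?thesis by (simp add: mtensor_def mat_def)
  qed
  show ?thesis unfolding orthonormal_family.proj_def[OF orthonormal_ket_tensor[OF that]] vec_eq_iff * by simp
qed

lemma mtensor_X_op:
  "mtensor (mat 1) (X_op p :: complex ^ ('n::finite \<times> 'n) ^ ('n \<times> 'n)) =
    lam3 (real CARD('n)) p *\<^sub>R mat 1 + (lam2 (real CARD('n)) p / lam4 (real CARD('n)) p) *\<^sub>R mtensor (mat 1) pi_C"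
  by (auto simp: vec_eq_iff mtensor_def X_op_def Let_def mat_def)

locale noise_channel =
  fixes p d :: real and ty :: "'n::finite itself"
  assumes d_eq: "d = real CARD('n)" and d_ge: "2 \<le> d" and p: "0 \<le> p" "p < 1"
begin

sublocale B: orthonormal_family "\<lambda>(i, j). vectorize (B_op p (i :: 'n) j)"
  by (rule orthonormal_B_op) (use d_eq d_ge p in auto)

sublocale K: orthonormal_family "\<lambda>i :: 'n \<times> 'n. vtensor (ket i) (psi_tau :: complex ^ ('n \<times> 'n))"
  by (rule orthonormal_ket_tensor[OF norm_psi_tau])

sublocale frame_params d "amp d p" "amp_diag d p" "amp_low d p"
  by (rule frame_params_amp[OF d_ge p])

lemma P_proj_eq: "P_proj p = B.proj"
proof -
  have "{vectorize (B_op p i j) | (i :: 'n) j. True} = range (\<lambda>(i, j). vectorize (B_op p i j))" by auto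
  then show ?thesis unfolding P_proj_def by (simp only: B.ortho_projector_span)
qed

lemmas lam_bounds = lam_nonneg[OF d_ge p]

text \<open>Both P and I \<otimes> pi are sums of outer products over orthonormal families. All
  coefficients are nonnegative, and conjugation by the complement of P preserves the form.\<close>

lemma gram_form_noise: "gram_form (noise_choi p :: complex ^ (('n \<times> 'n) \<times> ('n \<times> 'n)) ^ (('n \<times> 'n) \<times> ('n \<times> 'n)))"
proof -
  have "gram_form B.proj" unfolding B.proj_def by (intro gram_form_sum gram_form_outer)
  moreover have "gram_form (mtensor (mat 1 :: complex ^ ('n \<times> 'n) ^ ('n \<times> 'n)) (X_op p :: complex ^ ('n \<times> 'n) ^ ('n \<times> 'n)))"
    unfolding mtensor_X_op d_eq[symmetric] pi_C_def mtensor_mat1_pi[OF norm_psi_tau] K.proj_def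
    by (intro gram_form_add gram_form_scale gram_form_mat1 gram_form_sum gram_form_outer lam_bounds)
  moreover have "adj (mat 1 - B.proj) = mat 1 - B.proj"
    using B.adj_proj by (auto simp: vec_eq_iff mat_def)
  ultimately show ?thesis
    unfolding noise_choi_def P_proj_eq d_eq[symmetric]
    using gram_form_conj[of _ "mat 1 - B.proj"] by (metis gram_form_add gram_form_scale lam_bounds(4))
qed

lemma noise_kraus:
  obtains Ks where "kraus_ops (noise p :: ('n \<times> 'n, 'n \<times> 'n) supermap) (map adj Ks)"
    and "(noise_choi p :: complex ^ (('n \<times> 'n) \<times> ('n \<times> 'n)) ^ (('n \<times> 'n) \<times> ('n \<times> 'n))) = (\<Sum>K\<leftarrow>Ks. outer (vectorize K) (vectorize K))"
proof -
  obtain vs where "(noise_choi p :: complex ^ (('n \<times> 'n) \<times> ('n \<times> 'n)) ^ (('n \<times> 'n) \<times> ('n \<times> 'n))) = (\<Sum>v\<leftarrow>vs. outer v v)"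
    using gram_form_noise unfolding gram_form_def by (rule exE)
  moreover define Ks :: "(complex ^ ('n \<times> 'n) ^ ('n \<times> 'n)) list" where "Ks = map (inv vectorize) vs"
  have "surj (vectorize :: complex ^ ('n \<times> 'n) ^ ('n \<times> 'n) \<Rightarrow> _)"
    by (rule surjI[of _ "\<lambda>v. \<chi> k i. v $ (i, k)"]) (auto simp: vec_eq_iff vectorize_nth)
  then have "vs = map vectorize Ks"
    by (simp add: Ks_def o_def surj_f_inv_f)
  ultimately have J: "(noise_choi p :: complex ^ (('n \<times> 'n) \<times> ('n \<times> 'n)) ^ (('n \<times> 'n) \<times> ('n \<times> 'n))) = (\<Sum>K\<leftarrow>Ks. outer (vectorize K) (vectorize K))"
    by (simp add: o_def)
  show thesis
    using that[OF _ J] the_map_with_adjoint_choi[OF J] unfolding noise_def by blast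
qed

text \<open>The squared length of the projection of |T>> onto the span of the |B_ij>>; see
  \<open>sum_B_weight\<close>.\<close>

definition weight :: "complex ^ ('n \<times> 'n) ^ ('n \<times> 'n) \<Rightarrow> real" where
  "weight T = (\<Sum>j\<in>UNIV. (norm (coords (amp d p) (amp_diag d p) (col_block T j)))\<^sup>2)"

definition noise_form :: "complex ^ ('n \<times> 'n) ^ ('n \<times> 'n) \<Rightarrow> real" where
  "noise_form T = Re (cdot (vectorize T) (noise_choi p *v vectorize T))"

lemma sum_B_weight: "(\<Sum>r\<in>UNIV. (cmod (cdot (case r of (i, j) \<Rightarrow> vectorize (B_op p i j)) (vectorize T)))\<^sup>2) = weight T"
  unfolding sum_prod_UNIV weight_def norm_vec_sq
  by (subst sum.swap) (simp add: cdot_vectorize hs_B_op d_eq)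

lemma weight_le: "weight T \<le> (norm T)\<^sup>2"
  using B.bessel[of "vectorize T"] by (simp only: sum_B_weight norm_vectorize)

text \<open>The range of P contributes exactly lam1 times the weight. The component \<open>z\<close>
  orthogonal to it contributes the form of I \<otimes> X_p, which lies between 0 and
  \<open>xi\<close> times its squared norm.\<close>

lemma form_bounds:
  shows "lam1 d p * weight T \<le> noise_form T" "noise_form T \<le> lam1 d p * weight T + xi d p * ((norm T)\<^sup>2 - weight T)"
proof -
  define y z where "y = vectorize T" and "z = y - B.proj *v y"
  have z2: "(norm z)\<^sup>2 = (norm T)\<^sup>2 - weight T"
    unfolding z_def B.norm_proj_perp by (simp only: y_def sum_B_weight norm_vectorize)
  define M where "M = mtensor (mat 1 :: complex ^ ('n \<times> 'n) ^ ('n \<times> 'n)) (X_op p :: complex ^ ('n \<times> 'n) ^ ('n \<times> 'n))"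
  have adj: "adj (mat 1 - B.proj) = mat 1 - B.proj"
    using B.adj_proj by (auto simp: vec_eq_iff mat_def)
  have "cdot y (noise_choi p *v y) = of_real (lam1 d p * weight T) + cdot z (M *v z)"
  proof -
    have "cdot y (((mat 1 - B.proj) ** M ** (mat 1 - B.proj)) *v y) = cdot z (M *v z)"
      using cdot_adj[of y "mat 1 - B.proj" "M *v ((mat 1 - B.proj) *v y)"]
      by (simp add: adj matrix_vector_mul_assoc[symmetric] z_def matrix_vector_mult_diff_rdistrib)
    moreover have "cdot y (B.proj *v y) = of_real (weight T)"
      unfolding B.cdot_proj y_def sum_B_weight ..
    ultimately show ?thesis
      unfolding noise_choi_def P_proj_eq M_def[symmetric] d_eq[symmetric]
      by (simp add: matrix_vector_mult_add_rdistrib cdot_add_right matrix_vector_scaleR_left cdot_scaleR_right)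
  qed
  \<comment> \<open>The squared projection of \<open>z\<close> onto the vectors x \<otimes> psi_tau,
    where the \<open>pi_C\<close> part of \<open>X_op\<close> acts.\<close>
  moreover define k where "k = (\<Sum>i\<in>UNIV. (cmod (cdot (vtensor (ket i) (psi_tau :: complex ^ ('n \<times> 'n))) z))\<^sup>2)"
  have "cdot z (M *v z) = of_real (lam3 d p * (norm z)\<^sup>2 + (lam2 d p / lam4 d p) * k)"
    unfolding M_def mtensor_X_op d_eq[symmetric] pi_C_def mtensor_mat1_pi[OF norm_psi_tau] k_def
    by (simp add: matrix_vector_mult_add_rdistrib cdot_add_right matrix_vector_scaleR_left cdot_scaleR_right cdot_self K.cdot_proj del: of_real_sum)
  ultimately have form: "noise_form T = lam1 d p * weight T + (lam3 d p * (norm z)\<^sup>2 + (lam2 d p / lam4 d p) * k)"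
    unfolding noise_form_def y_def by simp
  have k: "0 \<le> k" "k \<le> (norm z)\<^sup>2"
    unfolding k_def by (auto intro: sum_nonneg K.bessel)
  note l = lam_bounds
  have "0 \<le> lam3 d p * (norm z)\<^sup>2 + (lam2 d p / lam4 d p) * k"
    using l k by (intro add_nonneg_nonneg mult_nonneg_nonneg) auto
  then show "lam1 d p * weight T \<le> noise_form T" unfolding form by simp
  have "(lam2 d p / lam4 d p) * k \<le> (lam2 d p / lam4 d p) * (norm z)\<^sup>2"
    using l k by (intro mult_left_mono) auto
  then show "noise_form T \<le> lam1 d p * weight T + xi d p * ((norm T)\<^sup>2 - weight T)"
    unfolding form z2[symmetric] xi_def by (simp add: distrib_right)
qed

text \<open>By cyclicity of the trace, tr (D (adj K) C) is the Frobenius product of K with C D.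
  Summing over the Kraus operators of the noise yields its Choi form at each product C D.\<close>

lemma fidelity_eq:
  assumes "kraus_ops \<C> Cs" "kraus_ops \<D> Ds"
  shows "ent_fidelity (tau :: complex ^ 'n ^ 'n) (\<D> \<circ> noise p \<circ> \<C>) = (1 / d\<^sup>2) * (\<Sum>D\<leftarrow>Ds. \<Sum>C\<leftarrow>Cs. noise_form (C ** D))"
proof -
  obtain Ks where Ks: "kraus_ops (noise p :: ('n \<times> 'n, 'n \<times> 'n) supermap) (map adj Ks)"
    "(noise_choi p :: complex ^ (('n \<times> 'n) \<times> ('n \<times> 'n)) ^ (('n \<times> 'n) \<times> ('n \<times> 'n))) = (\<Sum>K\<leftarrow>Ks. outer (vectorize K) (vectorize K))"
    by (rule noise_kraus)
  have form: "noise_form T = (\<Sum>K\<leftarrow>Ks. (cmod (hs K T))\<^sup>2)" for T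
  proof -
    have "cdot (vectorize T) (noise_choi p *v vectorize T) = of_real (\<Sum>K\<leftarrow>Ks. (cmod (hs T K))\<^sup>2)"
      using cdot_outer_sum_list[of "vectorize T" "map vectorize Ks"] by (simp add: Ks(2) o_def cdot_vectorize)
    moreover have "cmod (hs T K) = cmod (hs K T)" for K by (metis cnj_hs complex_mod_cnj)
    ultimately show ?thesis unfolding noise_form_def by simp
  qed
  have tr: "(cmod (trace (tau ** (D ** adj K ** C))))\<^sup>2 = (1 / d\<^sup>2) * (cmod (hs K (C ** D)))\<^sup>2"
    for C :: "complex ^ 'n ^ ('n \<times> 'n)" and D :: "complex ^ ('n \<times> 'n) ^ 'n" and K
  proof -
    have "trace (tau ** (D ** adj K ** C)) = of_real (1 / d) * trace (D ** (adj K ** C))"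
      by (simp add: tau_def d_eq matrix_mult_scaleR_left matrix_mul_assoc trace_def sum_distrib_left scaleR_conv_of_real[where 'a = complex])
    also have "trace (D ** (adj K ** C)) = trace ((adj K ** C) ** D)"
      unfolding trace_def matrix_matrix_mult_def[of D] matrix_matrix_mult_def[of "adj K ** C"]
      by (simp add: mult.commute) (rule sum.swap)
    also have "\<dots> = hs K (C ** D)" by (simp add: hs_trace matrix_mul_assoc)
    finally show ?thesis by (simp add: norm_mult power_mult_distrib power_divide norm_divide)
  qed
  have "kraus_ops (\<D> \<circ> noise p \<circ> \<C>) [(M ** C). M \<leftarrow> [D ** L. D \<leftarrow> Ds, L \<leftarrow> map adj Ks], C \<leftarrow> Cs]"
    by (intro kraus_ops_comp assms Ks(1))
  then have "ent_fidelity tau (\<D> \<circ> noise p \<circ> \<C>) = (\<Sum>F\<leftarrow>[(M ** C). M \<leftarrow> [D ** L. D \<leftarrow> Ds, L \<leftarrow> map adj Ks], C \<leftarrow> Cs]. (cmod (trace (tau ** F)))\<^sup>2)"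
    by (rule ent_fidelity_kraus)
  also have "\<dots> = (\<Sum>D\<leftarrow>Ds. \<Sum>K\<leftarrow>Ks. \<Sum>C\<leftarrow>Cs. (cmod (trace (tau ** (D ** adj K ** C))))\<^sup>2)"
    by (simp add: sum_list_concat_map o_def)
  also have "\<dots> = (\<Sum>D\<leftarrow>Ds. \<Sum>K\<leftarrow>Ks. \<Sum>C\<leftarrow>Cs. (1 / d\<^sup>2) * (cmod (hs K (C ** D)))\<^sup>2)"
    unfolding tr ..
  also have "\<dots> = (1 / d\<^sup>2) * (\<Sum>D\<leftarrow>Ds. \<Sum>C\<leftarrow>Cs. noise_form (C ** D))"
  proof -
    have "(\<Sum>D\<leftarrow>Ds. \<Sum>K\<leftarrow>Ks. \<Sum>C\<leftarrow>Cs. (cmod (hs K (C ** D)))\<^sup>2) = (\<Sum>D\<leftarrow>Ds. \<Sum>C\<leftarrow>Cs. noise_form (C ** D))"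
      unfolding form by (rule arg_cong[where f = sum_list], rule map_cong[OF refl], rule sum_list_swap)
    then show ?thesis
      by (simp only: sum_list_const_mult[of "1 / d\<^sup>2"])
  qed
  finally show ?thesis .
qed

end

section \<open>Bounds on the optimal fidelities\<close>

lemma contractive_list_mult:
  fixes Ls :: "(complex ^ 'a ^ 'b) list" and X :: "complex ^ 'c ^ 'a"
  assumes "\<And>y. (\<Sum>L\<leftarrow>Ls. (norm (L *v y))\<^sup>2) \<le> (norm y)\<^sup>2"
  shows "(\<Sum>L\<leftarrow>Ls. (norm (L ** X))\<^sup>2) \<le> (norm X)\<^sup>2"
  using contractive_family_mult[of "\<lambda>i. Ls ! i" "{0..<length Ls}" X] assms
  by (simp add: sum_list_sum_nth)

lemma contractive_list_norm:
  fixes Ls :: "(complex ^ 'a ^ 'b) list"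
  assumes "\<And>y. (\<Sum>L\<leftarrow>Ls. (norm (L *v y))\<^sup>2) \<le> (norm y)\<^sup>2"
  shows "(\<Sum>L\<leftarrow>Ls. (norm L)\<^sup>2) \<le> real CARD('a)"
  using contractive_list_mult[OF assms, of "mat 1"] by (simp add: norm_mat1)

lemma col_block_mult: "col_block (W ** D) j = W ** col_block D j"
  by (simp add: col_block_def matrix_matrix_mult_def vec_eq_iff)

text \<open>Block \<open>j\<close> of D applied to y is D applied to y \<otimes> |j>, which has the
  norm of y.\<close>

lemma norm_col_block_vec_le:
  fixes Ds :: "(complex ^ ('a::finite \<times> 'b::finite) ^ 'c) list"
  assumes "\<And>y. (\<Sum>D\<leftarrow>Ds. (norm (D *v y))\<^sup>2) \<le> (norm y)\<^sup>2"
  shows "(\<Sum>D\<leftarrow>Ds. (norm (col_block D j *v y))\<^sup>2) \<le> (norm y)\<^sup>2"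
proof -
  have "col_block D j *v y = D *v vtensor y (ket j)" for D :: "complex ^ ('a \<times> 'b) ^ 'c"
  proof -
    have "(D *v vtensor y (ket j)) $ i = (\<Sum>k\<in>UNIV. \<Sum>t\<in>UNIV. if t = j then D $ i $ (k, t) * y $ k else 0)" for i
      unfolding matrix_vector_mult_def vec_lambda_beta sum_prod_UNIV vtensor_def
      by (intro sum.cong refl) (auto simp: ket_nth)
    then show ?thesis by (simp add: vec_eq_iff matrix_vector_mult_def col_block_def)
  qed
  moreover have "(norm (vtensor y (ket j)))\<^sup>2 = (norm y)\<^sup>2"
  proof -
    have "(norm (vtensor y (ket j)))\<^sup>2 = (\<Sum>k\<in>UNIV. \<Sum>t\<in>UNIV. if t = j then (cmod (y $ k))\<^sup>2 else 0)"
      unfolding norm_vec_sq sum_prod_UNIV vtensor_def by (intro sum.cong refl) (auto simp: ket_nth)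
    then show ?thesis by (simp add: norm_vec_sq)
  qed
  ultimately show ?thesis using assms[of "vtensor y (ket j)"] by simp
qed

lemma norm_encoder_ket_vec:
  fixes y :: "complex ^ 'n"
  shows "(norm (encoder a b (ket i) *v y))\<^sup>2 = a\<^sup>2 * (norm y)\<^sup>2 + (2 * a * b + real CARD('n) * b\<^sup>2) * (cmod (y $ i))\<^sup>2"
proof -
  have sq: "(cmod (of_real a * x + of_real b * x))\<^sup>2 = (a\<^sup>2 + 2 * a * b + b\<^sup>2) * (cmod x)\<^sup>2" for x
    unfolding distrib_right[symmetric] of_real_add[symmetric] norm_mult norm_of_real power_mult_distrib power2_abs
    by (simp add: power2_sum)
  have iy: "(\<Sum>k\<in>UNIV. ket i $ k * y $ k) = y $ i"
    by (simp add: ket_nth if_distrib[of "\<lambda>x. x * _"] cong: if_cong)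
  have "(norm (encoder a b (ket i) *v y))\<^sup>2 = (\<Sum>l\<in>UNIV. \<Sum>s\<in>UNIV. (if s = i then a\<^sup>2 * (cmod (y $ l))\<^sup>2 else 0)
     + (if l = s then (if s = i then 2 * a * b * (cmod (y $ i))\<^sup>2 else 0) + b\<^sup>2 * (cmod (y $ i))\<^sup>2 else 0))"
    unfolding norm_vec_sq sum_prod_UNIV encoder_vec iy
    by (intro sum.cong refl) (auto simp: ket_nth sq norm_mult power_mult_distrib algebra_simps)
  also have "\<dots> = a\<^sup>2 * (norm y)\<^sup>2 + (2 * a * b * (cmod (y $ i))\<^sup>2 + real CARD('n) * (b\<^sup>2 * (cmod (y $ i))\<^sup>2))"
    unfolding sum.distrib by (simp add: norm_vec_sq sum_distrib_left sum.distrib)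
  finally show ?thesis by (simp add: algebra_simps)
qed

text \<open>The operator I \<otimes> <j|; over all \<open>j\<close> these are Kraus operators of the
  partial trace over the second factor.\<close>

definition traceout :: "'n \<Rightarrow> complex ^ ('n::finite \<times> 'n) ^ 'n" where
  "traceout j = (\<chi> k r. if r = (k, j) then 1 else 0)"

lemma traceout_vec: "(traceout j *v y) $ k = y $ (k, j)"
  by (simp add: traceout_def matrix_vector_mult_def if_distrib[of "\<lambda>x. x * _"] cong: if_cong)

lemma col_block_traceout: "col_block (traceout j) j' = (if j' = j then mat 1 else 0)"
  by (auto simp: col_block_def traceout_def vec_eq_iff mat_def)

lemma sum_norm_traceout: "(\<Sum>j\<in>UNIV. (norm (traceout j *v y))\<^sup>2) = (norm y)\<^sup>2"
  unfolding norm_vec_sq traceout_vec sum_prod_UNIV by (rule sum.swap)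

lemma cptniI:
  fixes Ls :: "(complex ^ 'a ^ 'b) list"
  assumes "\<And>y. (\<Sum>L\<leftarrow>Ls. (norm (L *v y))\<^sup>2) \<le> (norm y)\<^sup>2"
  obtains \<Phi> where "cptni \<Phi>" "kraus_ops \<Phi> Ls" "choi_rank \<Phi> \<le> length Ls"
proof
  let ?\<Phi> = "\<lambda>X. \<Sum>L\<leftarrow>Ls. L ** X ** adj L"
  show "kraus_ops ?\<Phi> Ls" by (simp add: kraus_ops_def)
  then show "cptni ?\<Phi>" using assms by (auto simp: cptni_iff)
  show "choi_rank ?\<Phi> \<le> length Ls"
    unfolding choi_rank_def by (rule Least_le) (use \<open>kraus_ops ?\<Phi> Ls\<close> in blast)
qed

lemma cptni_traceout:
  fixes xs :: "'n::finite list"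
  assumes xs: "distinct xs" "set xs = UNIV"
  obtains \<D> :: "('n \<times> 'n, 'n) supermap" where "cptni \<D>" "kraus_ops \<D> (map traceout xs)"
proof -
  have "(\<Sum>L\<leftarrow>map traceout xs. (norm (L *v y))\<^sup>2) \<le> (norm y)\<^sup>2" for y :: "complex ^ ('n \<times> 'n)"
    using sum_norm_traceout[of y] xs sum.distinct_set_conv_list[of xs "\<lambda>j. (norm (traceout j *v y))\<^sup>2"]
    by (simp add: o_def)
  then show thesis using cptniI that by blast
qed

section \<open>Optimal fidelity with arbitrary encoders\<close>

context noise_channel
begin

lemma coords_encoder_amp: "coords (amp d p) (amp_diag d p) (encoder (amp d p) (amp_diag d p) w) = w" for w :: "complex ^ 'n"
  by (rule coords_encoder) (use normalized in \<open>simp add: d_eq\<close>)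

lemma norm_encoder_amp_ket_vec:
  "(norm (encoder (amp d p) (amp_diag d p) (ket i) *v y))\<^sup>2
    = (amp d p)\<^sup>2 * (norm y)\<^sup>2 + (2 * amp d p * amp_diag d p + d * (amp_diag d p)\<^sup>2) * (cmod (y $ i))\<^sup>2"
  for y :: "complex ^ 'n"
  unfolding norm_encoder_ket_vec d_eq ..

lemma lam4_ratio_pos: "0 < lam4 d p / (d\<^sup>2 - 1)"
  unfolding lam4_def using d_sq_ge[OF d_ge] p d_ge by (intro divide_pos_pos) auto

lemma low_pos: "0 < amp_low d p"
proof -
  have "0 \<le> lam5 d p" using p by (simp add: lam5_def)
  moreover have "0 < (d - 1) * (lam4 d p / (d\<^sup>2 - 1))" using lam4_ratio_pos d_ge by (intro mult_pos_pos) auto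
  ultimately show ?thesis unfolding amp_low_def by (intro real_sqrt_gt_zero add_pos_nonneg)
qed

lemma low_sq: "(amp_low d p)\<^sup>2 = (amp d p)\<^sup>2 + (2 * amp d p * amp_diag d p + d * (amp_diag d p)\<^sup>2)"
  using v_sq by simp

text \<open>The form is at most lam1 times the squared norm. Contractivity of the encoder reduces
  the norms of C D to those of D, and the latter sum to at most d^2, the dimension on which the
  decoder acts.\<close>

lemma fidelity_le:
  fixes \<C> :: "('n, 'n \<times> 'n) supermap" and \<D> :: "('n \<times> 'n, 'n) supermap"
  assumes "cptni \<C>" "cptni \<D>"
  shows "ent_fidelity tau (\<D> \<circ> noise p \<circ> \<C>) \<le> lam1 d p"
proof -
  obtain Cs Ds where Cs: "kraus_ops \<C> Cs" and Ds: "kraus_ops \<D> Ds"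
    using assms by (auto simp: cptni_iff)
  note l = lam_bounds
  have "noise_form (C ** D) \<le> lam1 d p * (norm (C ** D))\<^sup>2" for C :: "complex ^ 'n ^ ('n \<times> 'n)" and D
  proof -
    have "noise_form (C ** D) \<le> lam1 d p * weight (C ** D) + xi d p * ((norm (C ** D))\<^sup>2 - weight (C ** D))"
      by (rule form_bounds)
    also have "\<dots> \<le> lam1 d p * weight (C ** D) + lam1 d p * ((norm (C ** D))\<^sup>2 - weight (C ** D))"
      using weight_le[of "C ** D"] l by (intro add_left_mono mult_right_mono) auto
    finally show ?thesis by (simp add: algebra_simps)
  qed
  then have "(\<Sum>D\<leftarrow>Ds. \<Sum>C\<leftarrow>Cs. noise_form (C ** D)) \<le> (\<Sum>D\<leftarrow>Ds. lam1 d p * (\<Sum>C\<leftarrow>Cs. (norm (C ** D))\<^sup>2))"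
    unfolding sum_list_const_mult[symmetric] by (intro sum_list_mono)
  also have "\<dots> \<le> (\<Sum>D\<leftarrow>Ds. lam1 d p * (norm D)\<^sup>2)"
    using l by (intro sum_list_mono mult_left_mono contractive_list_mult cptni_contractive[OF assms(1) Cs])
  also have "\<dots> \<le> lam1 d p * d\<^sup>2"
    using contractive_list_norm[OF cptni_contractive[OF assms(2) Ds]] l
    by (simp add: sum_list_const_mult mult_left_mono power2_eq_square d_eq)
  finally show ?thesis
    unfolding fidelity_eq[OF Cs Ds] using d_ge by (simp add: divide_le_eq)
qed

text \<open>The encoder has the d Kraus operators B_i and the decoder is the partial trace. Their
  products are exactly the B_ij, each of weight 1.\<close>

lemma fidelity_attained:
  shows "\<exists>(\<C> :: ('n, 'n \<times> 'n) supermap) \<D>. cptni \<C> \<and> cptni \<D> \<and> lam1 d p \<le> ent_fidelity tau (\<D> \<circ> noise p \<circ> \<C>)"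
proof -
  obtain xs :: "'n list" where xs: "distinct xs" "set xs = UNIV" using finite_distinct_list[of "UNIV :: 'n set"] by auto
  define B :: "'n \<Rightarrow> complex ^ 'n ^ ('n \<times> 'n)" where "B = (\<lambda>i. encoder (amp d p) (amp_diag d p) (ket i))"
  note sums = sum.distinct_set_conv_list[OF xs(1), symmetric, unfolded xs(2)]
  have "(\<Sum>i\<in>UNIV. (norm (B i *v y))\<^sup>2) = (norm y)\<^sup>2" for y
  proof -
    have "(\<Sum>i\<in>UNIV. (norm (B i *v y))\<^sup>2) = (d * (amp d p)\<^sup>2 + 2 * amp d p * amp_diag d p + d * (amp_diag d p)\<^sup>2) * (norm y)\<^sup>2"
      unfolding B_def norm_encoder_amp_ket_vec sum.distrib sum_distrib_left[symmetric] norm_vec_sq[of y, symmetric]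
      by (simp add: d_eq algebra_simps)
    then show ?thesis by (simp only: normalized)
  qed
  then have "(\<Sum>L\<leftarrow>map B xs. (norm (L *v y))\<^sup>2) \<le> (norm y)\<^sup>2" for y
    by (simp add: o_def sums)
  then obtain \<C> where C: "cptni \<C>" "kraus_ops \<C> (map B xs)" by (rule cptniI)
  obtain \<D> :: "('n \<times> 'n, 'n) supermap" where D: "cptni \<D>" "kraus_ops \<D> (map traceout xs)"
    by (rule cptni_traceout[OF xs])
  have "weight (B i ** traceout j) = 1" for i j
  proof -
    have "coords (amp d p) (amp_diag d p) (col_block (B i ** traceout j) j') = (if j' = j then ket i else 0)" for j'
      unfolding col_block_mult col_block_traceout by (simp add: B_def coords_encoder_amp coords_zero)
    then show ?thesis unfolding weight_def
      by (simp add: if_distrib[of norm] if_distrib[of "\<lambda>x. x\<^sup>2"] cong: if_cong)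
  qed
  then have "lam1 d p \<le> noise_form (B i ** traceout j)" for i j
    using form_bounds(1)[of "B i ** traceout j"] by simp
  then have "(\<Sum>j\<in>(UNIV :: 'n set). \<Sum>i\<in>(UNIV :: 'n set). lam1 d p) \<le> (\<Sum>j\<in>UNIV. \<Sum>i\<in>UNIV. noise_form (B i ** traceout j))"
    by (intro sum_mono)
  then have "lam1 d p \<le> ent_fidelity tau (\<D> \<circ> noise p \<circ> \<C>)"
    unfolding fidelity_eq[OF C(2) D(2)] using d_ge
    by (simp add: o_def sums d_eq field_simps power2_eq_square)
  then show ?thesis using C D by blast
qed

lemma F_opt_eq: "F_opt (tau :: complex ^ 'n ^ 'n) (noise p :: ('n \<times> 'n, 'n \<times> 'n) supermap) = lam1 d p"
  unfolding F_opt_def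
proof (rule cSup_eq_maximum)
  obtain \<C> :: "('n, 'n \<times> 'n) supermap" and \<D> where CD: "cptni \<C>" "cptni \<D>" "lam1 d p \<le> ent_fidelity tau (\<D> \<circ> noise p \<circ> \<C>)"
    using fidelity_attained by blast
  then have "lam1 d p = ent_fidelity tau (\<D> \<circ> noise p \<circ> \<C>)"
    using fidelity_le by (metis order_antisym)
  then show "lam1 d p \<in> {ent_fidelity tau (\<D> \<circ> noise p \<circ> \<C>) |(\<C> :: ('n, 'n \<times> 'n) supermap) \<D>. cptni \<C> \<and> cptni \<D>}"
    using CD by blast
qed (use fidelity_le in blast)

text \<open>The weight that \<open>recovery_bound\<close> shows to be lost in each column block when
  the encoder has one Kraus operator.\<close>

definition defect :: real where
  "defect = (d - 1) * gap\<^sup>2 - 14 * d * gap\<^sup>2 * sqrt gap"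

text \<open>For fixed \<open>j\<close> the column blocks of the decoder form a contractive family on
  the logical space, so \<open>recovery_bound\<close> applies to each of the d blocks. Lost weight
  is still counted with \<open>xi\<close>, so each unit of it costs lam1 - xi.\<close>

lemma fidelity1_le:
  fixes \<C> :: "('n, 'n \<times> 'n) supermap" and \<D> :: "('n \<times> 'n, 'n) supermap"
  assumes "cptni \<C>" "cptni \<D>" "choi_rank \<C> \<le> 1"
  shows "ent_fidelity tau (\<D> \<circ> noise p \<circ> \<C>) \<le> lam1 d p - (lam1 d p - xi d p) * (defect / d)"
proof -
  obtain W where W: "kraus_ops \<C> [W]"
    using assms(1,3)
  proof (rule choi_rank_le_1)
    assume "kraus_ops \<C> []"
    \<comment> \<open>The zero map, with its empty Kraus list, is also given by one zero operator,
      so a single \<open>W\<close> is always available.\<close>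
    then have "kraus_ops \<C> [0]" by (simp add: kraus_ops_def)
    then show thesis by (rule that)
  qed (rule that)
  have Wc: "norm (W *v y) \<le> norm y" for y
    using cptni_contractive[OF assms(1) W, of y] by (auto intro: power2_le_imp_le)
  obtain Ds where Ds: "kraus_ops \<D> Ds" using assms by (auto simp: cptni_iff)
  have Dc: "(\<Sum>D\<leftarrow>Ds. (norm (D *v y))\<^sup>2) \<le> (norm y)\<^sup>2" for y
    by (rule cptni_contractive[OF assms(2) Ds])
  have WD: "(\<Sum>D\<leftarrow>Ds. (norm ((W ** D) *v y))\<^sup>2) \<le> (norm y)\<^sup>2" for y
  proof -
    have "(\<Sum>D\<leftarrow>Ds. (norm ((W ** D) *v y))\<^sup>2) \<le> (\<Sum>D\<leftarrow>Ds. (norm (D *v y))\<^sup>2)"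
      by (intro sum_list_mono power_mono) (auto simp: matrix_vector_mul_assoc[symmetric] Wc)
    then show ?thesis using Dc[of y] by simp
  qed
  have N: "(\<Sum>D\<leftarrow>Ds. (norm (W ** D))\<^sup>2) \<le> d\<^sup>2"
    using contractive_list_norm[of "map ((**) W) Ds"] WD by (simp add: o_def power2_eq_square d_eq)
  define w where "w = (\<Sum>D\<leftarrow>Ds. weight (W ** D))"
  have "w = (\<Sum>j\<in>UNIV. \<Sum>i\<in>{0..<length Ds}. (norm (coords (amp d p) (amp_diag d p) (W ** col_block (Ds ! i) j)))\<^sup>2)"
    unfolding w_def weight_def col_block_mult sum_list_sum_nth
    by (subst sum.swap) simp
  also have "\<dots> \<le> (\<Sum>j\<in>(UNIV :: 'n set). d - defect)"
    unfolding defect_def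
  proof (intro sum_mono recovery_bound)
    fix j y
    show "(\<Sum>i\<in>{0..<length Ds}. (norm (col_block (Ds ! i) j *v y))\<^sup>2) \<le> (norm y)\<^sup>2"
      using norm_col_block_vec_le[of Ds, OF Dc, of j y] by (simp add: sum_list_sum_nth)
  qed (simp_all add: Wc d_eq)
  finally have w: "w \<le> d * (d - defect)" by (simp add: d_eq)
  note l = lam_bounds
  have "(\<Sum>D\<leftarrow>Ds. \<Sum>C\<leftarrow>[W]. noise_form (C ** D)) \<le> (\<Sum>D\<leftarrow>Ds. lam1 d p * weight (W ** D) + xi d p * ((norm (W ** D))\<^sup>2 - weight (W ** D)))"
    using form_bounds(2) by (intro sum_list_mono) simp
  also have "\<dots> = lam1 d p * w + xi d p * ((\<Sum>D\<leftarrow>Ds. (norm (W ** D))\<^sup>2) - w)"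
    unfolding w_def by (induction Ds) (simp_all add: algebra_simps)
  also have "\<dots> \<le> lam1 d p * w + xi d p * (d\<^sup>2 - w)"
    using N l by (intro add_left_mono mult_left_mono) (auto simp: xi_def)
  also have "\<dots> = (lam1 d p - xi d p) * w + xi d p * d\<^sup>2" by (simp add: algebra_simps)
  also have "\<dots> \<le> (lam1 d p - xi d p) * (d * (d - defect)) + xi d p * d\<^sup>2"
    using w l by (intro add_right_mono mult_left_mono) auto
  also have "\<dots> = d\<^sup>2 * (lam1 d p - (lam1 d p - xi d p) * (defect / d))"
    using d_ge by (simp add: field_simps power2_eq_square)
  finally have "(1 / d\<^sup>2) * (\<Sum>D\<leftarrow>Ds. \<Sum>C\<leftarrow>[W]. noise_form (C ** D))
      \<le> (1 / d\<^sup>2) * (d\<^sup>2 * (lam1 d p - (lam1 d p - xi d p) * (defect / d)))"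
    by (rule mult_left_mono) simp
  then show ?thesis
    unfolding fidelity_eq[OF W Ds] using d_ge by simp
qed

text \<open>With the partial trace as decoder, each of the d products W (I \<otimes> <j|) has weight
  at least (tr |B|)^2, already from the one direction |i>. Dividing the total by d^2 gives the
  bound.\<close>

lemma fidelity1_attained:
  shows "\<exists>(\<C> :: ('n, 'n \<times> 'n) supermap) \<D>. cptni \<C> \<and> cptni \<D> \<and> choi_rank \<C> \<le> 1
     \<and> lam1 d p * (trace_norm\<^sup>2 / d) \<le> ent_fidelity tau (\<D> \<circ> noise p \<circ> \<C>)"
proof -
  obtain xs :: "'n list" where xs: "distinct xs" "set xs = UNIV" using finite_distinct_list[of "UNIV :: 'n set"] by auto
  note sums = sum.distinct_set_conv_list[OF xs(1), symmetric, unfolded xs(2)]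
  \<comment> \<open>Any basis direction serves; for a basis vector (adj B) B is diagonal, so |B| is
    the diagonal matrix with entries \<open>c k\<close>.\<close>
  obtain i :: 'n where True by simp
  define B where "B = encoder (amp d p) (amp_diag d p) (ket i)"
  define c where "c = (\<lambda>k. if k = i then amp_low d p else amp d p)"
  have c0: "0 < c k" for k using a_pos low_pos by (simp add: c_def)
  text \<open>The isometry in the polar decomposition of \<open>B\<close>, whose singular values are \<open>c k\<close>.\<close>
  define W where "W = (\<chi> r k. of_real (1 / c k) * B $ r $ k)"
  have B2: "(norm (B *v y))\<^sup>2 = (\<Sum>k\<in>UNIV. (c k)\<^sup>2 * (cmod (y $ k))\<^sup>2)" for y
  proof -
    have "(\<Sum>k\<in>UNIV. (c k)\<^sup>2 * (cmod (y $ k))\<^sup>2) = (\<Sum>k\<in>UNIV. (amp d p)\<^sup>2 * (cmod (y $ k))\<^sup>2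
        + (if k = i then (2 * amp d p * amp_diag d p + d * (amp_diag d p)\<^sup>2) * (cmod (y $ k))\<^sup>2 else 0))"
      by (intro sum.cong refl) (auto simp: c_def low_sq distrib_right)
    also have "\<dots> = (norm (B *v y))\<^sup>2"
      unfolding B_def norm_encoder_amp_ket_vec sum.distrib by (simp add: norm_vec_sq sum_distrib_left)
    finally show ?thesis by simp
  qed
  have "(norm (W *v y))\<^sup>2 = (norm y)\<^sup>2" for y
  proof -
    have "W *v y = B *v (\<chi> k. of_real (1 / c k) * y $ k)"
      by (simp add: W_def matrix_vector_mult_def vec_eq_iff mult_ac)
    then have "(norm (W *v y))\<^sup>2 = (\<Sum>k\<in>UNIV. (c k)\<^sup>2 * (cmod (of_real (1 / c k) * y $ k))\<^sup>2)"
      by (simp add: B2)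
    also have "\<dots> = (norm y)\<^sup>2"
      unfolding norm_vec_sq
    proof (intro sum.cong refl)
      fix k
      show "(c k)\<^sup>2 * (cmod (of_real (1 / c k) * y $ k))\<^sup>2 = (cmod (y $ k))\<^sup>2"
        using c0[of k] by (simp add: norm_mult norm_divide power_divide)
    qed
    finally show ?thesis .
  qed
  then have "(\<Sum>L\<leftarrow>[W]. (norm (L *v y))\<^sup>2) \<le> (norm y)\<^sup>2" for y by simp
  then obtain \<C> where C: "cptni \<C>" "kraus_ops \<C> [W]" "choi_rank \<C> \<le> length [W]" by (rule cptniI)
  obtain \<D> :: "('n \<times> 'n, 'n) supermap" where D: "cptni \<D>" "kraus_ops \<D> (map traceout xs)"
    by (rule cptni_traceout[OF xs])
  \<comment> \<open>Since B = W |B| with W isometric, the product <B, W> is tr |B|.\<close>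
  have "hs B W = of_real trace_norm"
  proof -
    have "hs B W = (\<Sum>k\<in>UNIV. of_real (1 / c k) * (\<Sum>r\<in>UNIV. cnj (B $ r $ k) * B $ r $ k))"
      unfolding hs_def cdot_def by (subst sum.swap) (simp add: W_def sum_distrib_left mult_ac)
    also have "\<dots> = (\<Sum>k\<in>UNIV. of_real (1 / c k) * of_real ((norm (B *v ket k))\<^sup>2))"
      unfolding cdot_self[symmetric] cdot_def matrix_ket_nth ..
    also have "\<dots> = (\<Sum>k\<in>UNIV. of_real (c k))"
    proof (intro sum.cong refl)
      fix k
      have "(norm (B *v ket k))\<^sup>2 = (c k)\<^sup>2"
        by (simp add: B2 ket_nth if_distrib[of cmod] if_distrib[of "\<lambda>x. x\<^sup>2"] if_distrib[of "\<lambda>x. _ * x"] cong: if_cong)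
      then show "complex_of_real (1 / c k) * of_real ((norm (B *v ket k))\<^sup>2) = of_real (c k)"
        using c0[of k] by (simp add: power2_eq_square)
    qed
    also have "\<dots> = of_real (\<Sum>k\<in>UNIV. amp d p + (if k = i then amp_low d p - amp d p else 0))"
      unfolding of_real_sum by (intro sum.cong refl) (simp add: c_def)
    also have "(\<Sum>k\<in>UNIV. amp d p + (if k = i then amp_low d p - amp d p else 0)) = trace_norm"
      by (simp add: sum.distrib trace_norm_def d_eq[symmetric] left_diff_distrib)
    finally show ?thesis .
  qed
  then have "cdot (ket i) (coords (amp d p) (amp_diag d p) W) = of_real trace_norm" by (simp add: B_def hs_encoder)
  then have "trace_norm \<le> norm (coords (amp d p) (amp_diag d p) W)"
    using cmod_cdot_le[of "ket i" "coords (amp d p) (amp_diag d p) W"] by simp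
  then have zW: "trace_norm\<^sup>2 \<le> (norm (coords (amp d p) (amp_diag d p) W))\<^sup>2"
    using trace_norm_nonneg by (intro power_mono)
  have "weight (W ** traceout j) = (norm (coords (amp d p) (amp_diag d p) W))\<^sup>2" for j
  proof -
    have "coords (amp d p) (amp_diag d p) (col_block (W ** traceout j) j') = (if j' = j then coords (amp d p) (amp_diag d p) W else 0)" for j'
      unfolding col_block_mult col_block_traceout by (simp add: coords_zero)
    then show ?thesis unfolding weight_def
      by (simp add: if_distrib[of norm] if_distrib[of "\<lambda>x. x\<^sup>2"] cong: if_cong)
  qed
  then have "lam1 d p * trace_norm\<^sup>2 \<le> noise_form (W ** traceout j)" for j
    using form_bounds(1)[of "W ** traceout j"] zW lam_bounds
    by (smt (verit) mult_left_mono)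
  then have "(\<Sum>j\<in>(UNIV :: 'n set). lam1 d p * trace_norm\<^sup>2) \<le> (\<Sum>j\<in>UNIV. noise_form (W ** traceout j))"
    by (intro sum_mono)
  then have "lam1 d p * (trace_norm\<^sup>2 / d) \<le> ent_fidelity tau (\<D> \<circ> noise p \<circ> \<C>)"
    unfolding fidelity_eq[OF C(2) D(2)] using d_ge
    by (simp add: o_def sums d_eq field_simps power2_eq_square)
  then show ?thesis using C D by auto
qed

lemma F1_opt_bounds:
  shows "F1_opt (tau :: complex ^ 'n ^ 'n) (noise p :: ('n \<times> 'n, 'n \<times> 'n) supermap) \<le> lam1 d p - (lam1 d p - xi d p) * (defect / d)"
    and "lam1 d p * (trace_norm\<^sup>2 / d) \<le> F1_opt (tau :: complex ^ 'n ^ 'n) (noise p :: ('n \<times> 'n, 'n \<times> 'n) supermap)"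
proof -
  define S where "S = {ent_fidelity tau (\<D> \<circ> noise p \<circ> \<C>) |(\<C> :: ('n, 'n \<times> 'n) supermap) \<D>. cptni \<C> \<and> cptni \<D> \<and> choi_rank \<C> \<le> 1}"
  have F1: "F1_opt (tau :: complex ^ 'n ^ 'n) (noise p :: ('n \<times> 'n, 'n \<times> 'n) supermap) = Sup S"
    unfolding F1_opt_def S_def ..
  obtain \<C> :: "('n, 'n \<times> 'n) supermap" and \<D> where CD: "cptni \<C>" "cptni \<D>" "choi_rank \<C> \<le> 1"
    and F: "lam1 d p * (trace_norm\<^sup>2 / d) \<le> ent_fidelity tau (\<D> \<circ> noise p \<circ> \<C>)"
    using fidelity1_attained by blast
  then have mem: "ent_fidelity tau (\<D> \<circ> noise p \<circ> \<C>) \<in> S" unfolding S_def by blast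
  have ub: "x \<le> lam1 d p - (lam1 d p - xi d p) * (defect / d)" if "x \<in> S" for x
    using that fidelity1_le unfolding S_def by blast
  have "S \<noteq> {}" using mem by auto
  then show "F1_opt (tau :: complex ^ 'n ^ 'n) (noise p :: ('n \<times> 'n, 'n \<times> 'n) supermap) \<le> lam1 d p - (lam1 d p - xi d p) * (defect / d)"
    unfolding F1 using ub by (rule cSup_least)
  have "bdd_above S" using ub by (rule bdd_aboveI)
  then have "ent_fidelity tau (\<D> \<circ> noise p \<circ> \<C>) \<le> Sup S" by (rule cSup_upper[OF mem])
  then show "lam1 d p * (trace_norm\<^sup>2 / d) \<le> F1_opt (tau :: complex ^ 'n ^ 'n) (noise p :: ('n \<times> 'n, 'n \<times> 'n) supermap)"
    unfolding F1 using F by linarith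
qed

lemma Delta_opt_bounds:
  defines "\<delta> \<equiv> amp d p - amp_low d p"
  shows "(lam1 d p - xi d p) * (((d - 1) * \<delta>\<^sup>2 - 14 * d * \<delta>\<^sup>2 * sqrt \<delta>) / d)
      \<le> Delta_opt (tau :: complex ^ 'n ^ 'n) (noise p :: ('n \<times> 'n, 'n \<times> 'n) supermap)"
    and "Delta_opt (tau :: complex ^ 'n ^ 'n) (noise p :: ('n \<times> 'n, 'n \<times> 'n) supermap) \<le> lam1 d p * ((d - 1) * \<delta>\<^sup>2 / d)"
proof -
  have gap_eq: "gap = \<delta>" by (simp add: gap_def \<delta>_def)
  show "(lam1 d p - xi d p) * (((d - 1) * \<delta>\<^sup>2 - 14 * d * \<delta>\<^sup>2 * sqrt \<delta>) / d)
      \<le> Delta_opt (tau :: complex ^ 'n ^ 'n) (noise p :: ('n \<times> 'n, 'n \<times> 'n) supermap)"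
    using F1_opt_bounds(1) unfolding Delta_opt_def F_opt_eq defect_def gap_eq by linarith
  have "trace_norm\<^sup>2 / d = 1 - (d - 1) * \<delta>\<^sup>2 / d"
    using trace_norm_sq d_ge unfolding gap_eq by (simp add: field_simps)
  then show "Delta_opt (tau :: complex ^ 'n ^ 'n) (noise p :: ('n \<times> 'n, 'n \<times> 'n) supermap) \<le> lam1 d p * ((d - 1) * \<delta>\<^sup>2 / d)"
    using F1_opt_bounds(2) unfolding Delta_opt_def F_opt_eq by (simp add: right_diff_distrib)
qed

text \<open>By \<open>sq_sum\<close>, a^2 - v^2 = d a^2 - 1, and this equals p / (d^2 - 1) exactly.
  Dividing by a + v isolates the factor p, so only the limit of a + v is needed later.\<close>

lemma amp_gap: "amp d p - amp_low d p = p / ((d\<^sup>2 - 1) * (amp d p + amp_low d p))"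
proof -
  have d4: "4 \<le> d\<^sup>2" by (rule d_sq_ge[OF d_ge])
  have "(amp d p)\<^sup>2 = d * (lam4 d p / (d\<^sup>2 - 1))" using d_ge lam4_ratio_pos by (simp add: amp_def power_mult_distrib)
  then have "d * (amp d p)\<^sup>2 = (d\<^sup>2 * lam4 d p) / (d\<^sup>2 - 1)" by (simp add: power2_eq_square)
  also have "d\<^sup>2 * lam4 d p = (d\<^sup>2 - 1) + p" using d_ge by (simp add: lam4_def)
  also have "((d\<^sup>2 - 1) + p) / (d\<^sup>2 - 1) = 1 + p / (d\<^sup>2 - 1)" using d4 by (simp add: add_divide_distrib)
  finally have "(amp d p)\<^sup>2 - (amp_low d p)\<^sup>2 = p / (d\<^sup>2 - 1)"
    using sq_sum by (simp add: left_diff_distrib)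
  then have "(amp d p - amp_low d p) * (amp d p + amp_low d p) = p / (d\<^sup>2 - 1)"
    by (simp add: power2_eq_square algebra_simps)
  moreover have "amp d p + amp_low d p \<noteq> 0" using a_pos low_pos by simp
  ultimately have "amp d p - amp_low d p = p / (d\<^sup>2 - 1) / (amp d p + amp_low d p)"
    by (rule eq_divide_imp[rotated])
  then show ?thesis by simp
qed

end

section \<open>Asymptotics\<close>

context
  fixes d :: real
  assumes d: "2 \<le> d"
begin

lemma lam_tendsto:
  "(lam1 d \<longlongrightarrow> 1) (at_right 0)" "(lam4 d \<longlongrightarrow> (d\<^sup>2 - 1) / d\<^sup>2) (at_right 0)"
  "(lam5 d \<longlongrightarrow> 1 / d\<^sup>2) (at_right 0)" "(xi d \<longlongrightarrow> 0) (at_right 0)"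
proof -
  have d4: "4 \<le> d\<^sup>2" and d0: "d \<noteq> 0" using d_sq_ge[OF d] d by auto
  show 1: "(lam1 d \<longlongrightarrow> 1) (at_right 0)"
    unfolding lam1_def[abs_def] using d4 by (auto intro!: tendsto_eq_intros)
  show 4: "(lam4 d \<longlongrightarrow> (d\<^sup>2 - 1) / d\<^sup>2) (at_right 0)"
    unfolding lam4_def[abs_def] using d0 by (auto intro!: tendsto_eq_intros)
  show "(lam5 d \<longlongrightarrow> 1 / d\<^sup>2) (at_right 0)"
    unfolding lam5_def[abs_def] using d0 by (auto intro!: tendsto_eq_intros)
  have l4: "d\<^sup>2 * ((d\<^sup>2 - 1) / d\<^sup>2) \<noteq> 0" "(d\<^sup>2 - 1) / d\<^sup>2 \<noteq> 0" using d4 d0 by auto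
  have "((\<lambda>p. (1 - lam1 d p) * (d\<^sup>2 * lam1 d p - 1) / (d\<^sup>2 * lam4 d p)) \<longlongrightarrow>
      (1 - 1) * (d\<^sup>2 * 1 - 1) / (d\<^sup>2 * ((d\<^sup>2 - 1) / d\<^sup>2))) (at_right 0)"
    by (intro tendsto_intros 1 4 l4)
  then have 2: "(lam2 d \<longlongrightarrow> 0) (at_right 0)" by (simp add: lam2_def[abs_def])
  have "((\<lambda>p. 2 * (1 - lam1 d p)\<^sup>2 / (d\<^sup>2 * lam4 d p)) \<longlongrightarrow>
      2 * (1 - 1)\<^sup>2 / (d\<^sup>2 * ((d\<^sup>2 - 1) / d\<^sup>2))) (at_right 0)"
    by (intro tendsto_intros 1 4 l4)
  then have 3: "(lam3 d \<longlongrightarrow> 0) (at_right 0)" by (simp add: lam3_def[abs_def])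
  have "((\<lambda>p. lam3 d p + lam2 d p / lam4 d p) \<longlongrightarrow> 0 + 0 / ((d\<^sup>2 - 1) / d\<^sup>2)) (at_right 0)"
    by (intro tendsto_intros 2 3 4 l4)
  then show "(xi d \<longlongrightarrow> 0) (at_right 0)" by (simp add: xi_def[abs_def])
qed

lemma amp_tendsto:
  "(amp d \<longlongrightarrow> 1 / sqrt d) (at_right 0)" "(amp_low d \<longlongrightarrow> 1 / sqrt d) (at_right 0)"
proof -
  have d4: "4 \<le> d\<^sup>2" and d0: "0 < d" using d_sq_ge[OF d] d by auto
  have n: "d\<^sup>2 - 1 \<noteq> 0" using d4 by simp
  have "((\<lambda>p. lam4 d p / (d\<^sup>2 - 1)) \<longlongrightarrow> (d\<^sup>2 - 1) / d\<^sup>2 / (d\<^sup>2 - 1)) (at_right 0)"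
    by (intro tendsto_intros lam_tendsto n)
  then have q: "((\<lambda>p. lam4 d p / (d\<^sup>2 - 1)) \<longlongrightarrow> 1 / d\<^sup>2) (at_right 0)" using n by simp
  have "((\<lambda>p. sqrt d * sqrt (lam4 d p / (d\<^sup>2 - 1))) \<longlongrightarrow> sqrt d * sqrt (1 / d\<^sup>2)) (at_right 0)"
    by (intro tendsto_intros q)
  moreover have "sqrt d * sqrt (1 / d\<^sup>2) = 1 / sqrt d"
    using d0 by (simp add: real_sqrt_divide field_simps)
  ultimately show "(amp d \<longlongrightarrow> 1 / sqrt d) (at_right 0)" by (simp add: amp_def[abs_def])
  have "((\<lambda>p. sqrt ((d - 1) * (lam4 d p / (d\<^sup>2 - 1)) + lam5 d p)) \<longlongrightarrow> sqrt ((d - 1) * (1 / d\<^sup>2) + 1 / d\<^sup>2)) (at_right 0)"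
    by (intro tendsto_intros lam_tendsto q)
  moreover have "(d - 1) * (1 / d\<^sup>2) + 1 / d\<^sup>2 = 1 / d"
    using d0 by (simp add: field_simps power2_eq_square)
  ultimately show "(amp_low d \<longlongrightarrow> 1 / sqrt d) (at_right 0)"
    by (simp add: amp_low_def[abs_def] real_sqrt_divide)
qed

end

text \<open>Write the gap as r p, where r tends to sqrt d / (2 (d^2 - 1)). After division by p^2
  both bounds of \<open>Delta_opt_bounds\<close> tend to (d - 1) / d times the squared limit of r:
  \<open>lam1\<close> tends to 1, while \<open>xi\<close> and the factor
  \<open>sqrt (\<delta> p)\<close> of the correction tend to 0.\<close>

lemma Delta_opt_over_square_tendsto:
  assumes card: "CARD('n::finite) \<ge> 2" and d_eq: "d = real CARD('n)"
  shows "((\<lambda>p. Delta_opt (tau :: complex ^ 'n ^ 'n) (noise p :: ('n \<times> 'n, 'n \<times> 'n) supermap) / p\<^sup>2)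
      \<longlongrightarrow> (d - 1) / (4 * (d\<^sup>2 - 1)\<^sup>2)) (at_right 0)"
proof -
  have d: "2 \<le> d" using card d_eq by simp
  have d4: "4 \<le> d\<^sup>2" and d0: "0 < d" using d_sq_ge[OF d] d by auto
  define D where "D = (\<lambda>p. Delta_opt (tau :: complex ^ 'n ^ 'n) (noise p :: ('n \<times> 'n, 'n \<times> 'n) supermap))"
  define r where "r = (\<lambda>p. 1 / ((d\<^sup>2 - 1) * (amp d p + amp_low d p)))"
  define \<delta> where "\<delta> = (\<lambda>p. amp d p - amp_low d p)"
  define lo where "lo = (\<lambda>p. (lam1 d p - xi d p) * (((d - 1) * (r p)\<^sup>2 - 14 * d * (r p)\<^sup>2 * sqrt (\<delta> p)) / d))"
  define hi where "hi = (\<lambda>p. lam1 d p * ((d - 1) * (r p)\<^sup>2 / d))"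
  have bounds: "lo p \<le> D p / p\<^sup>2 \<and> D p / p\<^sup>2 \<le> hi p" if pos: "0 < p" "p < 1" for p
  proof -
    interpret noise_channel p d "TYPE('n)"
      by unfold_locales (use pos d d_eq in auto)
    have \<delta>: "\<delta> p = r p * p" unfolding \<delta>_def r_def amp_gap by simp
    have lo: "lo p = (lam1 d p - xi d p) * (((d - 1) * (\<delta> p)\<^sup>2 - 14 * d * (\<delta> p)\<^sup>2 * sqrt (\<delta> p)) / d) / p\<^sup>2"
    proof -
      have r: "(r p)\<^sup>2 = (\<delta> p)\<^sup>2 / p\<^sup>2" using pos by (simp add: \<delta> power_mult_distrib)
      show ?thesis unfolding lo_def r using pos d0 by (simp add: divide_simps)
    qed
    have hi: "hi p = lam1 d p * ((d - 1) * (\<delta> p)\<^sup>2 / d) / p\<^sup>2"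
      unfolding hi_def using pos by (simp add: \<delta> power_mult_distrib)
    show ?thesis
      unfolding lo hi D_def \<delta>_def using Delta_opt_bounds by (intro conjI divide_right_mono) auto
  qed
  have ev: "\<forall>\<^sub>F p in at_right 0. 0 < p \<and> p < (1 :: real)"
    by (rule eventually_at_rightI[of 0 1]) auto
  have r: "(r \<longlongrightarrow> sqrt d / (2 * (d\<^sup>2 - 1))) (at_right 0)"
  proof -
    have "(r \<longlongrightarrow> 1 / ((d\<^sup>2 - 1) * (1 / sqrt d + 1 / sqrt d))) (at_right 0)"
      unfolding r_def using d0 d4 by (intro tendsto_intros amp_tendsto[OF d]) auto
    moreover have "1 / ((d\<^sup>2 - 1) * (1 / sqrt d + 1 / sqrt d)) = sqrt d / (2 * (d\<^sup>2 - 1))"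
      using d0 by (simp add: field_simps)
    ultimately show ?thesis by (simp only:)
  qed
  have \<delta>: "(\<delta> \<longlongrightarrow> 0) (at_right 0)"
    unfolding \<delta>_def using tendsto_diff[OF amp_tendsto[OF d]] by simp
  have val: "(d - 1) * (sqrt d / (2 * (d\<^sup>2 - 1)))\<^sup>2 / d = (d - 1) / (4 * (d\<^sup>2 - 1)\<^sup>2)"
    unfolding power_divide power_mult_distrib using d0 by simp
  have "(hi \<longlongrightarrow> 1 * ((d - 1) * (sqrt d / (2 * (d\<^sup>2 - 1)))\<^sup>2 / d)) (at_right 0)"
    unfolding hi_def using d0 by (intro tendsto_intros lam_tendsto[OF d] r) auto
  then have hi: "(hi \<longlongrightarrow> (d - 1) / (4 * (d\<^sup>2 - 1)\<^sup>2)) (at_right 0)" by (simp only: val mult_1)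
  have "(lo \<longlongrightarrow> (1 - 0) * (((d - 1) * (sqrt d / (2 * (d\<^sup>2 - 1)))\<^sup>2 - 14 * d * (sqrt d / (2 * (d\<^sup>2 - 1)))\<^sup>2 * sqrt 0) / d)) (at_right 0)"
    unfolding lo_def using d0 by (intro tendsto_intros lam_tendsto[OF d] r \<delta>) auto
  then have lo: "(lo \<longlongrightarrow> (d - 1) / (4 * (d\<^sup>2 - 1)\<^sup>2)) (at_right 0)"
    by (simp only: val mult_1 real_sqrt_zero mult_zero_right diff_zero)
  have "((\<lambda>p. D p / p\<^sup>2) \<longlongrightarrow> (d - 1) / (4 * (d\<^sup>2 - 1)\<^sup>2)) (at_right 0)"
    by (rule tendsto_sandwich[OF _ _ lo hi]) (use ev bounds in \<open>auto elim!: eventually_mono\<close>)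
  then show ?thesis by (simp only: D_def)
qed

text \<open>Everything rests on the limit of the difference over p^2. The little-o claim restates
  it, and since the error is p / (d^2 - 2) exactly by \<open>F_opt_eq\<close>, the last quotient is
  the first one times (d^2 - 2)^2 for small positive p.\<close>

theorem corollaryS1:
  fixes d :: real
    and \<tau> :: "complex ^ 'n ^ 'n"
    and \<N> :: "real \<Rightarrow> ('n \<times> 'n, 'n \<times> 'n) supermap"
  assumes "CARD('n) \<ge> 2" and "d = real CARD('n)" and "\<tau> = tau" and "\<N> = noise"
  shows "(\<lambda>p. Delta_opt \<tau> (\<N> p) - (d - 1) / (4 * (d\<^sup>2 - 1)\<^sup>2) * p\<^sup>2) \<in> o[at_right 0](\<lambda>p. p\<^sup>2)
    \<and> (\<forall>p. 0 \<le> p \<and> p < 1 \<longrightarrow> eps_opt \<tau> (\<N> p) = p / (d\<^sup>2 - 2))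
    \<and> ((\<lambda>p. Delta_opt \<tau> (\<N> p) / (eps_opt \<tau> (\<N> p))\<^sup>2)
         \<longlongrightarrow> (d - 1) / 4 * ((d\<^sup>2 - 2) / (d\<^sup>2 - 1))\<^sup>2) (at_right 0)"
proof -
  define L where "L = (d - 1) / (4 * (d\<^sup>2 - 1)\<^sup>2)"
  have d: "2 \<le> d" using assms by simp
  have d4: "4 \<le> d\<^sup>2" by (rule d_sq_ge[OF d])
  have lim: "((\<lambda>p. Delta_opt \<tau> (\<N> p) / p\<^sup>2) \<longlongrightarrow> L) (at_right 0)"
    unfolding L_def assms(3,4) by (rule Delta_opt_over_square_tendsto[OF assms(1,2)])
  have ev: "\<forall>\<^sub>F p in at_right 0. 0 < p \<and> p < (1 :: real)"
    by (rule eventually_at_rightI[of 0 1]) auto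
  have "((\<lambda>p. (Delta_opt \<tau> (\<N> p) - L * p\<^sup>2) / p\<^sup>2) \<longlongrightarrow> 0) (at_right 0)"
  proof (rule Lim_transform_eventually)
    show "((\<lambda>p. Delta_opt \<tau> (\<N> p) / p\<^sup>2 - L) \<longlongrightarrow> 0) (at_right 0)"
      using tendsto_diff[OF lim tendsto_const[of L]] by simp
    show "\<forall>\<^sub>F p in at_right 0. Delta_opt \<tau> (\<N> p) / p\<^sup>2 - L = (Delta_opt \<tau> (\<N> p) - L * p\<^sup>2) / p\<^sup>2"
      using ev by eventually_elim (simp add: diff_divide_distrib)
  qed
  then have o: "(\<lambda>p. Delta_opt \<tau> (\<N> p) - L * p\<^sup>2) \<in> o[at_right 0](\<lambda>p. p\<^sup>2)"
    by (rule smalloI_tendsto) (use ev in \<open>auto elim!: eventually_mono\<close>)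
  have eps: "eps_opt \<tau> (\<N> p) = p / (d\<^sup>2 - 2)" if p: "0 \<le> p" "p < 1" for p
  proof -
    interpret noise_channel p d "TYPE('n)"
      by unfold_locales (use p d assms(2) in auto)
    show ?thesis unfolding eps_opt_def assms(3,4) F_opt_eq by (simp add: lam1_def)
  qed
  have "((\<lambda>p. Delta_opt \<tau> (\<N> p) / (eps_opt \<tau> (\<N> p))\<^sup>2) \<longlongrightarrow> L * (d\<^sup>2 - 2)\<^sup>2) (at_right 0)"
  proof (rule Lim_transform_eventually)
    show "((\<lambda>p. Delta_opt \<tau> (\<N> p) / p\<^sup>2 * (d\<^sup>2 - 2)\<^sup>2) \<longlongrightarrow> L * (d\<^sup>2 - 2)\<^sup>2) (at_right 0)"
      by (intro tendsto_intros lim)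
    show "\<forall>\<^sub>F p in at_right 0. Delta_opt \<tau> (\<N> p) / p\<^sup>2 * (d\<^sup>2 - 2)\<^sup>2 = Delta_opt \<tau> (\<N> p) / (eps_opt \<tau> (\<N> p))\<^sup>2"
      using ev by eventually_elim (simp add: eps power_divide)
  qed
  moreover have "L * (d\<^sup>2 - 2)\<^sup>2 = (d - 1) / 4 * ((d\<^sup>2 - 2) / (d\<^sup>2 - 1))\<^sup>2"
    by (simp add: L_def power_divide)
  ultimately show ?thesis using o eps unfolding L_def by (intro conjI allI impI) (simp_all only:)
qed

end
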